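(* Let $X$ be a Banach space. Then $\operatorname{wbs}(B_X)=0$ if $X$ has the weak Banach-Saks property, and $\operatorname{wbs}(B_X)=2$ otherwise. Moreover: (i) there is a separable reflexive Banach space $X$ with $\operatorname{bs}(B_X)=\operatorname{wbs}(B_X)=2$; (ii) there is a nonreflexive Banach space $X$ with separable dual such that $\operatorname{bs}(B_X)=\operatorname{wbs}(B_X)=2$; (iii) for $X=C[0,1]$ one has $\operatorname{bs}(B_X)=\operatorname{wbs}(B_X)=2$.
   Context: $B_X$ is the closed unit ball of $X$. A Banach space has the weak Banach-Saks property if every weakly convergent sequence in it has a subsequence $(x_{k_n})$ whose arithmetic means $\frac1m\sum_{n=1}^m x_{k_n}$ converge in norm. For a bounded sequence: $\operatorname{ca}(x_k)=\inf_{n}\sup\{\|x_k-x_l\|: k,l\ge n\}$, $\operatorname{cca}(x_k)=\operatorname{ca}(\frac1k\sum_{i=1}^k x_i)$, $\widetilde{\operatorname{cca}}(x_k)=\inf$ of $\operatorname{cca}$ over all subsequences. $\operatorname{bs}(A)=\sup\{\widetilde{\operatorname{cca}}(x_k): (x_k)\subset A\}$ and $\operatorname{wbs}(A)=\sup\{\widetilde{\operatorname{cca}}(x_k): (x_k)\subset A\text{ weakly convergent}\}$. *)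

theory Defs
  imports "HOL-Analysis.Analysis"
begin

text \<open>A (real) Banach space is represented as a pair (V, nrm): a linear subspace V of an
ambient real vector space 'a together with a function nrm which is a complete norm on V.
(The ambient vector operations are only used on V.)\<close>

definition banach_space :: "'a::real_vector set \<Rightarrow> ('a \<Rightarrow> real) \<Rightarrow> bool" where
  "banach_space V nrm \<longleftrightarrow>
     subspace V \<and>
     (\<forall>x\<in>V. nrm x = 0 \<longleftrightarrow> x = 0) \<and>
     (\<forall>x\<in>V. \<forall>y\<in>V. nrm (x + y) \<le> nrm x + nrm y) \<and>
     (\<forall>x\<in>V. \<forall>c. nrm (c *\<^sub>R x) = \<bar>c\<bar> * nrm x) \<and>
     (\<forall>s. (\<forall>n. s n \<in> V) \<and> (\<forall>e>0. \<exists>N. \<forall>m\<ge>N. \<forall>n\<ge>N. nrm (s m - s n) < e)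
          \<longrightarrow> (\<exists>x\<in>V. (\<lambda>n. nrm (s n - x)) \<longlonglongrightarrow> 0))"

definition unit_ball :: "'a::real_vector set \<Rightarrow> ('a \<Rightarrow> real) \<Rightarrow> 'a set" where
  "unit_ball V nrm = {x\<in>V. nrm x \<le> 1}"

definition dual_space :: "'a::real_vector set \<Rightarrow> ('a \<Rightarrow> real) \<Rightarrow> ('a \<Rightarrow> real) set" where
  "dual_space V nrm = {f.
     (\<forall>x\<in>V. \<forall>y\<in>V. f (x + y) = f x + f y) \<and>
     (\<forall>x\<in>V. \<forall>c. f (c *\<^sub>R x) = c * f x) \<and>
     (\<exists>C. \<forall>x\<in>V. \<bar>f x\<bar> \<le> C * nrm x)}"

definition dual_norm :: "'a::real_vector set \<Rightarrow> ('a \<Rightarrow> real) \<Rightarrow> ('a \<Rightarrow> real) \<Rightarrow> real" where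
  "dual_norm V nrm f = (SUP x\<in>unit_ball V nrm. \<bar>f x\<bar>)"

definition reflexive_space :: "'a::real_vector set \<Rightarrow> ('a \<Rightarrow> real) \<Rightarrow> bool" where
  "reflexive_space V nrm \<longleftrightarrow>
     (\<forall>\<Phi> :: ('a \<Rightarrow> real) \<Rightarrow> real.
        (\<forall>f\<in>dual_space V nrm. \<forall>g\<in>dual_space V nrm. \<Phi> (\<lambda>x. f x + g x) = \<Phi> f + \<Phi> g) \<and>
        (\<forall>f\<in>dual_space V nrm. \<forall>c. \<Phi> (\<lambda>x. c * f x) = c * \<Phi> f) \<and>
        (\<exists>C. \<forall>f\<in>dual_space V nrm. \<bar>\<Phi> f\<bar> \<le> C * dual_norm V nrm f)
        \<longrightarrow> (\<exists>x\<in>V. \<forall>f\<in>dual_space V nrm. \<Phi> f = f x))"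

definition separable_space :: "'a::real_vector set \<Rightarrow> ('a \<Rightarrow> real) \<Rightarrow> bool" where
  "separable_space V nrm \<longleftrightarrow>
     (\<exists>D. countable D \<and> D \<subseteq> V \<and> (\<forall>x\<in>V. \<forall>e>0. \<exists>d\<in>D. nrm (x - d) < e))"

definition separable_dual :: "'a::real_vector set \<Rightarrow> ('a \<Rightarrow> real) \<Rightarrow> bool" where
  "separable_dual V nrm \<longleftrightarrow>
     (\<exists>D. countable D \<and> D \<subseteq> dual_space V nrm \<and>
        (\<forall>f\<in>dual_space V nrm. \<forall>e>0. \<exists>g\<in>D. dual_norm V nrm (\<lambda>x. f x - g x) < e))"

definition weakly_convergent_to :: "'a::real_vector set \<Rightarrow> ('a \<Rightarrow> real) \<Rightarrow> (nat \<Rightarrow> 'a) \<Rightarrow> 'a \<Rightarrow> bool" where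
  "weakly_convergent_to V nrm s x \<longleftrightarrow>
     (\<forall>k. s k \<in> V) \<and> x \<in> V \<and> (\<forall>f\<in>dual_space V nrm. (\<lambda>k. f (s k)) \<longlonglongrightarrow> f x)"

definition weakly_convergent :: "'a::real_vector set \<Rightarrow> ('a \<Rightarrow> real) \<Rightarrow> (nat \<Rightarrow> 'a) \<Rightarrow> bool" where
  "weakly_convergent V nrm s \<longleftrightarrow> (\<exists>x. weakly_convergent_to V nrm s x)"

definition means :: "(nat \<Rightarrow> 'a::real_vector) \<Rightarrow> nat \<Rightarrow> 'a" where
  "means s m = (1 / real (Suc m)) *\<^sub>R (\<Sum>i\<le>m. s i)"

definition weak_banach_saks :: "'a::real_vector set \<Rightarrow> ('a \<Rightarrow> real) \<Rightarrow> bool" where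
  "weak_banach_saks V nrm \<longleftrightarrow>
     (\<forall>s. weakly_convergent V nrm s \<longrightarrow>
        (\<exists>r. strict_mono r \<and> (\<exists>y\<in>V. (\<lambda>m. nrm (means (s \<circ> r) m - y)) \<longlonglongrightarrow> 0)))"

definition ca :: "('a::real_vector \<Rightarrow> real) \<Rightarrow> (nat \<Rightarrow> 'a) \<Rightarrow> real" where
  "ca nrm s = (INF n. SUP p\<in>{n..} \<times> {n..}. nrm (s (fst p) - s (snd p)))"

definition cca :: "('a::real_vector \<Rightarrow> real) \<Rightarrow> (nat \<Rightarrow> 'a) \<Rightarrow> real" where
  "cca nrm s = ca nrm (means s)"

definition cca_tilde :: "('a::real_vector \<Rightarrow> real) \<Rightarrow> (nat \<Rightarrow> 'a) \<Rightarrow> real" where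
  "cca_tilde nrm s = (INF r\<in>{r. strict_mono r}. cca nrm (s \<circ> r))"

definition bs :: "'a::real_vector set \<Rightarrow> ('a \<Rightarrow> real) \<Rightarrow> 'a set \<Rightarrow> real" where
  "bs V nrm A = (SUP s\<in>{s. \<forall>k. s k \<in> A}. cca_tilde nrm s)"

definition wbs :: "'a::real_vector set \<Rightarrow> ('a \<Rightarrow> real) \<Rightarrow> 'a set \<Rightarrow> real" where
  "wbs V nrm A = (SUP s\<in>{s. (\<forall>k. s k \<in> A) \<and> weakly_convergent V nrm s}. cca_tilde nrm s)"

text \<open>C[0,1] realized inside the bounded continuous functions on the real line: each
continuous g on [0,1] corresponds to its unique extension that is constant on
(-\<infinity>,0] and on [1,\<infinity>); the norm is the sup norm over [0,1].\<close>
definition C01 :: "(real \<Rightarrow>\<^sub>C real) set" where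
  "C01 = {f. \<forall>t. apply_bcontfun f t = apply_bcontfun f (max 0 (min 1 t))}"

definition C01_norm :: "(real \<Rightarrow>\<^sub>C real) \<Rightarrow> real" where
  "C01_norm f = (SUP t\<in>{0..1}. \<bar>apply_bcontfun f t\<bar>)"

end

(*
Suppose a weakly null sequence has no subsequence with null Cesaro means. By weak-star compactness of the dual
ball and Ramsey's theorem some subsequence satisfies a lower l_1 estimate on all sets F with card F < min F, and
James's non-distortion argument turns it into normalised weakly null blocks whose lower l_1 constant is
asymptotically as close to 1 as desired. After thinning out, a mean of q^4 terms and a mean of q^2 terms differ by
almost 2 in norm, also for subsequences, so wbs of the unit ball is 2.

For the examples it remains to exhibit spaces without the weak Banach-Saks property. Baernstein's norm (l_2-sums
over disjoint Schreier sets) on all coordinates gives the reflexive one; using it on the even coordinates only and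
the supremum norm elsewhere gives the nonreflexive one with separable dual. In C[0,1] truncated sums of
ternary digits give a weakly null sequence with Schreier's property.
*)

theory Submission
  imports Defs "HOL-Library.Ramsey" "HOL-Library.Diagonal_Subsequence"
begin

section \<open>Sublinear functionals\<close>

text \<open>The carrier is a mere subset, with a norm that is meaningful only there. The extraction
  is therefore done for a seminorm on the whole type; a Banach pair enters by composing its norm
  with an algebraic projection onto the carrier.

  Weak nullity controls the signs. A functional that is large on a set of vectors bounds only sums
  with nonnegative coefficients from below. Far out there are finite index sets on which no
  functional of norm one is large throughout, so a functional can be kept large on prescribed
  positions and small on the others, which serves every choice of signs.

  The value 2 arises since the difference of the two means has coefficients of both signs, each sign
  carrying mass nearly 1. As every failure is amplified to 2, the examples need only the crude lower
  bound 1/2 for means.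

  In the sequence spaces every functional is a norm limit of its truncations to finitely many
  coordinates. This gives weak nullity of unit vectors, separability of the dual and the
  representation of bidual functionals. Reflexivity then depends on whether a finite norm forces
  vanishing tails, which the supremum-norm coordinates prevent.\<close>

definition sublinear :: "('a::real_vector \<Rightarrow> real) \<Rightarrow> bool" where
  "sublinear q \<longleftrightarrow> (\<forall>x y. q (x + y) \<le> q x + q y) \<and> (\<forall>c>0. \<forall>x. q (c *\<^sub>R x) \<le> c * q x)"

lemma sublinear_add: "sublinear q \<Longrightarrow> q (x + y) \<le> q x + q y"
  and sublinear_scale_le: "sublinear q \<Longrightarrow> 0 < c \<Longrightarrow> q (c *\<^sub>R x) \<le> c * q x"
  by (auto simp: sublinear_def)

lemma sublinear_0: "sublinear q \<Longrightarrow> q 0 = 0"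
  using sublinear_add[of q 0 0] sublinear_scale_le[of q "1 / 2" 0] by simp

lemma sublinear_scale:
  assumes q: "sublinear q" and c: "0 \<le> c"
  shows "q (c *\<^sub>R x) = c * q x"
proof (cases "c = 0")
  case False
  with c have c: "0 < c" by simp
  have "q x \<le> 1 / c * q (c *\<^sub>R x)"
    using sublinear_scale_le[OF q, of "1 / c" "c *\<^sub>R x"] c by simp
  then show ?thesis
    using sublinear_scale_le[OF q c, of x] c by (simp add: field_simps)
qed (simp add: sublinear_0[OF q])

lemma sublinear_minus: "sublinear q \<Longrightarrow> - q (- x) \<le> q x"
  using sublinear_add[of q x "- x"] sublinear_0[of q] by simp

text \<open>The perturbation by which a minimal sublinear functional is recognised as linear: it
  remains sublinear, lies below \<open>q\<close>, and at \<open>- y\<close> drops to at most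
  \<open>- q y\<close>.\<close>

definition shifted :: "('a::real_vector \<Rightarrow> real) \<Rightarrow> 'a \<Rightarrow> 'a \<Rightarrow> real" where
  "shifted q y x = (INF t\<in>{0..}. q (x + t *\<^sub>R y) - t * q y)"

lemma
  assumes q: "sublinear q"
  shows sublinear_shifted: "sublinear (shifted q y)"
    and shifted_le: "shifted q y x \<le> q x"
    and shifted_minus: "shifted q y (- y) \<le> - q y"
proof -
  have lb: "- q (- x) \<le> q (x + t *\<^sub>R y) - t * q y" if "t \<ge> 0" for x t
    using sublinear_add[OF q, of "x + t *\<^sub>R y" "- x"] sublinear_scale[OF q that, of y] by simp
  have bdd: "bdd_below ((\<lambda>t. q (x + t *\<^sub>R y) - t * q y) ` {0..})" for x
    using lb by (auto intro!: bdd_belowI2)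
  have upper: "shifted q y x \<le> q (x + t *\<^sub>R y) - t * q y" if "t \<ge> 0" for x t
    unfolding shifted_def using that by (intro cINF_lower bdd) auto
  have greatest: "b \<le> shifted q y x" if "\<And>t. t \<ge> 0 \<Longrightarrow> b \<le> q (x + t *\<^sub>R y) - t * q y" for x b
    unfolding shifted_def using that by (intro cINF_greatest) auto
  show "shifted q y x \<le> q x"
    using upper[of 0 x] by simp
  show "shifted q y (- y) \<le> - q y"
    using upper[of 1 "- y"] sublinear_0[OF q] by simp
  show "sublinear (shifted q y)"
    unfolding sublinear_def
  proof (intro conjI allI impI)
    fix u v
    have "shifted q y (u + v) - (q (v + t *\<^sub>R y) - t * q y) \<le> shifted q y u" if t: "t \<ge> 0" for t
    proof (rule greatest)
      fix s :: real
      assume s: "s \<ge> 0"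
      have "shifted q y (u + v) \<le> q ((u + s *\<^sub>R y) + (v + t *\<^sub>R y)) - (s + t) * q y"
        using upper[of "s + t" "u + v"] s t by (simp add: algebra_simps)
      also have "\<dots> \<le> q (u + s *\<^sub>R y) + q (v + t *\<^sub>R y) - (s + t) * q y"
        using sublinear_add[OF q] by simp
      finally show "shifted q y (u + v) - (q (v + t *\<^sub>R y) - t * q y) \<le> q (u + s *\<^sub>R y) - s * q y"
        by (simp add: algebra_simps)
    qed
    then have "shifted q y (u + v) - shifted q y u \<le> shifted q y v"
      by (intro greatest) (simp add: algebra_simps)
    then show "shifted q y (u + v) \<le> shifted q y u + shifted q y v"
      by simp
  next
    fix c :: real and x
    assume c: "c > 0"
    have "shifted q y (c *\<^sub>R x) / c \<le> shifted q y x"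
    proof (rule greatest)
      fix t :: real
      assume t: "t \<ge> 0"
      have "shifted q y (c *\<^sub>R x) \<le> c * (q (x + t *\<^sub>R y) - t * q y)"
        using upper[of "c * t" "c *\<^sub>R x"] sublinear_scale[OF q, of c "x + t *\<^sub>R y"] t c
        by (simp add: scaleR_add_right right_diff_distrib mult.assoc)
      then show "shifted q y (c *\<^sub>R x) / c \<le> q (x + t *\<^sub>R y) - t * q y"
        using c by (simp add: pos_divide_le_eq mult.commute)
    qed
    then show "shifted q y (c *\<^sub>R x) \<le> c * shifted q y x"
      using c by (simp add: field_simps)
  qed
qed

text \<open>Hahn-Banach in its dominated form. Zorn's lemma for the reversed pointwise order gives a
  minimal sublinear functional below \<open>p\<close>. By minimality it equals each of its shifts,
  which makes it odd; subadditivity at \<open>x\<close>, \<open>y\<close> and at their negatives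
  then yields additivity.\<close>

lemma ex_linear_le_sublinear:
  assumes p: "sublinear p"
  shows "\<exists>f. linear f \<and> (\<forall>x. f x \<le> p x)"
proof -
  define A where "A = {q. sublinear q \<and> (\<forall>x. q x \<le> p x)}"
  define P where "P = (\<lambda>q r :: 'a \<Rightarrow> real. \<forall>x. r x \<le> q x)"
  have "\<exists>m\<in>A. \<forall>a\<in>A. P m a \<longrightarrow> a = m"
  proof (rule predicate_Zorn)
    show "partial_order_on A (relation_of P A)"
      by (rule partial_order_on_relation_ofI)
        (auto simp: P_def fun_eq_iff intro: order_trans antisym)
    fix C
    assume C: "C \<in> Chains (relation_of P A)"
    then have CA: "C \<subseteq> A"
      by (auto simp: Chains_def relation_of_def)
    show "\<exists>u\<in>A. \<forall>a\<in>C. P a u"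
    proof (cases "C = {}")
      case True
      then show ?thesis using p by (auto simp: A_def)
    next
      case ne: False
      have sub: "sublinear q" if "q \<in> C" for q
        using CA that by (auto simp: A_def)
      define u where "u = (\<lambda>x. INF q\<in>C. q x)"
      have bdd: "bdd_below ((\<lambda>q. q x) ` C)" for x
      proof (rule bdd_belowI2)
        fix q
        assume q: "q \<in> C"
        then have "q (- x) \<le> p (- x)" using CA by (auto simp: A_def)
        then show "- p (- x) \<le> q x"
          using sublinear_minus[OF sub[OF q], of x] by simp
      qed
      have upper: "u x \<le> q x" if "q \<in> C" for q x
        unfolding u_def using that by (intro cINF_lower bdd)
      have greatest: "b \<le> u x" if "\<And>q. q \<in> C \<Longrightarrow> b \<le> q x" for b x
        unfolding u_def using that ne by (intro cINF_greatest)
      have "sublinear u"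
        unfolding sublinear_def
      proof (intro conjI allI impI)
        fix x y
        \<comment> \<open>In a chain the smaller of \<open>q\<close> and \<open>r\<close> serves
          both summands; this is where the chain condition gives subadditivity of the
          infimum.\<close>
        have *: "u (x + y) \<le> q x + r y" if q: "q \<in> C" and r: "r \<in> C" for q r
        proof -
          have "P q r \<or> P r q"
            using C q r by (auto simp: Chains_def relation_of_def)
          then show ?thesis
          proof
            assume "P q r"
            then have "u (x + y) \<le> r x + r y" "r x \<le> q x"
              using upper[OF r, of "x + y"] sublinear_add[OF sub[OF r], of x y] by (auto simp: P_def)
            then show ?thesis by simp
          next
            assume "P r q"
            then have "u (x + y) \<le> q x + q y" "q y \<le> r y"
              using upper[OF q, of "x + y"] sublinear_add[OF sub[OF q], of x y] by (auto simp: P_def)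
            then show ?thesis by simp
          qed
        qed
        have "u (x + y) - q x \<le> u y" if "q \<in> C" for q
        proof (rule greatest)
          fix r assume "r \<in> C"
          from *[OF that this] show "u (x + y) - q x \<le> r y" by simp
        qed
        then have "u (x + y) - u y \<le> u x"
          by (intro greatest) (simp add: algebra_simps)
        then show "u (x + y) \<le> u x + u y" by simp
      next
        fix c :: real and x
        assume c: "c > 0"
        have "u (c *\<^sub>R x) / c \<le> u x"
        proof (rule greatest)
          fix q assume "q \<in> C"
          then show "u (c *\<^sub>R x) / c \<le> q x"
            using upper[of q "c *\<^sub>R x"] sublinear_scale[OF sub, of q c x] c
            by (simp add: field_simps)
        qed
        then show "u (c *\<^sub>R x) \<le> c * u x" using c by (simp add: field_simps)
      qed
      moreover have "u x \<le> p x" for x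
      proof -
        obtain q where q: "q \<in> C" using ne by blast
        then have "q x \<le> p x" using CA by (auto simp: A_def)
        with upper[OF q, of x] show ?thesis by simp
      qed
      ultimately show ?thesis
        using upper by (auto simp: A_def P_def)
    qed
  qed
  then obtain m where "m \<in> A" and minA: "\<And>a. a \<in> A \<Longrightarrow> P m a \<Longrightarrow> a = m"
    by blast
  then have m: "sublinear m" "\<And>x. m x \<le> p x"
    by (auto simp: A_def)
  have min: "q = m" if "sublinear q" "\<And>x. q x \<le> m x" for q
    using that order_trans[OF that(2) m(2)] by (intro minA) (auto simp: A_def P_def)
  have "shifted m y = m" for y
    by (intro min sublinear_shifted m shifted_le)
  then have minus: "m (- y) = - m y" for y
    using shifted_minus[OF m(1), of y] sublinear_minus[OF m(1), of "- y"] by simp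
  have "linear m"
  proof (rule linearI)
    fix x y
    show "m (x + y) = m x + m y"
      using sublinear_add[OF m(1), of x y] sublinear_add[OF m(1), of "- x" "- y"]
      by (simp add: minus[of x] minus[of y] minus[of "x + y", simplified])
  next
    fix c x
    show "m (c *\<^sub>R x) = c *\<^sub>R m x"
    proof (cases "c \<ge> 0")
      case True
      then show ?thesis using sublinear_scale[OF m(1)] by simp
    next
      case False
      then have "m ((- c) *\<^sub>R x) = (- c) * m x"
        by (intro sublinear_scale[OF m(1)]) simp
      then show ?thesis using minus[of "c *\<^sub>R x"] by simp
    qed
  qed
  with m(2) show ?thesis by blast
qed

section \<open>Seminorms\<close>

locale seminorm =
  fixes p :: "'a::real_vector \<Rightarrow> real"
  assumes tri: "p (x + y) \<le> p x + p y"
    and homog: "p (c *\<^sub>R x) = \<bar>c\<bar> * p x"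
begin

lemma p_0 [simp]: "p 0 = 0"
  using homog[of 0 0] by simp

lemma p_minus [simp]: "p (- x) = p x"
  using homog[of "- 1" x] by simp

lemma p_ge_0 [simp]: "0 \<le> p x"
  using tri[of x "- x"] by simp

lemma tri_minus: "p (x - y) \<le> p x + p y"
  using tri[of x "- y"] by simp

lemma tri_sum: "p (sum g A) \<le> (\<Sum>i\<in>A. p (g i))"
proof (induction A rule: infinite_finite_induct)
  case (insert a A)
  then show ?case using tri[of "g a" "sum g A"] by simp
qed auto

definition dual_ball :: "('a \<Rightarrow> real) set" where
  "dual_ball = {f. linear f \<and> (\<forall>x. \<bar>f x\<bar> \<le> p x)}"

lemma dual_ball_linear: "f \<in> dual_ball \<Longrightarrow> linear f"
  and dual_ball_le: "f \<in> dual_ball \<Longrightarrow> \<bar>f x\<bar> \<le> p x"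
  by (auto simp: dual_ball_def)

lemma dual_ball_minus: "f \<in> dual_ball \<Longrightarrow> (\<lambda>x. - f x) \<in> dual_ball"
  by (auto simp: dual_ball_def intro: linear_compose_neg)

text \<open>Domination by \<open>shifted p x\<close> instead of \<open>p\<close> forces
  \<open>f (- x) \<le> - p x\<close>, so the functional norms \<open>x\<close> without being
  extended from the line through \<open>x\<close>.\<close>

lemma ex_norming: "\<exists>f\<in>dual_ball. f x = p x"
proof -
  have p: "sublinear p"
    by (auto simp: sublinear_def tri homog)
  obtain f where f: "linear f" "\<And>y. f y \<le> shifted p x y"
    using ex_linear_le_sublinear[OF sublinear_shifted[OF p]] by blast
  have le: "f y \<le> p y" for y
    using f(2) shifted_le[OF p] order_trans by blast
  moreover have "- f y \<le> p y" for y
    using le[of "- y"] linear_neg[OF f(1), of y] by simp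
  ultimately have "f \<in> dual_ball"
    using f(1) by (auto simp: dual_ball_def abs_le_iff)
  moreover have "p x \<le> f x"
    using order_trans[OF f(2) shifted_minus[OF p]] linear_neg[OF f(1), of x] by simp
  ultimately show ?thesis
    using le by (intro bexI[of _ f] antisym)
qed

definition weakly_null :: "(nat \<Rightarrow> 'a) \<Rightarrow> bool" where
  "weakly_null x \<longleftrightarrow> (\<forall>f\<in>dual_ball. (\<lambda>n. f (x n)) \<longlonglongrightarrow> 0)"

lemma weakly_null_subseq: "weakly_null x \<Longrightarrow> strict_mono r \<Longrightarrow> weakly_null (x \<circ> r)"
  unfolding weakly_null_def using LIMSEQ_subseq_LIMSEQ by (fastforce simp: o_def)

text \<open>Banach-Alaoglu: functionals are plain functions, so the product topology is the
  weak-star topology, and the ball is a closed subset of a product of compact intervals.\<close>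

lemma compact_dual_ball: "compact dual_ball"
proof -
  have "compactin (product_topology (\<lambda>x. euclidean) UNIV) (PiE UNIV (\<lambda>x. {- p x..p x}))"
    unfolding compactin_PiE by simp
  then have "compact (PiE UNIV (\<lambda>x. {- p x..p x}))"
    by (simp add: euclidean_product_topology)
  moreover have "closed {f :: 'a \<Rightarrow> real. linear f}"
  proof -
    have cont: "continuous_on UNIV (\<lambda>f :: 'a \<Rightarrow> real. f x)" for x
      by (rule continuous_on_product_coordinates)
    have "{f :: 'a \<Rightarrow> real. linear f} =
        (\<Inter>x. \<Inter>y. {f. f (x + y) = f x + f y}) \<inter> (\<Inter>c. \<Inter>x. {f. f (c *\<^sub>R x) = c *\<^sub>R f x})"
      by (auto simp: linear_iff)
    also have "closed \<dots>"
      by (intro closed_Int closed_INT ballI closed_Collect_eq continuous_intros cont)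
    finally show ?thesis .
  qed
  ultimately have "compact (PiE UNIV (\<lambda>x. {- p x..p x}) \<inter> {f. linear f})"
    by (rule compact_Int_closed)
  also have "PiE UNIV (\<lambda>x. {- p x..p x}) \<inter> {f. linear f} = dual_ball"
    by (auto simp: dual_ball_def abs_le_iff minus_le_iff)
  finally show ?thesis .
qed

text \<open>Otherwise the closed sets of functionals with
  \<open>\<bar>f (x i)\<bar> \<ge> d\<close>, for \<open>i\<close> in \<open>L\<close>, have the
  finite intersection property in the compact dual ball. A common element stays large along an
  infinite set of indices, contrary to weak nullity.\<close>

lemma weakly_null_finite_small:
  assumes x: "weakly_null x" and "0 < d" and L: "infinite L"
  shows "\<exists>P. finite P \<and> P \<subseteq> L \<and> (\<forall>f\<in>dual_ball. \<exists>i\<in>P. \<bar>f (x i)\<bar> < d)"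
proof (rule ccontr)
  assume neg: "\<not> ?thesis"
  define K where "K = (\<lambda>i. {f :: 'a \<Rightarrow> real. d \<le> \<bar>f (x i)\<bar>})"
  have "dual_ball \<inter> \<Inter> (K ` L) \<noteq> {}"
  proof (rule compact_imp_fip[OF compact_dual_ball])
    fix T
    assume "T \<in> K ` L"
    then show "closed T"
      by (auto simp: K_def intro!: closed_Collect_le continuous_intros
          continuous_on_product_coordinates)
  next
    fix F
    assume "finite F" "F \<subseteq> K ` L"
    then obtain P where "finite P" "P \<subseteq> L" "F = K ` P"
      by (meson finite_subset_image)
    then obtain f where "f \<in> dual_ball" "\<And>i. i \<in> P \<Longrightarrow> d \<le> \<bar>f (x i)\<bar>"
      using neg by (meson not_less)
    with \<open>F = K ` P\<close> show "dual_ball \<inter> \<Inter> F \<noteq> {}"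
      by (auto simp: K_def)
  qed
  then obtain f where f: "f \<in> dual_ball" "\<And>i. i \<in> L \<Longrightarrow> d \<le> \<bar>f (x i)\<bar>"
    by (auto simp: K_def)
  have "eventually (\<lambda>n. \<bar>f (x n)\<bar> < d) sequentially"
    using x f(1) \<open>0 < d\<close> tendstoD[of "\<lambda>n. f (x n)" 0 sequentially d]
    by (auto simp: weakly_null_def dist_real_def)
  then obtain N where "\<And>n. n \<ge> N \<Longrightarrow> \<bar>f (x n)\<bar> < d"
    by (auto simp: eventually_sequentially)
  moreover obtain n where "n \<in> L" "n \<ge> N"
    using L unfolding infinite_nat_iff_unbounded_le by blast
  ultimately show False using f(2)[of n] by fastforce
qed

text \<open>The gliding hump: if \<open>p (x (k n)) \<ge> 4 ^ n\<close>, a functional \<open>\<Sum>n. \<plusminus> 3 ^ - n g\<^sub>n\<close> with \<open>g\<^sub>n\<close> norming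
  \<open>x (k n)\<close> and signs chosen inductively is unbounded along the sequence.\<close>

lemma uniform_boundedness:
  assumes x: "\<And>f. f \<in> dual_ball \<Longrightarrow> bounded (range (\<lambda>n. f (x n)))"
  shows "\<exists>C. \<forall>n. p (x n) \<le> C"
proof (rule ccontr)
  assume "\<not> ?thesis"
  then have "\<forall>m::nat. \<exists>n. p (x n) > 4 ^ m"
    by (metis not_le)
  then obtain k where k: "\<And>m. p (x (k m)) > 4 ^ m" by metis
  have "\<forall>m. \<exists>f. f \<in> dual_ball \<and> f (x (k m)) = p (x (k m))"
    using ex_norming by blast
  then obtain g where g: "\<And>m. g m \<in> dual_ball" "\<And>m. g m (x (k m)) = p (x (k m))"
    by metis
  \<comment> \<open>With ratio 1/3 the terms after the m-th have total size at most half of it, so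
    they cannot cancel it; and 4/3 > 1 still leaves growth against \<open>4 ^ m\<close>.\<close>
  define q :: real where "q = 1 / 3"
  define e where "e = (\<lambda>m (s :: 'a \<Rightarrow> real). if s (x (k m)) \<ge> 0 then 1 else - 1 :: real)"
  define S where "S = rec_nat (\<lambda>_. 0) (\<lambda>m s y. s y + e m s * q ^ m * g m y)"
  have S_Suc: "S (Suc m) y = S m y + e m (S m) * q ^ m * g m y" for m y
    by (simp add: S_def)
  have S_0: "S 0 y = 0" for y by (simp add: S_def)
  define c where "c = (\<lambda>m. e m (S m) * q ^ m)"
  have S: "S m y = (\<Sum>i<m. c i * g i y)" for m y
    by (induction m) (simp_all only: S_0 S_Suc c_def sum.lessThan_Suc lessThan_0 sum.empty)
  have c: "\<bar>c i\<bar> = q ^ i" for i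
    by (simp add: c_def e_def q_def abs_mult)
  have term_le: "norm (c i * g i y) \<le> q ^ i * p y" for i y
    using dual_ball_le[OF g(1)] by (auto simp: abs_mult c q_def intro!: mult_left_mono)
  have sq: "summable (\<lambda>i. q ^ i)" "(\<Sum>i. q ^ i) = 3 / 2"
    using suminf_geometric[of q] by (auto simp: q_def intro: summable_geometric)
  have summ: "summable (\<lambda>i. c i * g i y)" for y
    by (rule summable_comparison_test[of _ "\<lambda>i. q ^ i * p y"])
      (use term_le sq in \<open>auto intro: summable_mult2\<close>)
  define F where "F = (\<lambda>y. \<Sum>i. c i * g i y)"
  have lin: "linear F"
  proof (rule linearI)
    show "F (u + v) = F u + F v" for u v
      unfolding F_def using summ
      by (subst suminf_add) (auto simp: linear_add[OF dual_ball_linear[OF g(1)]] algebra_simps)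
    show "F (a *\<^sub>R u) = a *\<^sub>R F u" for a u
      unfolding F_def using suminf_mult[OF summ[of u], of a]
      by (simp add: linear_scale[OF dual_ball_linear[OF g(1)]] algebra_simps)
  qed
  have tail: "\<bar>F y - S m y\<bar> \<le> (3 / 2) * q ^ m * p y" for m y
  proof -
    have "F y - S m y = (\<Sum>i. c (i + m) * g (i + m) y)"
      unfolding F_def S using suminf_minus_initial_segment[OF summ[of y], of m] by simp
    also have "\<bar>\<dots>\<bar> \<le> (\<Sum>i. q ^ m * p y * q ^ i)"
    proof -
      have "norm (c (i + m) * g (i + m) y) \<le> q ^ m * p y * q ^ i" for i
        using term_le[of "i + m" y] by (simp add: power_add mult_ac)
      then show ?thesis
        unfolding real_norm_def[symmetric] by (rule norm_suminf_le) (intro summable_mult sq)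
    qed
    also have "\<dots> = (3 / 2) * q ^ m * p y"
      using sq by (simp add: suminf_mult)
    finally show ?thesis .
  qed
  \<comment> \<open>The geometric series sums to 3/2, hence the factor that brings the functional
    into the dual ball.\<close>
  have "(\<lambda>y. (2 / 3) * F y) \<in> dual_ball"
    using linear_compose_scale_right[OF lin, of "2 / 3"] tail[of _ 0]
    by (auto simp: dual_ball_def S_0 abs_mult mult.commute)
  from x[OF this] obtain B where "\<And>n. \<bar>(2 / 3) * F (x n)\<bar> \<le> B"
    by (auto simp: bounded_iff)
  then have B: "\<bar>F (x n)\<bar> \<le> 3 / 2 * B" for n
    by (simp add: abs_mult field_simps)
  have large: "(4 / 3) ^ m / 2 \<le> \<bar>F (x (k m))\<bar>" for m
  proof -
    define P where "P = q ^ m * p (x (k m))"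
    have "\<bar>S (Suc m) (x (k m))\<bar> \<ge> P"
      by (auto simp: S_Suc e_def g P_def q_def)
    moreover have "\<bar>F (x (k m)) - S (Suc m) (x (k m))\<bar> \<le> P / 2"
      using tail[of "x (k m)" "Suc m"] by (simp add: P_def q_def)
    moreover have "P \<ge> q ^ m * 4 ^ m"
      unfolding P_def using k[of m] by (intro mult_left_mono) (auto simp: q_def)
    moreover have "q ^ m * 4 ^ m = (4 / 3) ^ m"
      by (simp add: q_def flip: power_mult_distrib)
    ultimately show ?thesis by linarith
  qed
  obtain m where "3 * B < (4 / 3) ^ m"
    using real_arch_pow[of "4 / 3" "3 * B"] by auto
  then show False
    using large[of m] B[of "k m"] by linarith
qed

end

section \<open>Ramsey arguments\<close>

lemma strict_mono_on_nth_sorted_list_of_set: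
  assumes "finite A" "k \<le> card A"
  shows "strict_mono_on {..<k} ((!) (sorted_list_of_set A))"
    and "\<And>i. i < k \<Longrightarrow> sorted_list_of_set A ! i \<in> A"
proof -
  have "sorted_wrt (<) (sorted_list_of_set A)"
    by simp
  then show "strict_mono_on {..<k} ((!) (sorted_list_of_set A))"
    using assms by (auto simp: strict_mono_on_def sorted_wrt_iff_nth_less)
  show "\<And>i. i < k \<Longrightarrow> sorted_list_of_set A ! i \<in> A"
    using assms by (metis nth_mem order_less_le_trans set_sorted_list_of_set length_sorted_list_of_set)
qed

lemma sorted_list_of_set_image:
  fixes h :: "nat \<Rightarrow> nat"
  assumes h: "strict_mono_on {..<k} h"
  shows "sorted_list_of_set (h ` {..<k}) = map h [0..<k]"
proof -
  have "inj_on h {..<k}"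
    using h by (rule strict_mono_on_imp_inj_on)
  then have "card (h ` {..<k}) = k"
    by (simp add: card_image)
  moreover have "sorted_wrt (<) (map h [0..<k])"
    using h by (auto simp: sorted_wrt_iff_nth_less strict_mono_on_def)
  ultimately show ?thesis
    using sorted_list_of_set_unique[of "h ` {..<k}" "map h [0..<k]"] by (simp add: atLeast0LessThan)
qed

text \<open>Ramsey's theorem for increasing tuples in place of sets. Because of \<open>cong\<close>
  the colour of a k-set can be read off its sorted enumeration.\<close>

lemma Ramsey_strict_mono:
  fixes P :: "(nat \<Rightarrow> nat) \<Rightarrow> bool"
  assumes cong: "\<And>h h'. (\<And>i. i < k \<Longrightarrow> h i = h' i) \<Longrightarrow> P h \<longleftrightarrow> P h'"
  obtains r :: "nat \<Rightarrow> nat" where "strict_mono r"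
    "(\<forall>h. strict_mono_on {..<k} h \<longrightarrow> P (r \<circ> h)) \<or> (\<forall>h. strict_mono_on {..<k} h \<longrightarrow> \<not> P (r \<circ> h))"
proof -
  define f where "f = (\<lambda>X. if P ((!) (sorted_list_of_set X)) then 1 else 0 :: nat)"
  have "\<forall>X. X \<subseteq> UNIV \<and> finite X \<and> card X = k \<longrightarrow> f X < 2"
    by (simp add: f_def)
  from Ramsey[OF infinite_UNIV_nat this] obtain Y t where Y: "infinite Y"
    and t: "\<forall>X. X \<subseteq> Y \<and> finite X \<and> card X = k \<longrightarrow> f X = t"
    by blast
  define r where "r = enumerate Y"
  have r: "strict_mono r"
    unfolding r_def by (rule strict_mono_enumerate[OF Y])
  have "P (r \<circ> h) \<longleftrightarrow> t = 1" if h: "strict_mono_on {..<k} h" for h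
  proof -
    have rh: "strict_mono_on {..<k} (r \<circ> h)"
      using h r by (auto simp: strict_mono_on_def strict_mono_def)
    have "(r \<circ> h) ` {..<k} \<subseteq> Y"
      using enumerate_in_set[OF Y] by (auto simp: r_def)
    moreover have "card ((r \<circ> h) ` {..<k}) = k"
      using card_image[OF strict_mono_on_imp_inj_on[OF rh]] by (simp only: card_lessThan)
    ultimately have "f ((r \<circ> h) ` {..<k}) = t"
      using t by simp
    moreover have "P ((!) (sorted_list_of_set ((r \<circ> h) ` {..<k}))) \<longleftrightarrow> P (r \<circ> h)"
      unfolding sorted_list_of_set_image[OF rh] by (rule cong) simp
    ultimately show ?thesis
      by (auto simp: f_def split: if_splits)
  qed
  with r that show ?thesis by blast
qed

lemma strict_mono_on_comp_left:
  "strict_mono r \<Longrightarrow> strict_mono_on S h \<Longrightarrow> strict_mono_on S (r \<circ> h)"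
  by (auto simp: strict_mono_on_def strict_mono_def)

section \<open>Lower l_1 estimates from the failure of Cesaro convergence\<close>

context seminorm
begin

text \<open>This is what the absence of Cesaro null subsequences leaves after passing to a suitable subsequence.\<close>

definition persistent :: "real \<Rightarrow> (nat \<Rightarrow> 'a) \<Rightarrow> bool" where
  "persistent e x \<longleftrightarrow> (\<forall>(r :: nat \<Rightarrow> nat) k. strict_mono r \<longrightarrow>
     (\<exists>h :: nat \<Rightarrow> nat. strict_mono_on {..<k} h \<and> (\<exists>f\<in>dual_ball. \<forall>i<k. e \<le> f (x (r (h i))))))"

lemma persistent_subseq:
  assumes "persistent e x" "strict_mono r"
  shows "persistent e (x \<circ> r)"
  unfolding persistent_def
proof (intro allI impI, goal_cases)
  case (1 s k)
  then show ?case
    using assms(1)[unfolded persistent_def, rule_format, OF strict_mono_o[OF assms(2)], of s k] by simp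
qed

text \<open>A diagonal subsequence has, for each threshold, a bound on the number of indices where a
  functional of the dual ball is large, uniform over the ball. Testing a mean with its norming
  functional, these indices contribute O(1/m) and the others at most the threshold.\<close>

lemma cesaro_null:
  assumes C: "\<And>n. p (x n) \<le> C"
    and ex: "\<And>e r. 0 < e \<Longrightarrow> strict_mono r \<Longrightarrow> \<exists>(r' :: nat \<Rightarrow> nat) k. strict_mono r' \<and>
      (\<forall>f\<in>dual_ball. \<forall>A. finite A \<longrightarrow> (\<forall>i\<in>A. e \<le> \<bar>f (x (r (r' i)))\<bar>) \<longrightarrow> card A \<le> k)"
  shows "\<exists>r :: nat \<Rightarrow> nat. strict_mono r \<and> (\<lambda>m. p (means (x \<circ> r) m)) \<longlonglongrightarrow> 0"
proof -
  define few where "few = (\<lambda>(k :: nat) e (s :: nat \<Rightarrow> nat). \<forall>f\<in>dual_ball. \<forall>A. finite A \<longrightarrow>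
    (\<forall>i\<in>A. e \<le> \<bar>f (x (s i))\<bar>) \<longrightarrow> card A \<le> k)"
  define P where "P = (\<lambda>n (s :: nat \<Rightarrow> nat). \<exists>k. few k (1 / real (Suc n)) s)"
  interpret subseqs P
  proof
    fix n and s :: "nat \<Rightarrow> nat"
    assume "strict_mono s"
    then show "\<exists>r'. strict_mono r' \<and> P n (s \<circ> r')"
      using ex[of "1 / real (Suc n)" s] by (auto simp: P_def few_def)
  qed
  have stable: "P n (s \<circ> r)" if r: "strict_mono r" and s: "P n s" for r s n
  proof -
    obtain k where k: "few k (1 / real (Suc n)) s"
      using s by (auto simp: P_def)
    have "card A \<le> k" if "f \<in> dual_ball" "finite A" "\<forall>i\<in>A. 1 / real (Suc n) \<le> \<bar>f (x ((s \<circ> r) i))\<bar>" for f A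
    proof -
      have "card (r ` A) \<le> k"
        using k that by (auto simp: few_def)
      then show ?thesis
        using r by (simp add: card_image strict_mono_imp_inj_on inj_on_subset)
    qed
    then show ?thesis by (auto simp: P_def few_def)
  qed
  define d where "d = diagseq"
  have d: "strict_mono d"
    unfolding d_def by (rule subseq_diagseq)
  have few_d: "\<exists>k. few k (1 / real (Suc n)) d" for n
  proof -
    obtain k where k: "few k (1 / real (Suc n)) (d \<circ> (+) (Suc n))"
      using diagseq_holds[of n, OF stable] by (auto simp: P_def d_def)
    \<comment> \<open>The diagonal sequence has the n-th property only after its first
      \<open>n + 1\<close> terms, which are simply added to the count.\<close>
    have "card A \<le> Suc n + k" if "f \<in> dual_ball" "finite A" and A: "\<forall>i\<in>A. 1 / real (Suc n) \<le> \<bar>f (x (d i))\<bar>" for f A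
    proof -
      define B where "B = {i. Suc n + i \<in> A}"
      have img: "(+) (Suc n) ` B = A - {..n}"
        by (auto simp: B_def image_iff) (metis add_Suc less_eqE not_less_eq_eq)
      have "finite ((+) (Suc n) ` B)"
        unfolding img using that by simp
      then have fB: "finite B"
        by (rule finite_imageD) simp
      then have "card B \<le> k"
        using k that by (auto simp: few_def B_def)
      then have "card (A - {..n}) \<le> k"
        unfolding img[symmetric] by (subst card_image) simp_all
      moreover have "card A \<le> card ((A - {..n}) \<union> {..n})"
        using that by (intro card_mono) auto
      ultimately show ?thesis
        using card_Un_le[of "A - {..n}" "{..n}"] by simp
    qed
    then show ?thesis by (auto simp: few_def)
  qed
  have C0: "0 \<le> C" using C[of 0] p_ge_0 order_trans by blast
  have est: "p (means (x \<circ> d) m) \<le> real k * C / real (Suc m) + e" if k: "few k e d" and e: "0 < e" for k e m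
  proof -
    obtain f where f: "f \<in> dual_ball" "f (means (x \<circ> d) m) = p (means (x \<circ> d) m)"
      using ex_norming by blast
    have lin: "linear f" using f(1) by (rule dual_ball_linear)
    define B where "B = {i\<in>{..m}. e \<le> \<bar>f (x (d i))\<bar>}"
    have cB: "card B \<le> k" using k f(1) by (auto simp: few_def B_def)
    have "(\<Sum>i\<le>m. f (x (d i))) \<le> (\<Sum>i\<le>m. (if i \<in> B then C else 0) + e)"
    proof (rule sum_mono)
      fix i assume "i \<in> {..m}"
      have "f (x (d i)) \<le> C"
        using dual_ball_le[OF f(1), of "x (d i)"] C[of "d i"] by linarith
      then show "f (x (d i)) \<le> (if i \<in> B then C else 0) + e"
        using \<open>i \<in> {..m}\<close> e by (auto simp: B_def)
    qed
    also have "\<dots> = real (card B) * C + real (Suc m) * e"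
      by (simp add: sum.distrib B_def flip: sum.inter_filter)
    also have "\<dots> \<le> real k * C + real (Suc m) * e"
      using cB C0 by (simp add: mult_right_mono)
    finally have "(\<Sum>i\<le>m. f (x (d i))) / real (Suc m) \<le> (real k * C + real (Suc m) * e) / real (Suc m)"
      by (rule divide_right_mono) simp
    also have "(\<Sum>i\<le>m. f (x (d i))) / real (Suc m) = p (means (x \<circ> d) m)"
      unfolding f(2)[symmetric] by (simp add: means_def linear_scale[OF lin] linear_sum[OF lin])
    finally show ?thesis
      by (simp add: add_divide_distrib del: of_nat_Suc)
  qed
  have "(\<lambda>m. p (means (x \<circ> d) m)) \<longlonglongrightarrow> 0"
  proof (rule LIMSEQ_I)
    fix r :: real
    assume r: "0 < r"
    obtain n where n: "1 / real (Suc n) < r / 2"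
      using nat_approx_posE[of "r / 2"] r by auto
    obtain k where k: "few k (1 / real (Suc n)) d"
      using few_d by blast
    obtain M where M: "real k * C / (r / 2) < real M"
      using reals_Archimedean2 by blast
    have "norm (p (means (x \<circ> d) m) - 0) < r" if "m \<ge> M" for m
    proof -
      have "real k * C / (r / 2) < real (Suc m)" using M that by simp
      then have "real k * C / real (Suc m) < r / 2"
        using r by (simp add: field_simps del: of_nat_Suc)
      then have "p (means (x \<circ> d) m) < r"
        using est[OF k zero_less_divide_1_iff[THEN iffD2, OF of_nat_0_less_iff[THEN iffD2, OF zero_less_Suc]], of m] n
        by linarith
      then show ?thesis by simp
    qed
    then show "\<exists>no. \<forall>m\<ge>no. norm (p (means (x \<circ> d) m) - 0) < r" by blast
  qed
  with d show ?thesis by blast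
qed

lemma ex_persistent_subseq:
  assumes C: "\<And>n. p (x n) \<le> C"
    and no: "\<And>r. strict_mono r \<Longrightarrow> \<not> (\<lambda>m. p (means (x \<circ> (r :: nat \<Rightarrow> nat)) m)) \<longlonglongrightarrow> 0"
  shows "\<exists>e (r :: nat \<Rightarrow> nat). 0 < e \<and> strict_mono r \<and> persistent e (x \<circ> r)"
proof (rule ccontr)
  assume neg: "\<not> ?thesis"
  have "\<exists>r :: nat \<Rightarrow> nat. strict_mono r \<and> (\<lambda>m. p (means (x \<circ> r) m)) \<longlonglongrightarrow> 0"
  proof (rule cesaro_null[OF C])
    fix e :: real and r :: "nat \<Rightarrow> nat"
    assume "0 < e" and r: "strict_mono r"
    then have "\<not> persistent e (x \<circ> r)"
      using neg by blast
    then obtain s :: "nat \<Rightarrow> nat" and k where s: "strict_mono s"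
      and no_h: "\<not> (\<exists>h :: nat \<Rightarrow> nat. strict_mono_on {..<k} h \<and> (\<exists>f\<in>dual_ball. \<forall>i<k. e \<le> f ((x \<circ> r) (s (h i)))))"
      unfolding persistent_def by blast
    have pos: "card B < k" if "f \<in> dual_ball" "finite B" "\<forall>i\<in>B. e \<le> f (x (r (s i)))" for f B
    proof (rule ccontr)
      assume "\<not> card B < k"
      then have "k \<le> card B" by simp
      note nth = strict_mono_on_nth_sorted_list_of_set[OF that(2) this]
      have "\<exists>f\<in>dual_ball. \<forall>i<k. e \<le> f ((x \<circ> r) (s (sorted_list_of_set B ! i)))"
        using that nth(2) by auto
      with nth(1) no_h show False by blast
    qed
    \<comment> \<open>Persistence speaks of one-sided largeness, so positive and negative values are
      counted separately; the dual ball is symmetric.\<close>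
    have "card A \<le> 2 * k" if f: "f \<in> dual_ball" and A: "finite A" "\<forall>i\<in>A. e \<le> \<bar>f (x (r (s i)))\<bar>" for f A
    proof -
      define A1 where "A1 = {i\<in>A. e \<le> f (x (r (s i)))}"
      define A2 where "A2 = {i\<in>A. e \<le> - f (x (r (s i)))}"
      have "A = A1 \<union> A2"
        using A by (fastforce simp: A1_def A2_def)
      then have "card A \<le> card A1 + card A2"
        using card_Un_le by blast
      moreover have "card A1 < k"
        using f A(1) by (intro pos[OF f]) (auto simp: A1_def)
      moreover have "card A2 < k"
        using f A(1) by (intro pos[OF dual_ball_minus[OF f]]) (auto simp: A2_def)
      ultimately show ?thesis by simp
    qed
    with s show "\<exists>(r' :: nat \<Rightarrow> nat) k. strict_mono r' \<and>
      (\<forall>f\<in>dual_ball. \<forall>A. finite A \<longrightarrow> (\<forall>i\<in>A. e \<le> \<bar>f (x (r (r' i)))\<bar>) \<longrightarrow> card A \<le> k)"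
      by blast
  qed
  with no show False by blast
qed

text \<open>Persistence provides one good tuple inside every subsequence, which rules out the
  negative alternative of Ramsey's theorem.\<close>

lemma persistent_all_tuples:
  assumes "persistent e x"
  shows "\<exists>r :: nat \<Rightarrow> nat. strict_mono r \<and> (\<forall>h :: nat \<Rightarrow> nat. strict_mono_on {..<k} h \<longrightarrow> (\<exists>f\<in>dual_ball. \<forall>i<k. e \<le> f (x (r (h i)))))"
proof -
  define P where "P = (\<lambda>h :: nat \<Rightarrow> nat. \<exists>f\<in>dual_ball. \<forall>i<k. e \<le> f (x (h i)))"
  have "P h \<longleftrightarrow> P h'" if "\<And>i. i < k \<Longrightarrow> h i = h' i" for h h'
    using that by (simp add: P_def)
  then obtain r :: "nat \<Rightarrow> nat" where r: "strict_mono r"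
    "(\<forall>h. strict_mono_on {..<k} h \<longrightarrow> P (r \<circ> h)) \<or> (\<forall>h. strict_mono_on {..<k} h \<longrightarrow> \<not> P (r \<circ> h))"
    by (rule Ramsey_strict_mono)
  obtain h where "strict_mono_on {..<k} h" "P (r \<circ> h)"
    using assms[unfolded persistent_def, rule_format, OF r(1), of k] by (auto simp: P_def)
  with r(2) have "\<forall>h. strict_mono_on {..<k} h \<longrightarrow> P (r \<circ> h)"
    by blast
  with r(1) show ?thesis by (auto simp: P_def)
qed

text \<open>\<open>S\<close> is a set of positions in the tuple, not of indices of the sequence; so
  the existence of a suitable functional is a two-colouring of k-tuples.\<close>

definition pattern :: "real \<Rightarrow> real \<Rightarrow> nat \<Rightarrow> nat set \<Rightarrow> (nat \<Rightarrow> 'a) \<Rightarrow> bool" where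
  "pattern e d k S x \<longleftrightarrow> (\<forall>h :: nat \<Rightarrow> nat. strict_mono_on {..<k} h \<longrightarrow> (\<exists>f\<in>dual_ball. \<forall>i<k.
     (i \<in> S \<longrightarrow> e \<le> f (x (h i))) \<and> (i \<notin> S \<longrightarrow> \<bar>f (x (h i))\<bar> \<le> d)))"

lemma pattern_subseq:
  assumes "pattern e d k S x" "strict_mono r"
  shows "pattern e d k S (x \<circ> r)"
  unfolding pattern_def
proof (intro allI impI, goal_cases)
  case (1 h)
  then show ?case
    using assms(1)[unfolded pattern_def, rule_format, OF strict_mono_on_comp_left[OF assms(2)], of h] by simp
qed

text \<open>Choose finite sets \<open>Q 0 < g 0 < Q 1 < g 1 < \<dots>\<close> such that no functional of norm one is large on a whole \<open>Q i\<close>: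
  a functional that is large on all \<open>g i\<close> then has a small value in each \<open>Q i\<close>. Ramsey's theorem makes the
  resulting choice uniform.\<close>

lemma ex_pattern_subseq:
  assumes per: "persistent e x" and x: "weakly_null x" and d: "0 < d"
  shows "\<exists>r :: nat \<Rightarrow> nat. strict_mono r \<and> pattern e d k S (x \<circ> r)"
proof -
  define P where "P = (\<lambda>h :: nat \<Rightarrow> nat. \<exists>f\<in>dual_ball. \<forall>i<k. (i \<in> S \<longrightarrow> e \<le> f (x (h i))) \<and> (i \<notin> S \<longrightarrow> \<bar>f (x (h i))\<bar> \<le> d))"
  have "P h \<longleftrightarrow> P h'" if "\<And>i. i < k \<Longrightarrow> h i = h' i" for h h'
    using that by (simp add: P_def)
  then obtain r :: "nat \<Rightarrow> nat" where r: "strict_mono r"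
    and dich: "(\<forall>h. strict_mono_on {..<k} h \<longrightarrow> P (r \<circ> h)) \<or> (\<forall>h. strict_mono_on {..<k} h \<longrightarrow> \<not> P (r \<circ> h))"
    by (rule Ramsey_strict_mono)
  obtain s :: "nat \<Rightarrow> nat" where s: "strict_mono s"
    and all: "\<And>h. strict_mono_on {..<k} h \<Longrightarrow> \<exists>f\<in>dual_ball. \<forall>i<k. e \<le> f (x (r (s (h i))))"
    using persistent_all_tuples[OF persistent_subseq[OF per r], of k] by auto
  define z where "z = x \<circ> (r \<circ> s)"
  have z: "weakly_null z"
    unfolding z_def using x strict_mono_o[OF r s] by (rule weakly_null_subseq)
  have "\<forall>N. \<exists>Q. finite Q \<and> Q \<subseteq> {N..} \<and> (\<forall>f\<in>dual_ball. \<exists>i\<in>Q. \<bar>f (z i)\<bar> < d)"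
    using weakly_null_finite_small[OF z d] infinite_Ici by blast
  then obtain Q where Q: "\<And>N. finite (Q N)" "\<And>N. Q N \<subseteq> {N..}"
    "\<And>N f. f \<in> dual_ball \<Longrightarrow> \<exists>i\<in>Q N. \<bar>f (z i)\<bar> < d"
    by metis
  define g where "g = (\<lambda>N. Suc (Max (insert N (Q N))))"
  have g: "N < g N" "\<And>i. i \<in> Q N \<Longrightarrow> i < g N" for N
    using Q(1)[of N] by (auto simp: g_def less_Suc_eq_le)
  \<comment> \<open>The i-th block runs from \<open>a i\<close> to \<open>g (a i)\<close> and the
    next one starts right after. Hence every selection of one index per block is increasing,
    whichever of the two kinds is selected.\<close>
  define a where "a = rec_nat 0 (\<lambda>_ N. Suc (g N))"
  have a_Suc: "a (Suc i) = Suc (g (a i))" for i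
    by (simp add: a_def)
  have mono_between: "strict_mono h" if "\<And>i. a i \<le> h i" "\<And>i. h i < a (Suc i)" for h
    unfolding strict_mono_Suc_iff using that order_less_le_trans by blast
  have "strict_mono (\<lambda>i. g (a i))"
    using g(1) by (intro mono_between) (auto simp: a_Suc less_imp_le)
  then obtain f where f: "f \<in> dual_ball" "\<And>i. i < k \<Longrightarrow> e \<le> f (z (g (a i)))"
    using all[of "\<lambda>i. g (a i)"] by (auto simp: z_def strict_mono_on_def strict_mono_def)
  have "\<forall>i. \<exists>j. j \<in> Q (a i) \<and> \<bar>f (z j)\<bar> < d"
    using Q(3)[OF f(1)] by blast
  then obtain q where q: "\<And>i. q i \<in> Q (a i)" "\<And>i. \<bar>f (z (q i))\<bar> < d"
    by metis
  define h where "h = (\<lambda>i. if i \<in> S then g (a i) else q i)"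
  have "strict_mono h"
  proof (rule mono_between)
    fix i
    show "a i \<le> h i" "h i < a (Suc i)"
      using g(1)[of "a i"] g(2)[OF q(1)[of i]] Q(2)[of "a i"] q(1)[of i] by (auto simp: h_def a_Suc)
  qed
  then have "strict_mono_on {..<k} (s \<circ> h)"
    using s by (auto simp: strict_mono_on_def strict_mono_def)
  moreover have "P (r \<circ> (s \<circ> h))"
    unfolding P_def using f q(2) by (intro bexI[of _ f]) (auto simp: h_def z_def less_imp_le)
  ultimately have "\<forall>h. strict_mono_on {..<k} h \<longrightarrow> P (r \<circ> h)"
    using dich by blast
  with r show ?thesis by (auto simp: P_def pattern_def)
qed

lemma ex_all_patterns_subseq:
  assumes "persistent e x" "weakly_null x" "0 < d"
  shows "\<exists>r :: nat \<Rightarrow> nat. strict_mono r \<and> (\<forall>S\<subseteq>{..<k}. pattern e d k S (x \<circ> r))"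
proof -
  have "\<exists>r :: nat \<Rightarrow> nat. strict_mono r \<and> (\<forall>S\<in>\<S>. pattern e d k S (x \<circ> r))" if "finite \<S>" for \<S>
    using that
  proof induction
    case empty
    show ?case using strict_mono_id by auto
  next
    case (insert S \<S>)
    then obtain r where r: "strict_mono r" "\<forall>S\<in>\<S>. pattern e d k S (x \<circ> r)" by blast
    obtain s where s: "strict_mono s" "pattern e d k S (x \<circ> r \<circ> s)"
      using ex_pattern_subseq[OF persistent_subseq[OF assms(1) r(1)] weakly_null_subseq[OF assms(2) r(1)] assms(3)] by blast
    have "\<forall>S\<in>\<S>. pattern e d k S (x \<circ> r \<circ> s)"
      using r(2) s(1) pattern_subseq by blast
    moreover have "x \<circ> (r \<circ> s) = x \<circ> r \<circ> s"
      by (simp add: o_assoc)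
    ultimately show ?case
      using s(2) strict_mono_o[OF r(1) s(1)] by (intro exI[of _ "r \<circ> s"]) (simp only: ball_simps simp_thms)
  qed
  from this[of "Pow {..<k}"] show ?thesis by auto
qed

text \<open>Choose the functional that is at least \<open>e\<close> where the coefficient is
  nonnegative and at most \<open>e / 2\<close> in modulus elsewhere. Both cases give at least
  \<open>e / 4 * \<bar>b\<bar> + 3 / 4 * e * b\<close> per term, and after a possible change of all
  signs the second parts have nonnegative sum.\<close>

lemma ell1_lower_estimate:
  assumes "\<And>S. S \<subseteq> {..<card F} \<Longrightarrow> pattern e (e / 2) (card F) S x"
    and F: "finite F" and e: "0 < e"
  shows "e / 4 * (\<Sum>i\<in>F. \<bar>a i\<bar>) \<le> p (\<Sum>i\<in>F. a i *\<^sub>R x i)"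
proof -
  define n where "n = card F"
  define h where "h = (!) (sorted_list_of_set F)"
  have h: "strict_mono_on {..<n} h" "\<And>i. i < n \<Longrightarrow> h i \<in> F"
    unfolding h_def n_def using strict_mono_on_nth_sorted_list_of_set[OF F order_refl] by auto
  have inj: "inj_on h {..<n}"
    using h(1) by (rule strict_mono_on_imp_inj_on)
  have img: "h ` {..<n} = F"
    using h(2) F inj by (intro card_subset_eq) (auto simp: card_image n_def)
  have reindex: "(\<Sum>i\<in>F. G i) = (\<Sum>i<n. G (h i))" for G :: "nat \<Rightarrow> 'c::comm_monoid_add"
    unfolding img[symmetric] using inj by (simp add: sum.reindex)
  have main: "e / 4 * (\<Sum>i\<in>F. \<bar>b i\<bar>) \<le> p (\<Sum>i\<in>F. b i *\<^sub>R x i)" 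
    if b: "0 \<le> (\<Sum>i\<in>F. b i)" for b :: "nat \<Rightarrow> real"
  proof -
    define S where "S = {i\<in>{..<n}. 0 \<le> b (h i)}"
    have "pattern e (e / 2) n S x"
      unfolding n_def by (rule assms(1)) (auto simp: S_def n_def)
    then obtain f where f: "f \<in> dual_ball"
      "\<And>i. i < n \<Longrightarrow> i \<in> S \<Longrightarrow> e \<le> f (x (h i))" "\<And>i. i < n \<Longrightarrow> i \<notin> S \<Longrightarrow> \<bar>f (x (h i))\<bar> \<le> e / 2"
      using h(1) by (auto simp: pattern_def)
    have lin: "linear f" using f(1) by (rule dual_ball_linear)
    have "e / 4 * (\<Sum>i\<in>F. \<bar>b i\<bar>) \<le> e / 4 * (\<Sum>i\<in>F. \<bar>b i\<bar>) + 3 / 4 * e * (\<Sum>i\<in>F. b i)"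
      using b e by simp
    also have "\<dots> = (\<Sum>i<n. e / 4 * \<bar>b (h i)\<bar> + 3 / 4 * e * b (h i))"
      by (simp add: reindex sum.distrib sum_distrib_left)
    also have "\<dots> \<le> (\<Sum>i<n. b (h i) * f (x (h i)))"
    proof (rule sum_mono)
      fix i assume i: "i \<in> {..<n}"
      show "e / 4 * \<bar>b (h i)\<bar> + 3 / 4 * e * b (h i) \<le> b (h i) * f (x (h i))"
      proof (cases "i \<in> S")
        case True
        then have "b (h i) * e \<le> b (h i) * f (x (h i))"
          using f(2)[of i] i by (intro mult_left_mono) (auto simp: S_def)
        moreover have "e / 4 * \<bar>b (h i)\<bar> + 3 / 4 * e * b (h i) = b (h i) * e"
          using True by (simp add: S_def)
        ultimately show ?thesis by simp
      next
        case False
        then have neg: "b (h i) < 0" using i by (auto simp: S_def)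
        then have "b (h i) * (e / 2) \<le> b (h i) * f (x (h i))"
          using f(3)[of i] i False by (intro mult_left_mono_neg) auto
        moreover have "e / 4 * \<bar>b (h i)\<bar> + 3 / 4 * e * b (h i) = b (h i) * (e / 2)"
          using neg by simp
        ultimately show ?thesis by simp
      qed
    qed
    also have "\<dots> = f (\<Sum>i\<in>F. b i *\<^sub>R x i)"
      by (simp add: linear_sum[OF lin] linear_scale[OF lin] reindex)
    also have "\<dots> \<le> p (\<Sum>i\<in>F. b i *\<^sub>R x i)"
      using dual_ball_le[OF f(1)] abs_le_D1 by blast
    finally show ?thesis .
  qed
  show ?thesis
  proof (cases "0 \<le> (\<Sum>i\<in>F. a i)")
    case True
    then show ?thesis by (rule main)
  next
    case False
    then show ?thesis
      using main[of "\<lambda>i. - a i"] p_minus[of "\<Sum>i\<in>F. a i *\<^sub>R x i"] by (simp add: sum_negf)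
  qed
qed

text \<open>Diagonalisation over the tuple length: beyond index \<open>n\<close> the diagonal
  sequence inherits all patterns of length \<open>n\<close>. This is the origin of the requirement
  that every index of \<open>F\<close> exceed \<open>card F\<close>.\<close>

lemma persistent_imp_ell1_subseq:
  assumes per: "persistent e x" and x: "weakly_null x" and e: "0 < e"
  shows "\<exists>r :: nat \<Rightarrow> nat. strict_mono r \<and> (\<forall>F a. finite F \<longrightarrow> (\<forall>i\<in>F. card F < i) \<longrightarrow>
    e / 4 * (\<Sum>i\<in>F. \<bar>a i\<bar>) \<le> p (\<Sum>i\<in>F. a i *\<^sub>R x (r i)))"
proof -
  define P where "P = (\<lambda>k (s :: nat \<Rightarrow> nat). \<forall>S\<subseteq>{..<k}. pattern e (e / 2) k S (x \<circ> s))"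
  interpret subseqs P
  proof
    fix n and s :: "nat \<Rightarrow> nat"
    assume s: "strict_mono s"
    show "\<exists>r'. strict_mono r' \<and> P n (s \<circ> r')"
      using ex_all_patterns_subseq[OF persistent_subseq[OF per s] weakly_null_subseq[OF x s], of "e / 2" n] e
      by (auto simp: P_def o_assoc)
  qed
  have stable: "P n (s \<circ> r)" if "strict_mono r" "P n s" for r s n
    using that pattern_subseq[OF _ that(1)] by (auto simp: P_def o_assoc)
  have "e / 4 * (\<Sum>i\<in>F. \<bar>a i\<bar>) \<le> p (\<Sum>i\<in>F. a i *\<^sub>R x (diagseq i))"
    if F: "finite F" "\<forall>i\<in>F. card F < i" for F a
  proof -
    define n where "n = card F"
    define G where "G = (\<lambda>i. i - Suc n) ` F"
    have inj: "inj_on (\<lambda>i. i - Suc n) F"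
      using F(2) by (intro inj_onI) (auto simp: n_def Suc_le_eq eq_diff_iff)
    have "card G = n"
      unfolding G_def n_def using card_image[OF inj] by (simp add: n_def)
    moreover have "P n (diagseq \<circ> (+) (Suc n))"
      by (rule diagseq_holds[OF stable])
    ultimately have "e / 4 * (\<Sum>i\<in>G. \<bar>a (Suc n + i)\<bar>) \<le> p (\<Sum>i\<in>G. a (Suc n + i) *\<^sub>R (x \<circ> (diagseq \<circ> (+) (Suc n))) i)"
      using F(1) by (intro ell1_lower_estimate e) (auto simp: P_def G_def comp_def)
    moreover have reindex: "(\<Sum>i\<in>G. H (Suc n + i)) = (\<Sum>i\<in>F. H i)" for H :: "nat \<Rightarrow> 'c::comm_monoid_add"
      unfolding G_def using F(2) by (subst sum.reindex[OF inj]) (auto simp: n_def Suc_le_eq intro!: sum.cong)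
    ultimately show ?thesis
      using reindex[of "\<lambda>i. \<bar>a i\<bar>"] reindex[of "\<lambda>i. a i *\<^sub>R x (diagseq i)"] by simp
  qed
  with subseq_diagseq show ?thesis by blast
qed

end

context seminorm
begin

section \<open>Almost isometric asymptotic \<open>\<ell>\<^sub>1\<close> sequences\<close>

text \<open>The cut-off \<open>N\<close> depends on the cardinality only. In this form the estimate
  passes to blocks of bounded length, since k blocks of at most K terms involve at most
  \<open>k * K\<close> vectors.\<close>

definition asymp_ell1 :: "real \<Rightarrow> (nat \<Rightarrow> 'a) \<Rightarrow> bool" where
  "asymp_ell1 t x \<longleftrightarrow> (\<forall>k. \<exists>N. \<forall>F a. finite F \<longrightarrow> F \<subseteq> {N..} \<longrightarrow> card F \<le> k \<longrightarrow>
     t * (\<Sum>i\<in>F. \<bar>a i\<bar>) \<le> p (\<Sum>i\<in>F. a i *\<^sub>R x i))"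

text \<open>James's non-distortion argument: if \<open>\<theta>\<close> is the supremum of the constants \<open>t\<close>, normalised blocks of length
  at most \<open>K\<close> and norm less than \<open>(1 + d) * \<theta>\<close> exist arbitrarily far out, and their combinations inherit the
  lower estimate with constants close to \<open>\<theta>\<close>.\<close>

lemma asymp_ell1_blocks:
  assumes c: "0 < c" "asymp_ell1 c z" and C: "\<And>n. p (z n) \<le> C"
    and z: "weakly_null z" and d: "0 < d" "d < 1"
  shows "\<exists>y. weakly_null y \<and> (\<forall>n. p (y n) \<le> 1) \<and> asymp_ell1 (1 - d) y"
proof -
  define T where "T = {t. asymp_ell1 t z}"
  have "c \<in> T" using c by (simp add: T_def)
  have "t \<le> C" if t: "t \<in> T" for t
  proof -
    obtain N where N: "\<And>F a. finite F \<Longrightarrow> F \<subseteq> {N..} \<Longrightarrow> card F \<le> 1 \<Longrightarrow>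
        t * (\<Sum>i\<in>F. \<bar>a i\<bar>) \<le> p (\<Sum>i\<in>F. a i *\<^sub>R z i)"
      using t unfolding T_def asymp_ell1_def mem_Collect_eq by blast
    from N[of "{N}" "\<lambda>_. 1"] C[of N] show ?thesis by simp
  qed
  then have bdd: "bdd_above T" by (rule bdd_aboveI)
  define th where "th = Sup T"
  have th: "0 < th"
    unfolding th_def using cSup_upper[OF \<open>c \<in> T\<close> bdd] c by simp
  \<comment> \<open>As \<open>(1 - d) * (1 + d) < 1\<close>, there is an attained constant
    \<open>t1\<close> above \<open>(1 - d) * t2\<close>, while \<open>t2\<close> itself fails. The
    ratio \<open>t1 / t2\<close> becomes the constant of the blocks.\<close>
  define t2 where "t2 = th * (1 + d)"
  have t2: "0 < t2" "th < t2" "(1 - d) * t2 < th"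
  proof -
    have "(1 - d) * t2 = th * (1 - d * d)" by (simp add: t2_def algebra_simps)
    also have "\<dots> < th" using th d by (simp add: mult_less_cancel_left1)
    finally show "(1 - d) * t2 < th" .
  qed (use th d in \<open>auto simp: t2_def\<close>)
  obtain t1 where t1: "t1 \<in> T" "(1 - d) * t2 < t1"
    using less_cSupD[of T "(1 - d) * t2"] t2(3) \<open>c \<in> T\<close> by (auto simp: th_def)
  have "t2 \<notin> T"
    using t2(2) cSup_upper[OF _ bdd, of t2] by (auto simp: th_def)
  then obtain K where "\<forall>N. \<exists>F a. finite F \<and> F \<subseteq> {N..} \<and> card F \<le> K \<and>
      p (\<Sum>i\<in>F. a i *\<^sub>R z i) < t2 * (\<Sum>i\<in>F. \<bar>a i\<bar>)"
    unfolding T_def asymp_ell1_def mem_Collect_eq not_all not_ex not_imp not_le by blast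
  then obtain F a where Fa: "\<And>N. finite (F N)" "\<And>N. F N \<subseteq> {N..}" "\<And>N. card (F N) \<le> K"
    "\<And>N. p (\<Sum>i\<in>F N. a N i *\<^sub>R z i) < t2 * (\<Sum>i\<in>F N. \<bar>a N i\<bar>)"
    by metis
  define A where "A = (\<lambda>N. \<Sum>i\<in>F N. \<bar>a N i\<bar>)"
  have A: "0 < A N" for N
  proof -
    have "0 < t2 * A N" using le_less_trans[OF p_ge_0 Fa(4)] by (simp add: A_def)
    then show ?thesis using t2(1) by (simp add: zero_less_mult_iff)
  qed
  define n where "n = rec_nat 0 (\<lambda>_ N. Suc (Max (insert N (F N))))"
  have n_Suc: "n (Suc j) = Suc (Max (insert (n j) (F (n j))))" for j
    by (simp add: n_def)
  have n_less: "n j < n (Suc j)" "\<And>i. i \<in> F (n j) \<Longrightarrow> i < n (Suc j)" for j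
    using Fa(1)[of "n j"] by (auto simp: n_Suc less_Suc_eq_le)
  have n: "strict_mono n" using n_less(1) by (simp add: strict_mono_Suc_iff)
  define G where "G = (\<lambda>j. F (n j))"
  have fin_G: "finite (G j)" for j by (simp add: G_def Fa)
  have G_lower: "n j \<le> i" "j \<le> i" if "i \<in> G j" for i j
    using that Fa(2)[of "n j"] seq_suble[OF n, of j] by (auto simp: G_def)
  have G_less: "i < i'" if "i \<in> G j" "i' \<in> G j'" "j < j'" for i i' j j'
  proof -
    have "i < n (Suc j)" using that(1) n_less(2) by (simp add: G_def)
    also have "\<dots> \<le> n j'" using n that(3) by (simp add: strict_mono_less_eq)
    also have "\<dots> \<le> i'" using that(2) by (rule G_lower)
    finally show ?thesis .
  qed
  have G_unique: "j = j'" if "i \<in> G j" "i \<in> G j'" for i j j'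
    using G_less[of i j i j'] G_less[of i j' i j] that by (cases j j' rule: linorder_cases) auto
  \<comment> \<open>Dividing by the upper bound \<open>t2 * A (n j)\<close> instead of the norm
    itself keeps the blocks in the unit ball and gives all of them the same coefficient mass
    \<open>1 / t2\<close>. This mass also carries weak nullity over to the blocks.\<close>
  define b where "b = (\<lambda>j i. a (n j) i / (t2 * A (n j)))"
  have b_sum: "(\<Sum>i\<in>G j. \<bar>b j i\<bar>) = 1 / t2" for j
  proof -
    have "(\<Sum>i\<in>G j. \<bar>b j i\<bar>) = A (n j) / (t2 * A (n j))"
      using A[of "n j"] t2(1)
      by (simp add: b_def abs_mult abs_divide G_def fun_cong[OF A_def] flip: sum_divide_distrib)
    then show ?thesis using A[of "n j"] by simp
  qed
  define y where "y = (\<lambda>j. \<Sum>i\<in>G j. b j i *\<^sub>R z i)"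
  have "p (y j) \<le> 1" for j
  proof -
    have "y j = (1 / (t2 * A (n j))) *\<^sub>R (\<Sum>i\<in>F (n j). a (n j) i *\<^sub>R z i)"
      by (simp add: y_def b_def G_def scaleR_sum_right divide_inverse mult.commute)
    then have "p (y j) = p (\<Sum>i\<in>F (n j). a (n j) i *\<^sub>R z i) / (t2 * A (n j))"
      using A[of "n j"] t2(1) by (simp add: homog)
    then show ?thesis
      using Fa(4)[of "n j"] A[of "n j"] t2(1) by (simp add: A_def)
  qed
  moreover have "weakly_null y"
    unfolding weakly_null_def
  proof
    fix f assume f: "f \<in> dual_ball"
    have lin: "linear f" using f by (rule dual_ball_linear)
    show "(\<lambda>j. f (y j)) \<longlonglongrightarrow> 0"
    proof (rule LIMSEQ_I)
      fix r :: real assume r: "0 < r"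
      obtain M where M: "\<And>i. i \<ge> M \<Longrightarrow> \<bar>f (z i)\<bar> < r * t2"
        using LIMSEQ_D[of "\<lambda>i. f (z i)" 0 "r * t2"] z f r t2(1) by (auto simp: weakly_null_def)
      have "norm (f (y j) - 0) < r" if "j \<ge> M" for j
      proof -
        have ne: "G j \<noteq> {}"
          using b_sum[of j] t2(1) by auto
        have "\<bar>f (y j)\<bar> \<le> (\<Sum>i\<in>G j. \<bar>b j i\<bar> * \<bar>f (z i)\<bar>)"
          by (simp add: y_def linear_sum[OF lin] linear_scale[OF lin] flip: abs_mult)
        also have "\<dots> \<le> (\<Sum>i\<in>G j. \<bar>b j i\<bar> * Max ((\<lambda>i. \<bar>f (z i)\<bar>) ` G j))"
          using fin_G by (intro sum_mono mult_left_mono Max_ge) auto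
        also have "\<dots> = Max ((\<lambda>i. \<bar>f (z i)\<bar>) ` G j) / t2"
          by (simp add: b_sum flip: sum_distrib_right)
        also have "\<dots> < r"
        proof -
          have "Max ((\<lambda>i. \<bar>f (z i)\<bar>) ` G j) < r * t2"
            using fin_G ne M order_trans[OF that G_lower(2)] by (subst Max_less_iff) auto
          then show ?thesis using t2(1) by (simp add: field_simps)
        qed
        finally show ?thesis by simp
      qed
      then show "\<exists>no. \<forall>j\<ge>no. norm (f (y j) - 0) < r" by blast
    qed
  qed
  moreover have "asymp_ell1 (1 - d) y"
    unfolding asymp_ell1_def
  proof
    fix k
    obtain N where N: "\<And>F a. finite F \<Longrightarrow> F \<subseteq> {N..} \<Longrightarrow> card F \<le> k * K \<Longrightarrow>
        t1 * (\<Sum>i\<in>F. \<bar>a i\<bar>) \<le> p (\<Sum>i\<in>F. a i *\<^sub>R z i)"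
      using t1(1) unfolding T_def asymp_ell1_def mem_Collect_eq by blast
    have "(1 - d) * (\<Sum>j\<in>J. \<bar>\<beta> j\<bar>) \<le> p (\<Sum>j\<in>J. \<beta> j *\<^sub>R y j)"
      if J: "finite J" "J \<subseteq> {N..}" "card J \<le> k" for J \<beta>
    proof -
      define U where "U = (\<Union>j\<in>J. G j)"
      define \<alpha> where "\<alpha> = (\<lambda>i. \<Sum>j\<in>J. if i \<in> G j then \<beta> j * b j i else 0)"
      have \<alpha>: "\<alpha> i = \<beta> j * b j i" if "j \<in> J" "i \<in> G j" for i j
      proof -
        have "\<alpha> i = (\<Sum>j'\<in>J. if j' = j then \<beta> j * b j i else 0)"
          unfolding \<alpha>_def using that(2) G_unique by (intro sum.cong) auto
        then show ?thesis using that(1) J(1) by simp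
      qed
      have sum_U: "(\<Sum>i\<in>U. h i) = (\<Sum>j\<in>J. \<Sum>i\<in>G j. h i)" for h :: "nat \<Rightarrow> 'b::comm_monoid_add"
        unfolding U_def using J(1) fin_G G_unique by (intro sum.UNION_disjoint) auto
      have "card U \<le> (\<Sum>j\<in>J. card (G j))"
        unfolding U_def using J(1) by (rule card_UN_le)
      also have "\<dots> \<le> card J * K"
        using sum_bounded_above[of J "\<lambda>j. card (G j)" K] Fa(3) by (simp add: G_def)
      also have "\<dots> \<le> k * K" using J(3) by simp
      finally have "card U \<le> k * K" .
      moreover have "U \<subseteq> {N..}"
      proof
        fix i assume "i \<in> U"
        then obtain j where "j \<in> J" "i \<in> G j" by (auto simp: U_def)
        then show "i \<in> {N..}" using G_lower(2)[of i j] J(2) by auto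
      qed
      moreover have "finite U" using J(1) fin_G by (auto simp: U_def)
      ultimately have *: "t1 * (\<Sum>i\<in>U. \<bar>\<alpha> i\<bar>) \<le> p (\<Sum>i\<in>U. \<alpha> i *\<^sub>R z i)"
        by (intro N)
      have "(\<Sum>i\<in>U. \<bar>\<alpha> i\<bar>) = (\<Sum>j\<in>J. \<bar>\<beta> j\<bar> * (\<Sum>i\<in>G j. \<bar>b j i\<bar>))"
        unfolding sum_U by (intro sum.cong) (auto simp: \<alpha> abs_mult sum_distrib_left)
      then have S1: "(\<Sum>i\<in>U. \<bar>\<alpha> i\<bar>) = (\<Sum>j\<in>J. \<bar>\<beta> j\<bar>) / t2"
        by (simp add: b_sum sum_divide_distrib)
      have S2: "(\<Sum>i\<in>U. \<alpha> i *\<^sub>R z i) = (\<Sum>j\<in>J. \<beta> j *\<^sub>R y j)"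
        unfolding sum_U by (intro sum.cong) (auto simp: \<alpha> y_def scaleR_sum_right)
      have "(1 - d) * (\<Sum>j\<in>J. \<bar>\<beta> j\<bar>) \<le> t1 / t2 * (\<Sum>j\<in>J. \<bar>\<beta> j\<bar>)"
        using t1(2) t2(1) by (intro mult_right_mono) (auto simp: field_simps intro: sum_nonneg)
      with * show ?thesis by (simp add: S1 S2)
    qed
    then show "\<exists>N. \<forall>F a. finite F \<longrightarrow> F \<subseteq> {N..} \<longrightarrow> card F \<le> k \<longrightarrow>
        (1 - d) * (\<Sum>i\<in>F. \<bar>a i\<bar>) \<le> p (\<Sum>i\<in>F. a i *\<^sub>R y i)"
      by blast
  qed
  ultimately show ?thesis by blast
qed

text \<open>The fourth power makes the sets \<open>{q..<q ^ 4}\<close> admissible; they carry almost the whole mass of the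
  difference of the \<open>q ^ 4\<close>-th and the \<open>q ^ 2\<close>-th mean.\<close>

definition spread_ell1 :: "real \<Rightarrow> (nat \<Rightarrow> 'a) \<Rightarrow> bool" where
  "spread_ell1 t x \<longleftrightarrow> (\<forall>k F a. finite F \<longrightarrow> F \<subseteq> {k..} \<longrightarrow> card F \<le> Suc k ^ 4 \<longrightarrow>
     t * (\<Sum>i\<in>F. \<bar>a i\<bar>) \<le> p (\<Sum>i\<in>F. a i *\<^sub>R x i))"

lemma ell1_estimate_reindex:
  assumes r: "strict_mono (r :: nat \<Rightarrow> nat)"
    and le: "\<And>a. t * (\<Sum>i\<in>r ` F. \<bar>a i\<bar>) \<le> p (\<Sum>i\<in>r ` F. a i *\<^sub>R x i)"
  shows "t * (\<Sum>i\<in>F. \<bar>a i\<bar>) \<le> p (\<Sum>i\<in>F. a i *\<^sub>R (x \<circ> r) i)"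
proof -
  have inj: "inj r" using r by (rule strict_mono_imp_inj_on)
  then have "inj_on r F" by (rule inj_on_subset) simp
  then show ?thesis
    using le[of "\<lambda>i. a (inv r i)"] inj by (simp add: sum.reindex inv_f_f)
qed

lemma card_image_strict_mono: "strict_mono (r :: nat \<Rightarrow> nat) \<Longrightarrow> card (r ` F) = card F"
  by (meson card_image inj_on_subset strict_mono_imp_inj_on subset_UNIV)

lemma spread_ell1_subseq:
  assumes "spread_ell1 t x" and r: "strict_mono (r :: nat \<Rightarrow> nat)"
  shows "spread_ell1 t (x \<circ> r)"
  unfolding spread_ell1_def
proof (intro allI impI ell1_estimate_reindex r assms(1)[unfolded spread_ell1_def, rule_format])
  fix k F
  assume F: "finite F" "F \<subseteq> {k..}" "card F \<le> Suc k ^ 4"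
  show "r ` F \<subseteq> {k..}"
  proof
    fix i assume "i \<in> r ` F"
    then obtain j where "j \<in> F" "i = r j" by blast
    then show "i \<in> {k..}" using F(2) seq_suble[OF r, of j] by auto
  qed
qed (simp_all add: card_image_strict_mono[OF r])

lemma asymp_imp_spread_ell1:
  assumes "asymp_ell1 t x"
  shows "\<exists>r :: nat \<Rightarrow> nat. strict_mono r \<and> spread_ell1 t (x \<circ> r)"
proof -
  obtain N where N: "\<And>k F a. finite F \<Longrightarrow> F \<subseteq> {N k..} \<Longrightarrow> card F \<le> k \<Longrightarrow>
      t * (\<Sum>i\<in>F. \<bar>a i\<bar>) \<le> p (\<Sum>i\<in>F. a i *\<^sub>R x i)"
    using assms unfolding asymp_ell1_def by metis
  \<comment> \<open>Partial sums make \<open>r\<close> strictly increasing while still dominating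
    the cut-off for sets of \<open>(k + 1) ^ 4\<close> elements.\<close>
  define r where "r = (\<lambda>k. \<Sum>j\<le>k. Suc (N (Suc j ^ 4)))"
  have r: "strict_mono r" by (simp add: strict_mono_Suc_iff r_def)
  have N_le: "N (Suc k ^ 4) \<le> r k" for k
    using member_le_sum[of k "{..k}" "\<lambda>j. Suc (N (Suc j ^ 4))"] by (simp add: r_def)
  have "spread_ell1 t (x \<circ> r)"
    unfolding spread_ell1_def
  proof (intro allI impI ell1_estimate_reindex r)
    fix k F and a :: "nat \<Rightarrow> real"
    assume F: "finite F" "F \<subseteq> {k..}" "card F \<le> Suc k ^ 4"
    have "r ` F \<subseteq> {N (Suc k ^ 4)..}"
    proof
      fix i assume "i \<in> r ` F"
      then obtain j where "j \<in> F" "i = r j" by blast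
      then have "r k \<le> i" using F(2) r by (auto simp: strict_mono_less_eq)
      then show "i \<in> {N (Suc k ^ 4)..}" using N_le[of k] by simp
    qed
    then show "t * (\<Sum>i\<in>r ` F. \<bar>a i\<bar>) \<le> p (\<Sum>i\<in>r ` F. a i *\<^sub>R x i)"
      using F by (intro N) (auto simp: card_image_strict_mono[OF r])
  qed
  with r show ?thesis by blast
qed

section \<open>Cauchy oscillation of means\<close>

lemma means_le:
  assumes "\<And>n. p (x n) \<le> C"
  shows "p (means x m) \<le> C"
proof -
  have "p (\<Sum>i\<le>m. x i) \<le> real (Suc m) * C"
    using order_trans[OF tri_sum sum_bounded_above[of "{..m}" "\<lambda>i. p (x i)" C]] assms by simp
  then show ?thesis
    by (simp add: means_def homog field_simps del: of_nat_Suc)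
qed

lemma diff_means_le: "p (means x k - means x l) \<le> 2" if "\<And>n. p (x n) \<le> 1"
  using tri_minus[of "means x k" "means x l"] means_le[of x 1 k, OF that] means_le[of x 1 l, OF that] by simp

lemma bdd_above_diff_means:
  assumes "\<And>n. p (x n) \<le> 1"
  shows "bdd_above ((\<lambda>q. p (means x (fst q) - means x (snd q))) ` A)"
  using diff_means_le[OF assms] by (auto intro!: bdd_aboveI2)

lemma cca_ge:
  assumes x: "\<And>n. p (x n) \<le> 1"
    and B: "\<And>n. \<exists>k\<ge>n. \<exists>l\<ge>n. B \<le> p (means x k - means x l)"
  shows "B \<le> cca p x"
  unfolding cca_def ca_def
proof (rule cINF_greatest)
  fix n
  obtain k l where "k \<ge> n" "l \<ge> n" "B \<le> p (means x k - means x l)"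
    using B by blast
  then show "B \<le> (SUP q\<in>{n..} \<times> {n..}. p (means x (fst q) - means x (snd q)))"
    by (intro cSUP_upper2[where x = "(k, l)"] bdd_above_diff_means x) auto
qed simp

lemma cca_nonneg: "0 \<le> cca p x" if "\<And>n. p (x n) \<le> 1"
  using that by (intro cca_ge) auto

lemma cca_le:
  assumes x: "\<And>n. p (x n) \<le> 1" and B: "\<And>k l. n \<le> k \<Longrightarrow> n \<le> l \<Longrightarrow> p (means x k - means x l) \<le> B"
  shows "cca p x \<le> B"
  unfolding cca_def ca_def
proof (rule cINF_lower2[of _ _ n])
  show "bdd_below (range (\<lambda>n. SUP q\<in>{n..} \<times> {n..}. p (means x (fst q) - means x (snd q))))"
  proof (rule bdd_belowI2)
    fix n
    show "0 \<le> (SUP q\<in>{n..} \<times> {n..}. p (means x (fst q) - means x (snd q)))"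
      by (intro cSUP_upper2[where x = "(n, n)"] bdd_above_diff_means x) auto
  qed
  show "(SUP q\<in>{n..} \<times> {n..}. p (means x (fst q) - means x (snd q))) \<le> B"
    using B by (intro cSUP_least) auto
qed simp

lemma cca_tilde_ge:
  assumes "\<And>r :: nat \<Rightarrow> nat. strict_mono r \<Longrightarrow> B \<le> cca p (x \<circ> r)"
  shows "B \<le> cca_tilde p x"
  unfolding cca_tilde_def using assms strict_mono_id by (intro cINF_greatest) auto

lemma cca_tilde_le:
  assumes x: "\<And>n. p (x n) \<le> 1" and r: "strict_mono r" and B: "cca p (x \<circ> r) \<le> B"
  shows "cca_tilde p x \<le> B"
  unfolding cca_tilde_def
proof (rule cINF_lower2[of _ _ r])
  show "bdd_below ((\<lambda>r. cca p (x \<circ> r)) ` {r :: nat \<Rightarrow> nat. strict_mono r})"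
    using x by (intro bdd_belowI2[of _ 0] cca_nonneg) auto
qed (use r B in auto)

lemma cca_tilde_nonneg: "0 \<le> cca_tilde p x" if "\<And>n. p (x n) \<le> 1"
  using that by (intro cca_tilde_ge cca_nonneg) auto

lemma cca_tilde_le_2: "cca_tilde p x \<le> 2" if "\<And>n. p (x n) \<le> 1"
  using that by (intro cca_tilde_le[of x id] cca_le[of _ 0] diff_means_le) (auto simp: strict_mono_def)

lemma cca_tilde_eq_0:
  assumes x: "\<And>n. p (x n) \<le> 1" and r: "strict_mono r"
    and lim: "(\<lambda>m. p (means (x \<circ> r) m - y)) \<longlonglongrightarrow> 0"
  shows "cca_tilde p x = 0"
proof (rule antisym)
  show "cca_tilde p x \<le> 0"
  proof (rule field_le_epsilon)
    fix e :: real assume e: "0 < e"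
    obtain n where n: "\<And>m. m \<ge> n \<Longrightarrow> p (means (x \<circ> r) m - y) < e / 2"
      using LIMSEQ_D[OF lim, of "e / 2"] e by auto
    have "cca p (x \<circ> r) \<le> e"
    proof (rule cca_le[of _ n])
      fix k l assume "n \<le> k" "n \<le> l"
      then show "p (means (x \<circ> r) k - means (x \<circ> r) l) \<le> e"
        using n[of k] n[of l] tri_minus[of "means (x \<circ> r) k - y" "means (x \<circ> r) l - y"] by simp
    qed (use x in auto)
    then show "cca_tilde p x \<le> 0 + e"
      using x r by (intro cca_tilde_le[of x r]) auto
  qed
qed (rule cca_tilde_nonneg[OF x])

text \<open>The coefficients of the difference are nearly \<open>- 1 / q ^ 2\<close> on the first
  \<open>q ^ 2\<close> indices and \<open>1 / q ^ 4\<close> on the rest. Discarding the first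
  \<open>q\<close> indices costs \<open>1 / q\<close> and leaves a set covered by the spread
  estimate, with mass at least \<open>2 - 3 / q\<close>. Together these losses are
  \<open>4 / q\<close>, which is at most \<open>d\<close>.\<close>

lemma spread_ell1_diff_means:
  assumes x: "\<And>n. p (x n) \<le> 1" and spread: "spread_ell1 (1 - d) x"
    and d: "0 < d" "d < 1" and q: "4 / d \<le> real q"
  shows "2 - 3 * d \<le> p (means x (q ^ 4 - 1) - means x (q ^ 2 - 1))"
proof -
  have q0: "0 < real q" using d q by (meson divide_pos_pos less_le_trans zero_less_numeral)
  then have q1: "1 \<le> q" by simp
  \<comment> \<open>\<open>means\<close> at index m averages m + 1 terms, so the index
    \<open>q ^ j - 1\<close> stands for exactly \<open>q ^ j\<close> terms.\<close>
  have m: "means x (q ^ j - 1) = (\<Sum>i<q ^ j. (1 / real q ^ j) *\<^sub>R x i)" for j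
    using q1 by (simp add: means_def scaleR_sum_right flip: lessThan_Suc_atMost)
  define c where "c = (\<lambda>i. (if i < q ^ 2 then - 1 / real q ^ 2 else 0) + 1 / real q ^ 4)"
  have q24: "q \<le> q ^ 2" "q ^ 2 \<le> q ^ 4"
    using q1 power_increasing[of 1 2 q] power_increasing[of 2 4 q] by auto
  have "(\<Sum>i<q ^ 2. (1 / real q ^ 2) *\<^sub>R x i) = (\<Sum>i<q ^ 4. if i < q ^ 2 then (1 / real q ^ 2) *\<^sub>R x i else 0)"
    using q24 by (intro sum.mono_neutral_cong_left) auto
  then have D: "means x (q ^ 4 - 1) - means x (q ^ 2 - 1) = (\<Sum>i<q ^ 4. c i *\<^sub>R x i)"
    unfolding m by (simp add: c_def scaleR_add_left sum.distrib if_distrib[of "\<lambda>c. c *\<^sub>R _"] cong: if_cong)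
      (simp add: sum_negf[symmetric] if_distrib[of uminus] cong: if_cong)
  also have "{..<q ^ 4} = {..<q} \<union> {q..<q ^ 4}"
    using q24 by auto
  also have "(\<Sum>i\<in>\<dots>. c i *\<^sub>R x i) = (\<Sum>i<q. c i *\<^sub>R x i) + (\<Sum>i=q..<q ^ 4. c i *\<^sub>R x i)"
    by (intro sum.union_disjoint) auto
  finally have split: "means x (q ^ 4 - 1) - means x (q ^ 2 - 1) =
      (\<Sum>i<q. c i *\<^sub>R x i) + (\<Sum>i=q..<q ^ 4. c i *\<^sub>R x i)" .
  have le: "1 / real q ^ 4 \<le> 1 / real q ^ 2"
    using q1 by (intro divide_left_mono power_increasing) auto
  have c1: "\<bar>c i\<bar> = 1 / real q ^ 2 - 1 / real q ^ 4" if "i < q ^ 2" for i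
    using that le by (simp add: c_def)
  have c2: "\<bar>c i\<bar> = 1 / real q ^ 4" if "\<not> i < q ^ 2" for i
    using that by (simp add: c_def)
  have small: "p (\<Sum>i<q. c i *\<^sub>R x i) \<le> 1 / real q"
  proof -
    have "p (\<Sum>i<q. c i *\<^sub>R x i) \<le> (\<Sum>i<q. 1 / real q ^ 2)"
    proof (rule order_trans[OF tri_sum sum_mono])
      fix i assume "i \<in> {..<q}"
      then have "\<bar>c i\<bar> \<le> 1 / real q ^ 2" using q24 by (subst c1) auto
      then have "\<bar>c i\<bar> * p (x i) \<le> 1 / real q ^ 2 * 1" using x by (intro mult_mono) auto
      then show "p (c i *\<^sub>R x i) \<le> 1 / real q ^ 2" by (simp add: homog)
    qed
    also have "\<dots> = 1 / real q" using q0 by (simp add: power2_eq_square)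
    finally show ?thesis .
  qed
  have "{q..<q ^ 4} = {q..<q ^ 2} \<union> {q ^ 2..<q ^ 4}"
    using q24 by auto
  then have "(\<Sum>i=q..<q ^ 4. \<bar>c i\<bar>) = (\<Sum>i=q..<q ^ 2. \<bar>c i\<bar>) + (\<Sum>i=q ^ 2..<q ^ 4. \<bar>c i\<bar>)"
    by (simp add: sum.union_disjoint)
  also have "\<dots> = (real q ^ 2 - real q) * (1 / real q ^ 2 - 1 / real q ^ 4) + (real q ^ 4 - real q ^ 2) * (1 / real q ^ 4)"
    using q24 by (simp add: c1 c2 of_nat_diff)
  also have "\<dots> = 2 - 1 / real q - 2 / real q ^ 2 + 1 / real q ^ 3"
    using q0 by (simp add: field_simps) (simp add: algebra_simps power_def numeral_eq_Suc)
  also have "\<dots> \<ge> 2 - 3 / real q"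
  proof -
    have "1 / real q ^ 2 \<le> 1 / real q" using q1 by (intro divide_left_mono) (auto simp: power2_eq_square)
    moreover have "0 \<le> 1 / real q ^ 3" by simp
    moreover have "3 / real q = 3 * (1 / real q)" "2 / real q ^ 2 = 2 * (1 / real q ^ 2)" by simp_all
    ultimately show ?thesis by linarith
  qed
  finally have mass: "2 - 3 / real q \<le> (\<Sum>i=q..<q ^ 4. \<bar>c i\<bar>)" .
  have "(1 - d) * (\<Sum>i=q..<q ^ 4. \<bar>c i\<bar>) \<le> p (\<Sum>i=q..<q ^ 4. c i *\<^sub>R x i)"
  proof -
    have "q ^ 4 \<le> Suc q ^ 4" by (intro power_mono) auto
    then have "card {q..<q ^ 4} \<le> Suc q ^ 4" by (simp only: card_atLeastLessThan)
    then show ?thesis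
      by (intro spread[unfolded spread_ell1_def, rule_format, of _ q]) auto
  qed
  moreover have "(1 - d) * (2 - 3 / real q) \<le> (1 - d) * (\<Sum>i=q..<q ^ 4. \<bar>c i\<bar>)"
    using mass d by (intro mult_left_mono) auto
  moreover have "(1 - d) * (2 - 3 / real q) \<ge> 2 - 2 * d - 3 / real q"
    using d q0 by (simp add: field_simps)
  moreover have "4 / real q \<le> d"
    using q q0 d by (simp add: field_simps)
  moreover have "4 / real q = 3 / real q + 1 / real q"
    by (simp add: field_simps)
  moreover have "p (\<Sum>i=q..<q ^ 4. c i *\<^sub>R x i) \<le> p (means x (q ^ 4 - 1) - means x (q ^ 2 - 1)) + p (\<Sum>i<q. c i *\<^sub>R x i)"
    using tri_minus[of "means x (q ^ 4 - 1) - means x (q ^ 2 - 1)" "\<Sum>i<q. c i *\<^sub>R x i"] unfolding split by simp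
  ultimately show ?thesis using small by linarith
qed

text \<open>The spread estimate survives passing to subsequences with the same constant, so the
  oscillation bound withstands the infimum in \<open>cca_tilde\<close>.\<close>

lemma spread_ell1_cca_tilde:
  assumes x: "\<And>n. p (x n) \<le> 1" and spread: "spread_ell1 (1 - d) x" and d: "0 < d" "d < 1"
  shows "2 - 3 * d \<le> cca_tilde p x"
proof (intro cca_tilde_ge cca_ge)
  fix r :: "nat \<Rightarrow> nat" and n :: nat
  assume r: "strict_mono r"
  obtain q0 :: nat where q0: "4 / d \<le> real q0"
    using real_arch_simple by blast
  define q where "q = max q0 (n + 2)"
  have "Suc n \<le> q ^ j" if "j \<ge> 1" for j
  proof -
    have "Suc n \<le> q" by (simp add: q_def)
    also have "q \<le> q ^ j"
      using power_increasing[of 1 j q] that by (simp add: q_def)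
    finally show ?thesis .
  qed
  from this[of 4] this[of 2] have "n \<le> q ^ 4 - 1" "n \<le> q ^ 2 - 1"
    by auto
  moreover have "2 - 3 * d \<le> p (means (x \<circ> r) (q ^ 4 - 1) - means (x \<circ> r) (q ^ 2 - 1))"
    using x q0 by (intro spread_ell1_diff_means spread_ell1_subseq[OF spread r] d) (auto simp: q_def)
  ultimately show "\<exists>k\<ge>n. \<exists>l\<ge>n. 2 - 3 * d \<le> p (means (x \<circ> r) k - means (x \<circ> r) l)"
    by blast
qed (use x in auto)

text \<open>Because of the blocks, \<open>w\<close> is in general no subsequence of
  \<open>z\<close>. The bound that the Cesaro argument wants comes from weak nullity by uniform
  boundedness.\<close>

lemma ex_spread_ell1:
  assumes z: "weakly_null z"
    and no: "\<And>r :: nat \<Rightarrow> nat. strict_mono r \<Longrightarrow> \<not> (\<lambda>m. p (means (z \<circ> r) m)) \<longlonglongrightarrow> 0"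
    and d: "0 < d" "d < 1"
  shows "\<exists>w. weakly_null w \<and> (\<forall>n. p (w n) \<le> 1) \<and> spread_ell1 (1 - d) w"
proof -
  obtain C where C: "\<And>n. p (z n) \<le> C"
    using uniform_boundedness[of z] z convergent_imp_bounded by (fastforce simp: weakly_null_def)
  obtain e and r :: "nat \<Rightarrow> nat" where e: "0 < e" and r: "strict_mono r" and per: "persistent e (z \<circ> r)"
    using ex_persistent_subseq[OF C no] by blast
  obtain s :: "nat \<Rightarrow> nat" where s: "strict_mono s" and ell1: "\<And>F a. finite F \<Longrightarrow> (\<forall>i\<in>F. card F < i) \<Longrightarrow>
    e / 4 * (\<Sum>i\<in>F. \<bar>a i\<bar>) \<le> p (\<Sum>i\<in>F. a i *\<^sub>R (z \<circ> r) (s i))"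
    using persistent_imp_ell1_subseq[OF per weakly_null_subseq[OF z r] e] by blast
  have "asymp_ell1 (e / 4) (z \<circ> (r \<circ> s))"
    unfolding asymp_ell1_def
  proof (intro allI exI impI)
    fix k F a
    assume "finite F" "F \<subseteq> {Suc k..}" "card F \<le> k"
    then show "e / 4 * (\<Sum>i\<in>F. \<bar>a i\<bar>) \<le> p (\<Sum>i\<in>F. a i *\<^sub>R (z \<circ> (r \<circ> s)) i)"
      using ell1[of F a] by (force simp: subset_iff)
  qed
  moreover have "weakly_null (z \<circ> (r \<circ> s))"
    using z strict_mono_o[OF r s] by (rule weakly_null_subseq)
  ultimately obtain y where y: "weakly_null y" "\<And>n. p (y n) \<le> 1" "asymp_ell1 (1 - d) y"
    using asymp_ell1_blocks[of "e / 4" "z \<circ> (r \<circ> s)" C d] C e d by auto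
  obtain t :: "nat \<Rightarrow> nat" where "strict_mono t" "spread_ell1 (1 - d) (y \<circ> t)"
    using asymp_imp_spread_ell1[OF y(3)] by blast
  then show ?thesis
    using y weakly_null_subseq[OF y(1)] by (intro exI[of _ "y \<circ> t"]) auto
qed

end

section \<open>The dichotomy\<close>

lemma tendsto_0_means:
  fixes x :: "nat \<Rightarrow> real"
  assumes "x \<longlonglongrightarrow> 0"
  shows "(\<lambda>m. (\<Sum>i\<le>m. x i) / real (Suc m)) \<longlonglongrightarrow> 0"
proof (rule LIMSEQ_I)
  fix e :: real assume e: "0 < e"
  obtain M where M: "\<And>i. i \<ge> M \<Longrightarrow> \<bar>x i\<bar> < e / 2"
    using LIMSEQ_D[OF assms, of "e / 2"] e by auto
  define S where "S = (\<Sum>i<M. \<bar>x i\<bar>)"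
  obtain K :: nat where K: "S / (e / 2) < real K" using reals_Archimedean2 by blast
  have "norm ((\<Sum>i\<le>m. x i) / real (Suc m) - 0) < e" if m: "m \<ge> K" for m
  proof -
    have "\<bar>\<Sum>i\<le>m. x i\<bar> \<le> (\<Sum>i\<le>m. (if i < M then \<bar>x i\<bar> else 0) + e / 2)"
      using M e by (intro order_trans[OF sum_abs] sum_mono) (auto simp: not_less less_imp_le)
    also have "\<dots> = (\<Sum>i\<in>{..m} \<inter> {..<M}. \<bar>x i\<bar>) + real (Suc m) * (e / 2)"
      by (simp add: sum.distrib sum.If_cases lessThan_def)
    also have "\<dots> \<le> S + real (Suc m) * (e / 2)"
      unfolding S_def by (intro add_right_mono sum_mono2) auto
    also have "S < real (Suc m) * (e / 2)"
    proof -
      have "S / (e / 2) < real (Suc m)" using K m by simp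
      then show ?thesis using e by (simp only: pos_divide_less_eq half_gt_zero)
    qed
    finally show ?thesis by (simp add: field_simps abs_divide del: of_nat_Suc)
  qed
  then show "\<exists>K. \<forall>m\<ge>K. norm ((\<Sum>i\<le>m. x i) / real (Suc m) - 0) < e" by blast
qed

lemma ca_cong: "(\<And>k l. N (s k - s l) = M (s k - s l)) \<Longrightarrow> ca N s = ca M s"
  by (simp add: ca_def)

lemma subspace_means: "subspace V \<Longrightarrow> (\<And>k. s k \<in> V) \<Longrightarrow> means s m \<in> V"
  unfolding means_def by (intro subspace_scale subspace_sum)

lemma means_diff_const: "means (\<lambda>k. s k - x) m = means s m - x"
  by (simp add: means_def sum_subtractf scaleR_diff_right scaleR_conv_of_real sum_constant_scaleR del: of_nat_Suc)

locale banach_pair =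
  fixes V :: "'a::real_vector set" and nrm :: "'a \<Rightarrow> real"
  assumes banach: "banach_space V nrm"
begin

lemma subspace: "subspace V"
  using banach by (simp add: banach_space_def)

text \<open>A purely algebraic projection. No continuity enters: the seminorm \<open>ext\<close>
  built from it is constant along the kernel of the projection by construction.\<close>

definition proj :: "'a \<Rightarrow> 'a" where
  "proj = (SOME \<pi>. linear \<pi> \<and> (\<forall>v\<in>V. \<pi> v = v) \<and> range \<pi> \<subseteq> V)"

lemma linear_proj: "linear proj"
  and proj_id: "v \<in> V \<Longrightarrow> proj v = v"
  and proj_in: "proj x \<in> V"
proof -
  have "\<exists>\<pi>. linear \<pi> \<and> (\<forall>v\<in>V. \<pi> v = v) \<and> range \<pi> \<subseteq> V"
    using linear_exists_left_inverse_on[OF linear_id subspace] by (auto simp: id_def)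
  from someI_ex[OF this, folded proj_def]
  show "linear proj" "v \<in> V \<Longrightarrow> proj v = v" "proj x \<in> V"
    by auto
qed

definition ext :: "'a \<Rightarrow> real" where
  "ext x = nrm (proj x)"

lemma ext_eq: "x \<in> V \<Longrightarrow> ext x = nrm x"
  by (simp add: ext_def proj_id)

lemma ext_proj: "ext (proj x) = ext x"
  by (simp add: ext_def proj_id proj_in)

sublocale ext: seminorm ext
proof
  show "ext (x + y) \<le> ext x + ext y" for x y
    using banach proj_in by (simp add: ext_def linear_add[OF linear_proj] banach_space_def)
  show "ext (c *\<^sub>R x) = \<bar>c\<bar> * ext x" for c x
    using banach proj_in by (simp add: ext_def linear_scale[OF linear_proj] banach_space_def)
qed

text \<open>Members of \<open>dual_space\<close> are controlled on \<open>V\<close> only and may be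
  arbitrary elsewhere. Composing with \<open>proj\<close> and dividing by a bound turns them into
  members of the dual ball of \<open>ext\<close>.\<close>

lemma weakly_convergent_to_iff:
  "weakly_convergent_to V nrm s x \<longleftrightarrow>
     (\<forall>k. s k \<in> V) \<and> x \<in> V \<and> ext.weakly_null (\<lambda>k. s k - x)"
proof (intro iffI conjI allI; (elim conjE)?)
  assume w: "weakly_convergent_to V nrm s x"
  then show "s k \<in> V" "x \<in> V" for k
    by (auto simp: weakly_convergent_to_def)
  show "ext.weakly_null (\<lambda>k. s k - x)"
    unfolding ext.weakly_null_def
  proof
    fix f assume f: "f \<in> ext.dual_ball"
    have lin: "linear f" using f by (rule ext.dual_ball_linear)
    have "\<forall>x\<in>V. \<bar>f x\<bar> \<le> 1 * nrm x"
      using ext.dual_ball_le[OF f] ext_eq by (metis mult_1)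
    then have "f \<in> dual_space V nrm"
      using linear_add[OF lin] linear_scale[OF lin] unfolding dual_space_def mem_Collect_eq real_scaleR_def by blast
    then have "(\<lambda>k. f (s k)) \<longlonglongrightarrow> f x"
      using w by (simp add: weakly_convergent_to_def)
    then show "(\<lambda>k. f (s k - x)) \<longlonglongrightarrow> 0"
      by (simp add: linear_diff[OF lin] LIM_zero_iff)
  qed
next
  assume s: "\<forall>k. s k \<in> V" and x: "x \<in> V" and null: "ext.weakly_null (\<lambda>k. s k - x)"
  show "weakly_convergent_to V nrm s x"
    unfolding weakly_convergent_to_def
  proof (intro conjI ballI)
    fix f assume f: "f \<in> dual_space V nrm"
    then obtain C where C: "\<And>x. x \<in> V \<Longrightarrow> \<bar>f x\<bar> \<le> C * nrm x"
      unfolding dual_space_def by blast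
    \<comment> \<open>The bound \<open>C\<close> may fail to be positive, and \<open>D\<close>
      serves as a divisor.\<close>
    define D where "D = max C 1"
    have D: "0 < D" "C \<le> D" by (auto simp: D_def)
    define g where "g = (\<lambda>x. f (proj x) / D)"
    have "g \<in> ext.dual_ball"
      unfolding ext.dual_ball_def mem_Collect_eq
    proof (intro conjI allI linearI)
      show "g (a + b) = g a + g b" for a b
        using f proj_in D by (simp add: g_def linear_add[OF linear_proj] dual_space_def add_divide_distrib)
      show "g (c *\<^sub>R a) = c *\<^sub>R g a" for c a
        using f proj_in D by (simp add: g_def linear_scale[OF linear_proj] dual_space_def)
      show "\<bar>g a\<bar> \<le> ext a" for a
      proof -
        have "\<bar>f (proj a)\<bar> \<le> D * ext a"
          using C[OF proj_in, of a] mult_right_mono[OF D(2) ext.p_ge_0, of a] by (simp add: ext_def)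
        then show ?thesis using D by (simp add: g_def field_simps)
      qed
    qed
    then have "(\<lambda>k. g (s k - x)) \<longlonglongrightarrow> 0"
      using null by (simp add: ext.weakly_null_def)
    then have "(\<lambda>k. D * g (s k - x)) \<longlonglongrightarrow> 0"
      by (rule tendsto_mult_right_zero)
    moreover have "D * g (s k - x) = f (s k) - f x" for k
    proof -
      have "f (s k - x) = f (s k + (- 1) *\<^sub>R x)" by simp
      also have "\<dots> = f (s k) + f ((- 1) *\<^sub>R x)"
        using f s subspace_scale[OF subspace x] unfolding dual_space_def by blast
      also have "f ((- 1) *\<^sub>R x) = - 1 * f x"
        using f x unfolding dual_space_def by blast
      finally show ?thesis
        using s x D subspace_diff[OF subspace] by (simp add: g_def proj_id)
    qed
    ultimately show "(\<lambda>k. f (s k)) \<longlonglongrightarrow> f x"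
      by (simp add: LIM_zero_iff)
  qed (use s x in auto)
qed

text \<open>Means along a subsequence of a weakly null sequence are weakly null, so 0 is their only
  possible norm limit. Index \<open>2 * Suc k - 1\<close> stands for \<open>2 * (k + 1)\<close>
  terms: the last \<open>k + 1\<close> of them lie so far out that they can form a Schreier set, and
  they carry half of the weight.\<close>

lemma not_weak_banach_saksI:
  assumes s: "\<And>k. s k \<in> V" and null: "\<And>f. f \<in> dual_space V nrm \<Longrightarrow> (\<lambda>k. f (s k)) \<longlonglongrightarrow> 0"
    and e: "0 < e" "\<And>r k. strict_mono r \<Longrightarrow> e \<le> nrm (means (s \<circ> r) (2 * Suc k - 1))"
  shows "\<not> weak_banach_saks V nrm"
proof
  have "(\<lambda>k. f (s k)) \<longlonglongrightarrow> f 0" if f: "f \<in> dual_space V nrm" for f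
  proof -
    have "f (0 *\<^sub>R 0) = 0 * f 0" using f subspace_0[OF subspace] unfolding dual_space_def by blast
    then show ?thesis using null[OF f] by simp
  qed
  then have to: "weakly_convergent_to V nrm s 0"
    using s subspace_0[OF subspace] by (auto simp: weakly_convergent_to_def)
  assume "weak_banach_saks V nrm"
  then obtain r y where r: "strict_mono r" and y: "y \<in> V"
    and lim: "(\<lambda>m. nrm (means (s \<circ> r) m - y)) \<longlonglongrightarrow> 0"
    using to by (auto simp: weak_banach_saks_def weakly_convergent_def)
  have mV: "means (s \<circ> r) m \<in> V" for m
    using s by (intro subspace_means[OF subspace]) simp
  have lim: "(\<lambda>m. ext (means (s \<circ> r) m - y)) \<longlonglongrightarrow> 0"
    using lim mV y by (simp add: ext_eq subspace_diff[OF subspace])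
  obtain f where f: "f \<in> ext.dual_ball" "f y = ext y"
    using ext.ex_norming by blast
  have lin: "linear f" using f(1) by (rule ext.dual_ball_linear)
  have "(\<lambda>k. f (s k)) \<longlonglongrightarrow> 0"
    using to f(1) by (simp add: weakly_convergent_to_iff ext.weakly_null_def)
  then have "(\<lambda>k. f (s (r k))) \<longlonglongrightarrow> 0"
    using LIMSEQ_subseq_LIMSEQ[OF _ r] by (simp add: comp_def)
  from tendsto_0_means[OF this] have 0: "(\<lambda>m. f (means (s \<circ> r) m)) \<longlonglongrightarrow> 0"
    by (simp add: means_def linear_scale[OF lin] linear_sum[OF lin])
  have "(\<lambda>m. f (means (s \<circ> r) m - y)) \<longlonglongrightarrow> 0"
    using ext.dual_ball_le[OF f(1)] by (intro Lim_null_comparison[OF _ lim]) simp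
  then have "(\<lambda>m. f (means (s \<circ> r) m)) \<longlonglongrightarrow> f y"
    by (simp add: linear_diff[OF lin] LIM_zero_iff)
  then have "ext y = 0" using LIMSEQ_unique[OF _ 0] f(2) by simp
  obtain M where M: "\<And>m. m \<ge> M \<Longrightarrow> ext (means (s \<circ> r) m - y) < e"
    using order_tendstoD(2)[OF lim e(1)] by (auto simp: eventually_sequentially)
  have "e \<le> ext (means (s \<circ> r) (2 * Suc M - 1))"
    using e(2)[OF r, of M] mV by (simp add: ext_eq)
  then show False
    using M[of "2 * Suc M - 1"] ext.tri[of "means (s \<circ> r) (2 * Suc M - 1) - y" y] \<open>ext y = 0\<close> by simp
qed

lemma cca_tilde_ext:
  assumes "\<And>k. s k \<in> V"
  shows "cca_tilde nrm s = cca_tilde ext s"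
proof -
  have "cca nrm (s \<circ> r) = cca ext (s \<circ> r)" for r
    unfolding cca_def
    by (intro ca_cong ext_eq[symmetric] subspace_diff[OF subspace] subspace_means[OF subspace])
      (simp_all add: assms)
  then show ?thesis by (simp add: cca_tilde_def)
qed

lemma cca_tilde_unit_ball:
  assumes "\<And>k. s k \<in> unit_ball V nrm"
  shows "0 \<le> cca_tilde nrm s" "cca_tilde nrm s \<le> 2"
  using assms ext.cca_tilde_nonneg[of s] ext.cca_tilde_le_2[of s]
  by (auto simp: cca_tilde_ext unit_ball_def ext_eq)

lemma zero_seq: "(\<lambda>_. 0) \<in> {s. (\<forall>k. s k \<in> unit_ball V nrm) \<and> weakly_convergent V nrm s}"
  using subspace_0[OF subspace] ext_eq[of 0]
  by (auto simp: unit_ball_def weakly_convergent_def weakly_convergent_to_def)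

lemma bdd_cca_tilde:
  "bdd_above (cca_tilde nrm ` {s. (\<forall>k. s k \<in> unit_ball V nrm) \<and> weakly_convergent V nrm s})"
  "bdd_above (cca_tilde nrm ` {s. \<forall>k. s k \<in> unit_ball V nrm})"
  using cca_tilde_unit_ball(2) by (auto intro!: bdd_aboveI2)

lemma wbs_eq_0:
  assumes "weak_banach_saks V nrm"
  shows "wbs V nrm (unit_ball V nrm) = 0"
proof -
  have "cca_tilde nrm s = 0" if s: "\<And>k. s k \<in> unit_ball V nrm" "weakly_convergent V nrm s" for s
  proof -
    obtain r y where r: "strict_mono r" and y: "y \<in> V" and lim: "(\<lambda>m. nrm (means (s \<circ> r) m - y)) \<longlonglongrightarrow> 0"
      using assms s(2) by (auto simp: weak_banach_saks_def)
    have sV: "s k \<in> V" "ext (s k) \<le> 1" for k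
      using s(1) by (auto simp: unit_ball_def ext_eq)
    have "ext (means (s \<circ> r) m - y) = nrm (means (s \<circ> r) m - y)" for m
      using sV y by (intro ext_eq subspace_diff[OF subspace] subspace_means[OF subspace]) auto
    then have "cca_tilde ext s = 0"
      using lim by (intro ext.cca_tilde_eq_0[OF sV(2) r, where y = y]) simp
    then show ?thesis using cca_tilde_ext[OF sV(1)] by simp
  qed
  then have "cca_tilde nrm ` {s. (\<forall>k. s k \<in> unit_ball V nrm) \<and> weakly_convergent V nrm s} = {0}"
    using zero_seq by (auto simp: image_iff)
  then show ?thesis by (simp add: wbs_def)
qed

lemma
  assumes "\<not> weak_banach_saks V nrm"
  shows wbs_eq_2: "wbs V nrm (unit_ball V nrm) = 2"
    and bs_eq_2: "bs V nrm (unit_ball V nrm) = 2"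
proof -
  obtain s where "weakly_convergent V nrm s"
    and no: "\<And>r y. strict_mono r \<Longrightarrow> y \<in> V \<Longrightarrow> \<not> (\<lambda>m. nrm (means (s \<circ> r) m - y)) \<longlonglongrightarrow> 0"
    using assms by (auto simp: weak_banach_saks_def)
  then obtain x where s: "\<And>k. s k \<in> V" and x: "x \<in> V" and null: "ext.weakly_null (\<lambda>k. s k - x)"
    by (auto simp: weakly_convergent_def weakly_convergent_to_iff)
  have no_ext: "\<not> (\<lambda>m. ext (means ((\<lambda>k. s k - x) \<circ> r) m)) \<longlonglongrightarrow> 0" if r: "strict_mono r" for r :: "nat \<Rightarrow> nat"
  proof -
    have "ext (means ((\<lambda>k. s k - x) \<circ> r) m) = nrm (means (s \<circ> r) m - x)" for m
    proof -
      have "means ((\<lambda>k. s k - x) \<circ> r) m = means (s \<circ> r) m - x"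
        using means_diff_const[of "s \<circ> r" x m] by (simp add: comp_def)
      then show ?thesis
        using s x by (simp add: ext_eq subspace_diff[OF subspace] subspace_means[OF subspace])
    qed
    then show ?thesis using no[OF r x] by simp
  qed
  have ex: "\<exists>u\<in>{s. (\<forall>k. s k \<in> unit_ball V nrm) \<and> weakly_convergent V nrm s}. 2 - 3 * d \<le> cca_tilde nrm u"
    if d: "0 < d" "d < 1" for d
  proof -
    obtain w where w: "ext.weakly_null w" "\<And>n. ext (w n) \<le> 1" "ext.spread_ell1 (1 - d) w"
      using ext.ex_spread_ell1[OF null no_ext d] by blast
    \<comment> \<open>The extracted sequence is known only as a sequence in the whole type.
      Projecting it into \<open>V\<close> changes no value of \<open>ext\<close>, so every estimate
      is kept.\<close>
    define u where "u = (\<lambda>n. proj (w n))"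
    have u: "u k \<in> V" "ext (u k) \<le> 1" for k
      by (auto simp: u_def proj_in ext_proj w(2))
    have "ext (\<Sum>i\<in>F. a i *\<^sub>R u i) = ext (\<Sum>i\<in>F. a i *\<^sub>R w i)" for F and a :: "nat \<Rightarrow> real"
    proof -
      have "(\<Sum>i\<in>F. a i *\<^sub>R u i) = proj (\<Sum>i\<in>F. a i *\<^sub>R w i)"
        by (simp add: u_def linear_sum[OF linear_proj] linear_scale[OF linear_proj])
      then show ?thesis by (simp add: ext_proj)
    qed
    then have "ext.spread_ell1 (1 - d) u"
      using w(3) by (simp add: ext.spread_ell1_def)
    then have "2 - 3 * d \<le> cca_tilde nrm u"
      using ext.spread_ell1_cca_tilde[OF u(2) _ d] cca_tilde_ext[OF u(1)] by simp
    moreover have "ext.weakly_null u"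
      unfolding ext.weakly_null_def
    proof
      fix f assume f: "f \<in> ext.dual_ball"
      have "f \<circ> proj \<in> ext.dual_ball"
        using linear_compose[OF linear_proj ext.dual_ball_linear[OF f]] ext.dual_ball_le[OF f, of "proj _"]
        by (auto simp: ext.dual_ball_def ext_proj)
      then show "(\<lambda>n. f (u n)) \<longlonglongrightarrow> 0"
        using w(1) by (auto simp: ext.weakly_null_def u_def comp_def)
    qed
    then have "weakly_convergent V nrm u"
      using u subspace_0[OF subspace] by (auto simp: weakly_convergent_def weakly_convergent_to_iff intro!: exI[of _ 0])
    moreover have "u k \<in> unit_ball V nrm" for k
      using u by (simp add: unit_ball_def ext_eq[symmetric])
    ultimately show ?thesis by blast
  qed
  have ge: "2 - 3 * d \<le> wbs V nrm (unit_ball V nrm)" "2 - 3 * d \<le> bs V nrm (unit_ball V nrm)"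
    if d: "0 < d" "d < 1" for d
  proof -
    obtain u where "u \<in> {s. (\<forall>k. s k \<in> unit_ball V nrm) \<and> weakly_convergent V nrm s}" "2 - 3 * d \<le> cca_tilde nrm u"
      using ex[OF d] by blast
    then show "2 - 3 * d \<le> wbs V nrm (unit_ball V nrm)" "2 - 3 * d \<le> bs V nrm (unit_ball V nrm)"
      unfolding wbs_def bs_def by (auto intro!: cSUP_upper2[where x = u] bdd_cca_tilde)
  qed
  \<comment> \<open>For \<open>B < 2\<close> the choice \<open>d = (2 - B) / 6\<close> is
    contradictory, but it is below 1 only when \<open>B > - 4\<close>; the case of very negative
    \<open>B\<close> is therefore handled by \<open>d = 1 / 2\<close>.\<close>
  have "2 \<le> B" if "\<And>d. 0 < d \<Longrightarrow> d < 1 \<Longrightarrow> 2 - 3 * d \<le> B" for B :: real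
  proof (rule ccontr)
    assume B: "\<not> 2 \<le> B"
    show False
    proof (cases "B \<le> - 1")
      case True
      then show False using that[of "1 / 2"] by simp
    next
      case False
      then show False using B that[of "(2 - B) / 6"] by (simp add: field_simps)
    qed
  qed
  from this[OF ge(1)] this[OF ge(2)]
  have "2 \<le> wbs V nrm (unit_ball V nrm)" "2 \<le> bs V nrm (unit_ball V nrm)" by auto
  moreover have "wbs V nrm (unit_ball V nrm) \<le> 2" "bs V nrm (unit_ball V nrm) \<le> 2"
    unfolding wbs_def bs_def using zero_seq cca_tilde_unit_ball(2) by (auto intro!: cSUP_least)
  ultimately show "wbs V nrm (unit_ball V nrm) = 2" "bs V nrm (unit_ball V nrm) = 2" by auto
qed

end

section \<open>A Baernstein-type norm\<close>

definition support_below :: "nat \<Rightarrow> (nat \<Rightarrow> real) \<Rightarrow> bool" where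
  "support_below m x \<longleftrightarrow> (\<forall>i\<ge>m. x i = 0)"

definition tail :: "nat \<Rightarrow> (nat \<Rightarrow> real) \<Rightarrow> nat \<Rightarrow> real" where
  "tail n x i = (if i < n then 0 else x i)"

definition head :: "nat \<Rightarrow> (nat \<Rightarrow> real) \<Rightarrow> nat \<Rightarrow> real" where
  "head n x i = (if i < n then x i else 0)"

lemma support_below_add:
  "support_below m x \<Longrightarrow> support_below n y \<Longrightarrow> support_below (max m n) (\<lambda>i. x i + y i)"
  by (simp add: support_below_def)

lemma support_below_scale: "support_below m x \<Longrightarrow> support_below m (\<lambda>i. c * x i)"
  by (simp add: support_below_def)

lemma support_below_head: "support_below n (head n x)"
  by (simp add: support_below_def head_def)

text \<open>Schreier sets inside \<open>D\<close>. Coordinates are numbered from 0, hence the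
  successor.\<close>

definition admissible :: "nat set \<Rightarrow> nat set \<Rightarrow> bool" where
  "admissible D A \<longleftrightarrow> finite A \<and> A \<noteq> {} \<and> A \<subseteq> D \<and> card A \<le> Suc (Min A)"

text \<open>The singletons ensure that the supremum norm is dominated even outside \<open>D\<close>, where the norm is just the
  supremum norm. For \<open>D = UNIV\<close> this is Baernstein's reflexive space without the Banach-Saks property;
  coordinates outside \<open>D\<close> span a copy of \<open>c\<^sub>0\<close>.\<close>

definition families :: "nat set \<Rightarrow> nat set set set" where
  "families D = {\<G>. finite \<G> \<and> pairwise disjnt \<G> \<and> (\<forall>A\<in>\<G>. admissible D A)} \<union> range (\<lambda>i. {{i}})"

definition fnorm :: "nat set set \<Rightarrow> (nat \<Rightarrow> real) \<Rightarrow> real" where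
  "fnorm \<G> x = L2_set (\<lambda>A. \<Sum>i\<in>A. \<bar>x i\<bar>) \<G>"

lemma families_disjoint:
  assumes "\<G> \<in> families D"
  shows "finite \<G>" "pairwise disjnt \<G>" "\<And>A. A \<in> \<G> \<Longrightarrow> finite A"
  using assms by (auto simp: families_def admissible_def)

lemma families_empty: "{} \<in> families D"
  by (simp add: families_def)

lemma families_singleton: "{{i}} \<in> families D"
  by (auto simp: families_def)

lemma fnorm_nonneg: "0 \<le> fnorm \<G> x"
  by (simp add: fnorm_def)

lemma fnorm_singleton: "fnorm {{i}} x = \<bar>x i\<bar>"
  by (simp add: fnorm_def)

lemma fnorm_mono:
  assumes "\<And>i. \<bar>x i\<bar> \<le> \<bar>y i\<bar>"
  shows "fnorm \<G> x \<le> fnorm \<G> y"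
  unfolding fnorm_def using assms by (intro L2_set_mono sum_mono sum_nonneg) auto

lemma fnorm_triangle: "fnorm \<G> (\<lambda>i. x i + y i) \<le> fnorm \<G> x + fnorm \<G> y"
proof -
  have "fnorm \<G> (\<lambda>i. x i + y i) \<le> L2_set (\<lambda>A. (\<Sum>i\<in>A. \<bar>x i\<bar>) + (\<Sum>i\<in>A. \<bar>y i\<bar>)) \<G>"
    unfolding fnorm_def sum.distrib[symmetric] by (intro L2_set_mono sum_mono sum_nonneg) auto
  also have "\<dots> \<le> fnorm \<G> x + fnorm \<G> y"
    unfolding fnorm_def by (rule L2_set_triangle_ineq)
  finally show ?thesis .
qed

lemma fnorm_scale: "fnorm \<G> (\<lambda>i. c * x i) = \<bar>c\<bar> * fnorm \<G> x"
  by (simp add: fnorm_def abs_mult sum_distrib_left[symmetric] L2_set_right_distrib)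

lemma fnorm_le_sum:
  assumes G: "\<G> \<in> families D" and x: "support_below n x"
  shows "fnorm \<G> x \<le> (\<Sum>i<n. \<bar>x i\<bar>)"
proof -
  note dis = families_disjoint[OF G]
  have "fnorm \<G> x \<le> (\<Sum>A\<in>\<G>. \<Sum>i\<in>A. \<bar>x i\<bar>)"
    unfolding fnorm_def by (intro L2_set_le_sum sum_nonneg) auto
  also have "\<dots> = (\<Sum>i\<in>\<Union>\<G>. \<bar>x i\<bar>)"
    using dis by (subst sum.Union_disjoint) (auto simp: pairwise_def disjnt_def)
  also have "\<dots> = (\<Sum>i\<in>\<Union>\<G> \<inter> {..<n}. \<bar>x i\<bar>)"
    using dis x by (intro sum.mono_neutral_right) (auto simp: support_below_def intro: leI)
  also have "\<dots> \<le> (\<Sum>i<n. \<bar>x i\<bar>)"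
    by (intro sum_mono2) auto
  finally show ?thesis .
qed

locale baernstein =
  fixes D :: "nat set"
begin

text \<open>The real supremum \<open>N\<close> says nothing about a vector on which the family norms
  are unbounded, so boundedness is carried along separately.\<close>

definition finite_norm :: "(nat \<Rightarrow> real) \<Rightarrow> bool" where
  "finite_norm x \<longleftrightarrow> bdd_above ((\<lambda>\<G>. fnorm \<G> x) ` families D)"

definition N :: "(nat \<Rightarrow> real) \<Rightarrow> real" where
  "N x = (SUP \<G>\<in>families D. fnorm \<G> x)"

lemma fnorm_le_N: "finite_norm x \<Longrightarrow> \<G> \<in> families D \<Longrightarrow> fnorm \<G> x \<le> N x"
  unfolding N_def finite_norm_def by (rule cSUP_upper)

lemma N_le: "(\<And>\<G>. \<G> \<in> families D \<Longrightarrow> fnorm \<G> x \<le> B) \<Longrightarrow> N x \<le> B"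
  unfolding N_def using families_empty by (intro cSUP_least) auto

lemma finite_normI: "(\<And>\<G>. \<G> \<in> families D \<Longrightarrow> fnorm \<G> x \<le> B) \<Longrightarrow> finite_norm x"
  unfolding finite_norm_def by (rule bdd_aboveI2)

lemma N_nonneg: "finite_norm x \<Longrightarrow> 0 \<le> N x"
  using fnorm_le_N[OF _ families_empty] fnorm_nonneg order_trans by blast

lemma abs_le_N: "finite_norm x \<Longrightarrow> \<bar>x i\<bar> \<le> N x"
  using fnorm_le_N[OF _ families_singleton] by (simp add: fnorm_singleton)

lemma finite_norm_mono:
  assumes "finite_norm y" "\<And>i. \<bar>x i\<bar> \<le> \<bar>y i\<bar>"
  shows "finite_norm x" "N x \<le> N y"
proof -
  have "fnorm \<G> x \<le> N y" if "\<G> \<in> families D" for \<G>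
    using fnorm_mono[of x y \<G>, OF assms(2)] fnorm_le_N[OF assms(1) that] by simp
  then show "finite_norm x" "N x \<le> N y"
    by (auto intro: finite_normI N_le)
qed

lemma finite_norm_add:
  assumes "finite_norm x" "finite_norm y"
  shows "finite_norm (\<lambda>i. x i + y i)" "N (\<lambda>i. x i + y i) \<le> N x + N y"
proof -
  have "fnorm \<G> (\<lambda>i. x i + y i) \<le> N x + N y" if "\<G> \<in> families D" for \<G>
    using fnorm_triangle[of \<G> x y] fnorm_le_N[OF assms(1) that] fnorm_le_N[OF assms(2) that] by simp
  then show "finite_norm (\<lambda>i. x i + y i)" "N (\<lambda>i. x i + y i) \<le> N x + N y"
    by (auto intro!: finite_normI N_le)
qed

lemma finite_norm_scale:
  assumes "finite_norm x"
  shows "finite_norm (\<lambda>i. c * x i)" "N (\<lambda>i. c * x i) = \<bar>c\<bar> * N x"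
proof -
  have le: "fnorm \<G> (\<lambda>i. c * x i) \<le> \<bar>c\<bar> * N x" if "\<G> \<in> families D" "finite_norm x" for \<G> c x
    using fnorm_le_N[OF that(2,1)] by (simp add: fnorm_scale mult_left_mono)
  have fin: "finite_norm (\<lambda>i. c * x i)" for c
    using le[OF _ assms] by (auto intro: finite_normI)
  then show "finite_norm (\<lambda>i. c * x i)" .
  have N_le_scale: "N (\<lambda>i. c * x i) \<le> \<bar>c\<bar> * N x" if "finite_norm x" for c x
    using le[OF _ that] by (rule N_le)
  show "N (\<lambda>i. c * x i) = \<bar>c\<bar> * N x"
  proof (cases "c = 0")
    case True
    then show ?thesis
      using N_le_scale[OF assms, of 0] N_nonneg[OF fin[of 0]] by simp
  next
    case False
    then have "N x \<le> \<bar>1 / c\<bar> * N (\<lambda>i. c * x i)"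
      using N_le_scale[OF fin, of "1 / c" c] by simp
    then show ?thesis
      using False N_le_scale[OF assms, of c] by (simp add: field_simps)
  qed
qed

lemma finite_norm_support:
  assumes "support_below n x"
  shows "finite_norm x" "N x \<le> (\<Sum>i<n. \<bar>x i\<bar>)"
  using fnorm_le_sum[OF _ assms] by (auto intro: finite_normI N_le)

text \<open>The step of the shrinking argument: a flat vector far to the right adds at most a constant to the square of
  the norm, because only few admissible sets, each of bounded size, meet both supports.\<close>

lemma N_add_flat:
  assumes v: "support_below m v"
  shows "\<exists>b>0. \<forall>w. finite_norm w \<longrightarrow> (\<forall>i<m. w i = 0) \<longrightarrow> (\<forall>i. \<bar>w i\<bar> \<le> b) \<longrightarrow> N w \<le> 1 \<longrightarrow>
    (N (\<lambda>i. v i + w i))\<^sup>2 \<le> (N v)\<^sup>2 + 3"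
proof -
  have fv: "finite_norm v" using v by (rule finite_norm_support)
  then have Nv: "0 \<le> N v" by (rule N_nonneg)
  \<comment> \<open>Sets meeting \<open>{..<m}\<close> have distinct minima below \<open>m\<close>:
    at most \<open>m\<close> of them, with at most \<open>m\<close> elements each. On them
    \<open>w\<close> adds at most \<open>h = m ^ 2 * b\<close>, and this \<open>b\<close> makes
    \<open>(N v + h)\<^sup>2\<close> at most \<open>(N v)\<^sup>2 + 2\<close>. The remaining sets
    see only \<open>w\<close> and add at most 1.\<close>
  define b where "b = 1 / (2 * (real m ^ 2 + 1) * (N v + 1))"
  have b: "0 < b" using Nv by (simp add: b_def add_nonneg_pos)
  define h where "h = real m ^ 2 * b"
  have h: "0 \<le> h" "2 * (N v + 1) * h \<le> 1"
  proof -
    have "2 * (N v + 1) * h = real m ^ 2 / (real m ^ 2 + 1)"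
    proof -
      have "N v + 1 \<noteq> 0" "real m ^ 2 + 1 \<noteq> 0"
        using Nv add_nonneg_pos[OF zero_le_power2[of "real m"] zero_less_one] by auto
      then show ?thesis by (simp add: h_def b_def divide_simps) (simp add: algebra_simps)
    qed
    also have "\<dots> \<le> 1" by (simp add: add_nonneg_pos)
    finally show "2 * (N v + 1) * h \<le> 1" .
  qed (use b in \<open>auto simp: h_def\<close>)
  have h1: "h \<le> 1" 
    using h Nv mult_right_mono[of 1 "2 * (N v + 1)" h] by simp
  have sq: "(N v + h)\<^sup>2 \<le> (N v)\<^sup>2 + 2"
  proof -
    have "(N v + h)\<^sup>2 = (N v)\<^sup>2 + 2 * N v * h + h * h"
      by (simp add: power2_eq_square algebra_simps)
    moreover have "2 * N v * h \<le> 1" using h by (simp add: algebra_simps)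
    moreover have "h * h \<le> 1 * 1" using h(1) h1 by (intro mult_mono) auto
    ultimately show ?thesis by simp
  qed
  have "(N (\<lambda>i. v i + w i))\<^sup>2 \<le> (N v)\<^sup>2 + 3"
    if fw: "finite_norm w" and w0: "\<And>i. i < m \<Longrightarrow> w i = 0" and wb: "\<And>i. \<bar>w i\<bar> \<le> b" and w1: "N w \<le> 1" for w
  proof -
    have "fnorm \<G> (\<lambda>i. v i + w i) \<le> sqrt ((N v)\<^sup>2 + 3)" if G: "\<G> \<in> families D" for \<G>
    \<comment> \<open>A singleton outside \<open>D\<close> is not admissible, so the splitting into
      subfamilies below does not cover it.\<close>
    proof (cases "\<G> \<in> range (\<lambda>i. {{i}})")
      case True
      then obtain i where i: "\<G> = {{i}}" by blast
      have "\<bar>v i + w i\<bar> \<le> sqrt ((N v)\<^sup>2 + 3)"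
      proof (cases "i < m")
        case True
        then have "\<bar>v i + w i\<bar> \<le> N v" using w0 abs_le_N[OF fv] by simp
        also have "\<dots> \<le> sqrt ((N v)\<^sup>2 + 3)" by (rule real_le_rsqrt) simp
        finally show ?thesis .
      next
        case False
        then have "\<bar>v i + w i\<bar> \<le> 1" using v w1 abs_le_N[OF fw, of i] by (simp add: support_below_def)
        also have "\<dots> \<le> sqrt ((N v)\<^sup>2 + 3)" by simp
        finally show ?thesis .
      qed
      then show ?thesis by (simp add: i fnorm_singleton)
    next
      case False
      then have fin: "finite \<G>" and dis: "pairwise disjnt \<G>" and adm: "\<And>A. A \<in> \<G> \<Longrightarrow> admissible D A"
        using G by (auto simp: families_def)
      define H where "H = {A\<in>\<G>. A \<inter> {..<m} \<noteq> {}}"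
      have sub: "S \<in> families D" if "S \<subseteq> \<G>" for S
        using that fin dis adm by (auto simp: families_def intro: finite_subset pairwise_mono)
      have Min_less: "Min A < m" if A: "A \<in> H" for A
      proof -
        obtain i where "i \<in> A" "i < m" using A by (auto simp: H_def)
        moreover have "finite A" using A adm by (auto simp: H_def admissible_def)
        ultimately show ?thesis by (meson Min_le le_less_trans)
      qed
      have "inj_on Min H"
      proof (rule inj_onI)
        fix A B assume AB: "A \<in> H" "B \<in> H" "Min A = Min B"
        then have "admissible D A" "admissible D B"
          using adm by (auto simp: H_def)
        then have "Min A \<in> A" "Min B \<in> B"
          by (auto simp: admissible_def intro: Min_in)
        then have "\<not> disjnt A B" using AB by (auto simp: disjnt_def)
        then show "A = B" using dis AB by (auto simp: H_def pairwise_def)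
      qed
      then have "card H \<le> card {..<m}"
        using Min_less by (intro card_inj_on_le[of Min]) auto
      then have card_H: "card H \<le> m" by simp
      have "fnorm H w \<le> (\<Sum>A\<in>H. \<Sum>i\<in>A. \<bar>w i\<bar>)"
        unfolding fnorm_def by (intro L2_set_le_sum sum_nonneg) auto
      also have "\<dots> \<le> (\<Sum>A\<in>H. real m * b)"
      proof (rule sum_mono)
        fix A assume A: "A \<in> H"
        then have "card A \<le> Suc (Min A)" using adm by (auto simp: H_def admissible_def)
        also have "\<dots> \<le> m" using Min_less[OF A] by simp
        finally have "real (card A) * b \<le> real m * b" using b by (intro mult_right_mono) auto
        moreover have "(\<Sum>i\<in>A. \<bar>w i\<bar>) \<le> real (card A) * b"
          using sum_bounded_above[of A "\<lambda>i. \<bar>w i\<bar>" b] wb by simp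
        ultimately show "(\<Sum>i\<in>A. \<bar>w i\<bar>) \<le> real m * b" by simp
      qed
      also have "\<dots> \<le> real m * (real m * b)"
        using card_H b by (simp add: mult_right_mono)
      finally have "fnorm H w \<le> h" by (simp add: h_def power2_eq_square)
      moreover have "fnorm H v \<le> N v"
        using sub[of H] by (intro fnorm_le_N fv) (auto simp: H_def)
      ultimately have "fnorm H (\<lambda>i. v i + w i) \<le> N v + h"
        using fnorm_triangle[of H v w] by simp
      then have "(fnorm H (\<lambda>i. v i + w i))\<^sup>2 \<le> (N v + h)\<^sup>2"
        by (intro power_mono fnorm_nonneg)
      then have 1: "(fnorm H (\<lambda>i. v i + w i))\<^sup>2 \<le> (N v)\<^sup>2 + 2" using sq by simp
      have "fnorm (\<G> - H) (\<lambda>i. v i + w i) = fnorm (\<G> - H) w"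
        unfolding fnorm_def using v
        by (intro L2_set_cong refl sum.cong) (auto simp: H_def support_below_def not_less[symmetric])
      also have "\<dots> \<le> 1"
        using fnorm_le_N[OF fw sub, of "\<G> - H"] w1 by auto
      finally have 2: "(fnorm (\<G> - H) (\<lambda>i. v i + w i))\<^sup>2 \<le> 1"
        using power_mono[OF _ fnorm_nonneg, of "\<G> - H" "\<lambda>i. v i + w i" 1 2] by simp
      have "(fnorm \<G> (\<lambda>i. v i + w i))\<^sup>2 = (fnorm H (\<lambda>i. v i + w i))\<^sup>2 + (fnorm (\<G> - H) (\<lambda>i. v i + w i))\<^sup>2"
        unfolding fnorm_def L2_set_def using fin
        by (simp add: sum_nonneg sum.subset_diff[of H \<G>] H_def add.commute)
      then have "(fnorm \<G> (\<lambda>i. v i + w i))\<^sup>2 \<le> (N v)\<^sup>2 + 3"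
        using 1 2 by simp
      then show ?thesis by (rule real_le_rsqrt)
    qed
    then have "N (\<lambda>i. v i + w i) \<le> sqrt ((N v)\<^sup>2 + 3)" by (rule N_le)
    then have "(N (\<lambda>i. v i + w i))\<^sup>2 \<le> (sqrt ((N v)\<^sup>2 + 3))\<^sup>2"
      using N_nonneg[OF finite_norm_add(1)[OF fv fw]] by (intro power_mono)
    then show ?thesis by simp
  qed
  with b show ?thesis by blast
qed

text \<open>If \<open>F\<close> exceeded \<open>d\<close> on normalised vectors arbitrarily far out,
  averages of many such blocks would be flat, and still have \<open>F\<close> at least
  \<open>d\<close>. By \<open>N_add_flat\<close> a sum of \<open>n\<close> successive averages has
  norm at most \<open>sqrt (3 * n)\<close>, whereas \<open>F\<close> is at least
  \<open>n * d\<close> on it; for large \<open>n\<close> this violates the bound.\<close>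

lemma shrinking:
  fixes F :: "(nat \<Rightarrow> real) \<Rightarrow> real"
  assumes add: "\<And>m n x y. support_below m x \<Longrightarrow> support_below n y \<Longrightarrow> F (\<lambda>i. x i + y i) = F x + F y"
    and scale: "\<And>n x c. support_below n x \<Longrightarrow> F (\<lambda>i. c * x i) = c * F x"
    and bound: "\<And>n x. support_below n x \<Longrightarrow> \<bar>F x\<bar> \<le> C * N x"
    and d: "0 < d"
  shows "\<exists>n. \<forall>m u. support_below m u \<longrightarrow> (\<forall>i<n. u i = 0) \<longrightarrow> \<bar>F u\<bar> \<le> d * N u"
proof (rule ccontr)
  assume "\<not> ?thesis"
  then have neg: "\<exists>m u. support_below m u \<and> (\<forall>i<n. u i = 0) \<and> d * N u < \<bar>F u\<bar>" for n
    by (auto simp: not_le)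
  have block: "\<exists>m u. support_below m u \<and> (\<forall>i<n. u i = 0) \<and> N u \<le> 1 \<and> d < F u" for n
  proof -
    obtain m u where u: "support_below m u" "\<And>i. i < n \<Longrightarrow> u i = 0" "d * N u < \<bar>F u\<bar>"
      using neg by blast
    have fu: "finite_norm u" using u(1) by (rule finite_norm_support)
    have "0 < N u"
    proof (rule ccontr)
      assume "\<not> 0 < N u"
      then have "N u = 0" using N_nonneg[OF fu] by simp
      then show False using u(3) bound[OF u(1)] by simp
    qed
    define c where "c = sgn (F u) / N u"
    have "\<bar>c\<bar> * N u \<le> 1" using \<open>0 < N u\<close> by (simp add: c_def abs_sgn_eq)
    moreover have "c * F u = \<bar>F u\<bar> / N u" by (simp add: c_def abs_sgn mult.commute)
    moreover have "d < \<bar>F u\<bar> / N u" using u(3) \<open>0 < N u\<close> by (simp add: field_simps)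
    ultimately show ?thesis
      using u support_below_scale[OF u(1), of c] scale[OF u(1), of c] finite_norm_scale(2)[OF fu, of c]
      by (intro exI[of _ m] exI[of _ "\<lambda>i. c * u i"]) auto
  qed
  \<comment> \<open>A sum of \<open>K\<close> successive blocks keeps supremum norm at most 1, while
    the bounds for \<open>N\<close> and \<open>F\<close> grow linearly in \<open>K\<close>. Division
    by \<open>K\<close> will make it as flat as desired.\<close>
  have blocks: "\<exists>m' u. m \<le> m' \<and> support_below m' u \<and> (\<forall>i<m. u i = 0) \<and> (\<forall>i. \<bar>u i\<bar> \<le> 1) \<and> N u \<le> real K \<and> real K * d \<le> F u" for m K
  proof (induction K)
    case 0
    have "N (\<lambda>_. 0) \<le> 0"
      using finite_norm_support(2)[of 0 "\<lambda>_. 0"] by (simp add: support_below_def)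
    moreover have "F (\<lambda>_. 0) = 0"
      using scale[of 0 "\<lambda>_. 0" 0] by (simp add: support_below_def)
    ultimately show ?case
      by (intro exI[of _ m] exI[of _ "\<lambda>_. 0"]) (simp add: support_below_def)
  next
    case (Suc K)
    then obtain m' u where u: "m \<le> m'" "support_below m' u" "\<And>i. i < m \<Longrightarrow> u i = 0" "\<And>i. \<bar>u i\<bar> \<le> 1"
      "N u \<le> real K" "real K * d \<le> F u" by blast
    obtain m'' u' where u': "support_below m'' u'" "\<And>i. i < m' \<Longrightarrow> u' i = 0" "N u' \<le> 1" "d < F u'"
      using block[of m'] by blast
    have fu: "finite_norm u" "finite_norm u'"
      using u(2) u'(1) finite_norm_support by blast+
    have "\<bar>u i + u' i\<bar> \<le> 1" for i
      using u(2,4) u'(2,3) abs_le_N[OF fu(2), of i] by (cases "i < m'") (auto simp: support_below_def)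
    moreover have "N (\<lambda>i. u i + u' i) \<le> real (Suc K)"
      using finite_norm_add(2)[OF fu] u(5) u'(3) by simp
    moreover have "real (Suc K) * d \<le> F (\<lambda>i. u i + u' i)"
      using u(6) u'(4) add[OF u(2) u'(1)] by (simp add: algebra_simps)
    ultimately show ?case
      using support_below_add[OF u(2) u'(1)] u(1,3) u'(2)
      by (intro exI[of _ "max m' m''"] exI[of _ "\<lambda>i. u i + u' i"]) auto
  qed
  have "\<exists>m v. support_below m v \<and> (N v)\<^sup>2 \<le> 3 * real n \<and> real n * d \<le> F v" for n
  proof (induction n)
    case 0
    have "N (\<lambda>_. 0) \<le> 0"
      using finite_norm_support(2)[of 0 "\<lambda>_. 0"] by (simp add: support_below_def)
    moreover have "0 \<le> N (\<lambda>_. 0)"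
      by (intro N_nonneg finite_norm_support[of 0]) (simp add: support_below_def)
    moreover have "F (\<lambda>_. 0) = 0"
      using scale[of 0 "\<lambda>_. 0" 0] by (simp add: support_below_def)
    ultimately show ?case
      by (intro exI[of _ 0] exI[of _ "\<lambda>_. 0"]) (simp add: support_below_def)
  next
    case (Suc n)
    then obtain m v where v: "support_below m v" "(N v)\<^sup>2 \<le> 3 * real n" "real n * d \<le> F v" by blast
    obtain b where b: "0 < b" "\<And>w. finite_norm w \<Longrightarrow> (\<forall>i<m. w i = 0) \<Longrightarrow> (\<forall>i. \<bar>w i\<bar> \<le> b) \<Longrightarrow> N w \<le> 1 \<Longrightarrow>
        (N (\<lambda>i. v i + w i))\<^sup>2 \<le> (N v)\<^sup>2 + 3"
      using N_add_flat[OF v(1)] by blast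
    obtain K :: nat where K: "1 / b < real K" using reals_Archimedean2 by blast
    then have K0: "0 < real K" using b(1) by (meson less_trans zero_less_divide_1_iff)
    obtain m' u where u: "support_below m' u" "\<And>i. i < m \<Longrightarrow> u i = 0" "\<And>i. \<bar>u i\<bar> \<le> 1"
      "N u \<le> real K" "real K * d \<le> F u" using blocks[of m K] by blast
    define w where "w = (\<lambda>i. (1 / real K) * u i)"
    have fu: "finite_norm u" using u(1) by (rule finite_norm_support)
    have w: "support_below m' w" unfolding w_def using u(1) by (rule support_below_scale)
    have "\<bar>w i\<bar> \<le> b" for i
    proof -
      have "\<bar>w i\<bar> \<le> 1 / real K" using u(3)[of i] K0 by (simp add: w_def abs_mult field_simps)
      also have "\<dots> \<le> b" using K K0 b(1) by (simp add: field_simps)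
      finally show ?thesis .
    qed
    moreover have "N w \<le> 1"
      using u(4) K0 finite_norm_scale(2)[OF fu, of "1 / real K"] by (simp add: w_def)
    ultimately have "(N (\<lambda>i. v i + w i))\<^sup>2 \<le> 3 * real (Suc n)"
      using b(2)[of w] finite_norm_support(1)[OF w] u(2) v(2) by (simp add: w_def)
    moreover have "F w = F u / real K"
      using scale[OF u(1), of "1 / real K"] by (simp add: w_def)
    then have "d \<le> F w"
      using u(5) K0 by (simp only: pos_le_divide_eq) (simp add: mult.commute)
    then have "real (Suc n) * d \<le> F (\<lambda>i. v i + w i)"
      using v(3) add[OF v(1) w] by (simp add: algebra_simps)
    ultimately show ?case
      using support_below_add[OF v(1) w] by blast
  qed
  then obtain v where v: "\<And>n. \<exists>m. support_below m (v n)" "\<And>n. (N (v n))\<^sup>2 \<le> 3 * real n"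
    "\<And>n. real n * d \<le> F (v n)" by metis
  obtain n :: nat where n: "3 * C\<^sup>2 / d\<^sup>2 < real n" using reals_Archimedean2 by blast
  then have n0: "0 < real n" by (meson divide_nonneg_nonneg le_less_trans mult_nonneg_nonneg zero_le_numeral zero_le_power2)
  have "real n * d \<le> C * N (v n)"
    using v(1)[of n] v(3)[of n] bound[of _ "v n"] by fastforce
  then have "(real n * d)\<^sup>2 \<le> (C * N (v n))\<^sup>2"
    using d by (intro power_mono) auto
  also have "\<dots> = C\<^sup>2 * (N (v n))\<^sup>2" by (simp add: power_mult_distrib)
  also have "\<dots> \<le> C\<^sup>2 * (3 * real n)" using v(2) by (intro mult_left_mono) auto
  finally have "real n * (real n * d\<^sup>2) \<le> real n * (3 * C\<^sup>2)"
    by (simp add: power2_eq_square mult_ac)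
  then have "real n * d\<^sup>2 \<le> 3 * C\<^sup>2" using n0 by simp
  then show False using n d by (simp add: field_simps)
qed

end

section \<open>The Banach space of sequences whose tails vanish in norm\<close>

abbreviation ap :: "('a::topological_space \<Rightarrow>\<^sub>C real) \<Rightarrow> 'a \<Rightarrow> real" where
  "ap \<equiv> apply_bcontfun"

text \<open>Sequences are encoded as bounded continuous functions on the discrete space of naturals;
  the encoding can be inverted only for bounded sequences.\<close>

definition bseq :: "(nat \<Rightarrow> real) \<Rightarrow> nat \<Rightarrow>\<^sub>C real" where
  "bseq x = Bcontfun x"

lemma apply_bseq:
  assumes "\<And>i. \<bar>x i\<bar> \<le> B"
  shows "ap (bseq x) = x"
  unfolding bseq_def using assms by (intro Bcontfun_inverse bcontfun_normI[of _ B]) auto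

lemma bseq_apply [simp]: "bseq (ap f) = f"
  by (simp add: bseq_def apply_bcontfun_inverse)

definition kron :: "nat \<Rightarrow> nat \<Rightarrow> real" where
  "kron k i = (if i = k then 1 else 0)"

lemma tail_add: "tail n (\<lambda>i. x i + y i) = (\<lambda>i. tail n x i + tail n y i)"
  and tail_scale: "tail n (\<lambda>i. c * x i) = (\<lambda>i. c * tail n x i)"
  by (auto simp: tail_def)

lemma abs_tail_le: "\<bar>tail n x i\<bar> \<le> \<bar>x i\<bar>"
  by (simp add: tail_def)

lemma abs_head_le: "\<bar>head n x i\<bar> \<le> \<bar>x i\<bar>"
  by (simp add: head_def)

lemma head_Suc: "head (Suc n) x = (\<lambda>i. head n x i + x n * kron n i)"
  by (auto simp: fun_eq_iff head_def kron_def less_Suc_eq)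

lemma support_below_kron: "support_below (Suc k) (kron k)"
  by (simp add: support_below_def kron_def)

lemma support_below_0: "support_below 0 (\<lambda>_. 0)"
  by (simp add: support_below_def)

context baernstein
begin

text \<open>The tail condition makes this the closure of the finitely supported vectors. Whether a
  finite norm already implies it is what separates the reflexive example from the other one.\<close>

definition W :: "(nat \<Rightarrow>\<^sub>C real) set" where
  "W = {f. finite_norm (ap f) \<and> (\<lambda>n. N (tail n (ap f))) \<longlonglongrightarrow> 0}"

definition nw :: "(nat \<Rightarrow>\<^sub>C real) \<Rightarrow> real" where
  "nw f = N (ap f)"

abbreviation W_dual :: "((nat \<Rightarrow>\<^sub>C real) \<Rightarrow> real) set" where
  "W_dual \<equiv> dual_space W nw"

abbreviation W_dual_norm :: "((nat \<Rightarrow>\<^sub>C real) \<Rightarrow> real) \<Rightarrow> real" where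
  "W_dual_norm \<equiv> dual_norm W nw"

lemma W_finite_norm: "f \<in> W \<Longrightarrow> finite_norm (ap f)"
  by (simp add: W_def)

lemma finite_norm_tail:
  assumes "finite_norm x"
  shows "finite_norm (tail n x)" "N (tail n x) \<le> N x"
  using finite_norm_mono[of x "tail n x"] assms abs_tail_le by blast+

lemma finite_norm_head:
  assumes "finite_norm x"
  shows "finite_norm (head n x)" "N (head n x) \<le> N x"
  using finite_norm_mono[of x "head n x"] assms abs_head_le by blast+

lemma N_tail_mono: "finite_norm x \<Longrightarrow> m \<le> n \<Longrightarrow> N (tail n x) \<le> N (tail m x)"
  by (rule finite_norm_mono(2)[OF finite_norm_tail(1)]) (auto simp: tail_def)

lemma N_tail_tendsto_0I:
  assumes fin: "finite_norm x" and small: "\<And>e. 0 < e \<Longrightarrow> \<exists>n. N (tail n x) \<le> e"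
  shows "(\<lambda>n. N (tail n x)) \<longlonglongrightarrow> 0"
proof (rule LIMSEQ_I)
  fix e :: real assume "0 < e"
  then obtain m where "N (tail m x) \<le> e / 2" using small[of "e / 2"] by auto
  then have "norm (N (tail n x) - 0) < e" if "n \<ge> m" for n
    using N_tail_mono[OF fin that] N_nonneg[OF finite_norm_tail(1)[OF fin]] \<open>0 < e\<close> by simp
  then show "\<exists>m. \<forall>n\<ge>m. norm (N (tail n x) - 0) < e" by blast
qed

lemma N_tail_small:
  assumes "(\<lambda>n. N (tail n x)) \<longlonglongrightarrow> 0" "0 < e"
  shows "\<exists>n. N (tail n x) < e"
  using eventually_happens'[OF sequentially_bot order_tendstoD(2)[OF assms]] .

lemma apply_bseq_N: "finite_norm x \<Longrightarrow> ap (bseq x) = x"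
  by (rule apply_bseq[OF abs_le_N])

lemma nw_bseq: "finite_norm x \<Longrightarrow> nw (bseq x) = N x"
  by (simp add: nw_def apply_bseq_N)

lemma bseq_add: "finite_norm x \<Longrightarrow> finite_norm y \<Longrightarrow> bseq (\<lambda>i. x i + y i) = bseq x + bseq y"
  by (rule bcontfun_eqI) (simp add: apply_bseq_N finite_norm_add plus_bcontfun.rep_eq)

lemma bseq_scale: "finite_norm x \<Longrightarrow> bseq (\<lambda>i. c * x i) = c *\<^sub>R bseq x"
  by (rule bcontfun_eqI) (simp add: apply_bseq_N finite_norm_scale)

lemma bseq_in_W:
  assumes "support_below n x"
  shows "bseq x \<in> W"
proof -
  have "N (tail n x) \<le> e" if "0 < e" for e
  proof -
    have "tail n x = (\<lambda>_. 0)" using assms by (auto simp: tail_def support_below_def)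
    then show ?thesis using finite_norm_support(2)[OF support_below_0] that by simp
  qed
  then show ?thesis
    using finite_norm_support(1)[OF assms]
    by (auto simp: W_def apply_bseq_N intro!: N_tail_tendsto_0I)
qed

lemma subspace_W: "subspace W"
proof (rule subspaceI)
  have "ap (0 :: nat \<Rightarrow>\<^sub>C real) = (\<lambda>_. 0)"
    by auto
  then have "(0 :: nat \<Rightarrow>\<^sub>C real) = bseq (\<lambda>_. 0)"
    by (metis bseq_apply)
  then show "(0 :: nat \<Rightarrow>\<^sub>C real) \<in> W"
    using bseq_in_W[OF support_below_0] by simp
next
  fix f g assume f: "f \<in> W" and g: "g \<in> W"
  let ?f = "ap f" and ?g = "ap g"
  have fin: "finite_norm ?f" "finite_norm ?g" "finite_norm (\<lambda>i. ?f i + ?g i)"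
    using f g by (auto simp: W_def intro: finite_norm_add)
  have "(\<lambda>n. N (tail n (\<lambda>i. ?f i + ?g i))) \<longlonglongrightarrow> 0"
  proof (rule tendsto_sandwich[OF always_eventually always_eventually tendsto_const])
    show "\<forall>n. 0 \<le> N (tail n (\<lambda>i. ?f i + ?g i))"
      using fin(3) by (intro allI N_nonneg finite_norm_tail)
    show "\<forall>n. N (tail n (\<lambda>i. ?f i + ?g i)) \<le> N (tail n ?f) + N (tail n ?g)"
      unfolding tail_add using fin by (intro allI finite_norm_add finite_norm_tail)
    show "(\<lambda>n. N (tail n ?f) + N (tail n ?g)) \<longlonglongrightarrow> 0"
      using f g tendsto_add[of "\<lambda>n. N (tail n ?f)" 0 _ "\<lambda>n. N (tail n ?g)" 0] by (simp add: W_def)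
  qed
  with fin(3) show "f + g \<in> W" by (simp add: W_def plus_bcontfun.rep_eq)
next
  fix c f assume f: "f \<in> W"
  let ?f = "ap f"
  have fin: "finite_norm ?f" using f by (rule W_finite_norm)
  have "(\<lambda>n. \<bar>c\<bar> * N (tail n ?f)) \<longlonglongrightarrow> 0"
    using f by (intro tendsto_mult_right_zero) (simp add: W_def)
  then have "(\<lambda>n. N (tail n (\<lambda>i. c * ?f i))) \<longlonglongrightarrow> 0"
    unfolding tail_scale finite_norm_scale(2)[OF finite_norm_tail(1)[OF fin]] .
  then show "c *\<^sub>R f \<in> W" using finite_norm_scale(1)[OF fin] by (simp add: W_def scaleR_bcontfun.rep_eq)
qed

text \<open>Each family involves finitely many coordinates only, so coordinatewise limits
  suffice.\<close>

lemma fnorm_lim_le: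
  assumes G: "\<G> \<in> families D" and lim: "\<And>i. (\<lambda>k. y k i) \<longlonglongrightarrow> x i" and le: "\<forall>\<^sub>F k in sequentially. fnorm \<G> (y k) \<le> B"
  shows "fnorm \<G> x \<le> B"
proof (rule tendsto_upperbound[OF _ le])
  show "(\<lambda>k. fnorm \<G> (y k)) \<longlonglongrightarrow> fnorm \<G> x"
    unfolding fnorm_def L2_set_def by (intro tendsto_intros lim)
qed simp

text \<open>The coordinatewise limit is approached in norm because bounds on every single family
  survive the limit. Its tails are compared with those of a nearby member of the sequence.\<close>

lemma complete_W:
  assumes s: "\<And>n. s n \<in> W" and cauchy: "\<And>e. 0 < e \<Longrightarrow> \<exists>M. \<forall>m\<ge>M. \<forall>n\<ge>M. nw (s m - s n) < e"
  shows "\<exists>x\<in>W. (\<lambda>n. nw (s n - x)) \<longlonglongrightarrow> 0"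
proof -
  define z where "z = (\<lambda>n. ap (s n))"
  have z: "finite_norm (z n)" for n
    using s by (simp add: W_finite_norm z_def)
  have nw_diff: "nw (s m - s n) = N (\<lambda>i. z m i - z n i)" for m n
    by (simp add: nw_def z_def minus_bcontfun.rep_eq)
  have fin_diff: "finite_norm (\<lambda>i. x i - y i)" if "finite_norm x" "finite_norm y" for x y
    using finite_norm_add(1)[OF that(1) finite_norm_scale(1)[OF that(2), of "- 1"]] by simp
  have "Cauchy (\<lambda>n. z n i)" for i
  proof (rule metric_CauchyI)
    fix e :: real assume "0 < e"
    then obtain M where "\<And>m n. m \<ge> M \<Longrightarrow> n \<ge> M \<Longrightarrow> nw (s m - s n) < e" using cauchy by blast
    then have "dist (z m i) (z n i) < e" if "m \<ge> M" "n \<ge> M" for m n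
      using le_less_trans[OF abs_le_N[OF fin_diff[OF z[of m] z[of n]], of i]] that
      by (simp add: nw_diff dist_real_def)
    then show "\<exists>M. \<forall>m\<ge>M. \<forall>n\<ge>M. dist (z m i) (z n i) < e" by blast
  qed
  then have "\<exists>l. (\<lambda>n. z n i) \<longlonglongrightarrow> l" for i
    by (simp add: Cauchy_convergent_iff convergent_def)
  then obtain x where x: "\<And>i. (\<lambda>n. z n i) \<longlonglongrightarrow> x i" by metis
  have close: "\<exists>M. \<forall>n\<ge>M. finite_norm (\<lambda>i. z n i - x i) \<and> N (\<lambda>i. z n i - x i) \<le> e" if e: "0 < e" for e
  proof -
    obtain M where M: "\<And>m n. m \<ge> M \<Longrightarrow> n \<ge> M \<Longrightarrow> nw (s m - s n) < e" using cauchy[OF e] by blast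
    have "fnorm \<G> (\<lambda>i. z n i - x i) \<le> e" if n: "n \<ge> M" and G: "\<G> \<in> families D" for n \<G>
    proof (rule fnorm_lim_le[OF G, of "\<lambda>k i. z n i - z k i"])
      show "(\<lambda>k. z n i - z k i) \<longlonglongrightarrow> z n i - x i" for i
        by (intro tendsto_intros x)
      show "\<forall>\<^sub>F k in sequentially. fnorm \<G> (\<lambda>i. z n i - z k i) \<le> e"
      proof (rule eventually_sequentiallyI)
        fix k assume "M \<le> k"
        then have "N (\<lambda>i. z n i - z k i) \<le> e" using M[OF n, of k] by (simp add: nw_diff)
        then show "fnorm \<G> (\<lambda>i. z n i - z k i) \<le> e"
          using fnorm_le_N[OF fin_diff[OF z z] G, of n k] by simp
      qed
    qed
    then show ?thesis by (auto intro!: exI[of _ M] finite_normI N_le)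
  qed
  have fx: "finite_norm x"
  proof -
    obtain M where "finite_norm (\<lambda>i. z M i - x i)" using close[of 1] by auto
    from fin_diff[OF z[of M] this] show ?thesis by simp
  qed
  have "(\<lambda>n. N (tail n x)) \<longlonglongrightarrow> 0"
  proof (rule N_tail_tendsto_0I[OF fx])
    fix e :: real assume e: "0 < e"
    obtain M where M: "N (\<lambda>i. z M i - x i) \<le> e / 2" using close[of "e / 2"] e by auto
    have "(\<lambda>n. N (tail n (z M))) \<longlonglongrightarrow> 0" using s[of M] by (simp add: W_def z_def)
    then obtain n where n: "N (tail n (z M)) < e / 2"
      using N_tail_small[of "z M" "e / 2"] e by auto
    have "tail n x = (\<lambda>i. tail n (z M) i + (- 1) * tail n (\<lambda>i. z M i - x i) i)"
      by (auto simp: tail_def)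
    then have "N (tail n x) \<le> N (tail n (z M)) + N (\<lambda>i. (- 1) * tail n (\<lambda>i. z M i - x i) i)"
      using finite_norm_add(2)[OF finite_norm_tail(1)[OF z[of M]]
          finite_norm_scale(1)[OF finite_norm_tail(1)[OF fin_diff[OF z[of M] fx]], of "- 1" n]] by simp
    also have "\<dots> \<le> e"
      using n M finite_norm_scale(2)[OF finite_norm_tail(1)[OF fin_diff[OF z[of M] fx]], of "- 1" n]
        finite_norm_tail(2)[OF fin_diff[OF z[of M] fx], of n] by simp
    finally show "\<exists>n. N (tail n x) \<le> e" by blast
  qed
  then have "bseq x \<in> W" using fx by (simp add: W_def apply_bseq_N)
  moreover have "(\<lambda>n. nw (s n - bseq x)) \<longlonglongrightarrow> 0"
  proof (rule LIMSEQ_I)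
    fix e :: real assume e: "0 < e"
    have nw_eq: "nw (s n - bseq x) = N (\<lambda>i. z n i - x i)" for n
      by (simp add: nw_def z_def minus_bcontfun.rep_eq apply_bseq_N[OF fx])
    obtain M where M: "\<And>n. n \<ge> M \<Longrightarrow> N (\<lambda>i. z n i - x i) \<le> e / 2" using close[of "e / 2"] e by auto
    have "norm (nw (s n - bseq x) - 0) < e" if "n \<ge> M" for n
      using M[OF that] N_nonneg[OF fin_diff[OF z[of n] fx]] e by (simp add: nw_eq)
    then show "\<exists>M. \<forall>n\<ge>M. norm (nw (s n - bseq x) - 0) < e" by blast
  qed
  ultimately show ?thesis by blast
qed

lemma banach_W: "banach_space W nw"
  unfolding banach_space_def
proof (intro conjI ballI allI impI)
  show "subspace W" by (rule subspace_W)
next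
  fix f assume f: "f \<in> W"
  show "nw f = 0 \<longleftrightarrow> f = 0"
  proof
    assume "nw f = 0"
    then have "ap f i = 0" for i
      using abs_le_N[OF W_finite_norm[OF f], of i] by (simp add: nw_def)
    then show "f = 0" by (intro bcontfun_eqI) simp
  next
    assume "f = 0"
    then show "nw f = 0"
      using finite_norm_scale(2)[OF W_finite_norm[OF f], of 0] by (simp add: nw_def zero_bcontfun.rep_eq)
  qed
next
  fix f g assume "f \<in> W" "g \<in> W"
  then show "nw (f + g) \<le> nw f + nw g"
    using finite_norm_add(2)[OF W_finite_norm W_finite_norm] by (simp add: nw_def plus_bcontfun.rep_eq)
next
  fix f and c :: real assume "f \<in> W"
  then show "nw (c *\<^sub>R f) = \<bar>c\<bar> * nw f"
    using finite_norm_scale(2)[OF W_finite_norm] by (simp add: nw_def scaleR_bcontfun.rep_eq)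
next
  fix s :: "nat \<Rightarrow> nat \<Rightarrow>\<^sub>C real"
  assume "(\<forall>n. s n \<in> W) \<and> (\<forall>e>0. \<exists>M. \<forall>m\<ge>M. \<forall>n\<ge>M. nw (s m - s n) < e)"
  then show "\<exists>x\<in>W. (\<lambda>n. nw (s n - x)) \<longlonglongrightarrow> 0"
    by (intro complete_W) auto
qed

section \<open>Functionals on the Baernstein-type space\<close>

lemma finite_norm_kron: "finite_norm (kron k)"
  by (rule finite_norm_support[OF support_below_kron])

lemma nw_kron: "nw (bseq (kron k)) \<le> 1"
proof -
  have "(\<Sum>i<Suc k. \<bar>kron k i\<bar>) = 1"
    by (simp add: kron_def)
  then show ?thesis
    using finite_norm_support[OF support_below_kron, of k] by (simp add: nw_bseq)
qed

lemma dual_head: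
  assumes f: "f \<in> W_dual"
  shows "f (bseq (head n x)) = (\<Sum>i<n. x i * f (bseq (kron i)))"
proof (induction n)
  case 0
  have "f (0 *\<^sub>R bseq (kron 0)) = 0 * f (bseq (kron 0))"
    using f bseq_in_W[OF support_below_kron] unfolding dual_space_def by blast
  moreover have "bseq (head 0 x) = 0 *\<^sub>R bseq (kron 0)"
    using bseq_scale[OF finite_norm_kron, of 0 0] by (simp add: head_def[abs_def])
  ultimately show ?case by simp
next
  case (Suc n)
  have fin: "finite_norm (head n x)" "finite_norm (\<lambda>i. x n * kron n i)"
    using finite_norm_support(1) support_below_head support_below_kron finite_norm_scale(1) by blast+
  have "f (bseq (head (Suc n) x)) = f (bseq (head n x) + x n *\<^sub>R bseq (kron n))"
    unfolding head_Suc by (simp add: bseq_add[OF fin] bseq_scale finite_norm_kron)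
  also have "\<dots> = f (bseq (head n x)) + f (x n *\<^sub>R bseq (kron n))"
    using f bseq_in_W[OF support_below_head] bseq_in_W[OF support_below_kron] subspace_scale[OF subspace_W]
    unfolding dual_space_def by blast
  also have "f (x n *\<^sub>R bseq (kron n)) = x n * f (bseq (kron n))"
    using f bseq_in_W[OF support_below_kron] unfolding dual_space_def by blast
  finally show ?case using Suc.IH by simp
qed

definition coord_approx :: "((nat \<Rightarrow>\<^sub>C real) \<Rightarrow> real) \<Rightarrow> nat \<Rightarrow> (nat \<Rightarrow>\<^sub>C real) \<Rightarrow> real" where
  "coord_approx f n x = (\<Sum>i<n. ap x i * f (bseq (kron i)))"

text \<open>The unit vectors form a shrinking basis: truncations of a functional to finitely many
  coordinates converge to it in dual norm.\<close>

lemma dual_approx: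
  assumes f: "f \<in> W_dual" and d: "0 < d"
  shows "\<exists>n. \<forall>x\<in>W. \<bar>f x - coord_approx f n x\<bar> \<le> d * nw x"
proof -
  have fadd: "f (x + y) = f x + f y" if "x \<in> W" "y \<in> W" for x y
    using f that unfolding dual_space_def by blast
  have fscale: "f (c *\<^sub>R x) = c * f x" if "x \<in> W" for c x
    using f that unfolding dual_space_def by blast
  obtain C where C: "\<And>x. x \<in> W \<Longrightarrow> \<bar>f x\<bar> \<le> C * nw x"
    using f unfolding dual_space_def by blast
  have "\<exists>n. \<forall>m u. support_below m u \<longrightarrow> (\<forall>i<n. u i = 0) \<longrightarrow> \<bar>f (bseq u)\<bar> \<le> d * N u"
  proof (rule shrinking[OF _ _ _ d])
    show "f (bseq (\<lambda>i. x i + y i)) = f (bseq x) + f (bseq y)" if "support_below m x" "support_below n y" for m n x y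
      using that by (simp add: bseq_add finite_norm_support(1) fadd bseq_in_W)
    show "f (bseq (\<lambda>i. c * x i)) = c * f (bseq x)" if "support_below n x" for n x c
      using that by (simp add: bseq_scale finite_norm_support(1) fscale bseq_in_W)
    show "\<bar>f (bseq x)\<bar> \<le> C * N x" if "support_below n x" for n x
      using C[OF bseq_in_W[OF that]] that by (simp add: nw_bseq finite_norm_support(1))
  qed
  then obtain n where n: "\<And>m u. support_below m u \<Longrightarrow> (\<forall>i<n. u i = 0) \<Longrightarrow> \<bar>f (bseq u)\<bar> \<le> d * N u"
    by blast
  have "\<bar>f x - coord_approx f n x\<bar> \<le> d * nw x" if x: "x \<in> W" for x
  proof -
    define z where "z = ap x"
    have z: "finite_norm z" using x by (simp add: z_def W_finite_norm)
    have tailW: "bseq (tail k z) \<in> W" for k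
    proof -
      have "x = bseq (head k z) + bseq (tail k z)"
        using z by (intro bcontfun_eqI)
          (simp add: plus_bcontfun.rep_eq apply_bseq_N finite_norm_head finite_norm_tail head_def tail_def flip: z_def)
      then have "bseq (tail k z) = x - bseq (head k z)" by simp
      then show ?thesis
        using subspace_diff[OF subspace_W x bseq_in_W[OF support_below_head]] by simp
    qed
    \<comment> \<open>A second cut at \<open>k\<close>: between \<open>n\<close> and
      \<open>k\<close> the vector is finitely supported and \<open>shrinking\<close> applies; beyond
      \<open>k\<close> the boundedness of \<open>f\<close> is enough, as that tail vanishes when
      \<open>k\<close> grows.\<close>
    have le: "\<bar>f x - f (bseq (head n z))\<bar> \<le> d * nw x + \<bar>C\<bar> * N (tail k z)" if k: "k \<ge> n" for k
    proof -
      define u where "u = head k (tail n z)"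
      have u: "support_below k u" "\<forall>i<n. u i = 0" "finite_norm u" "N u \<le> N z"
        using support_below_head finite_norm_head[OF finite_norm_tail(1)[OF z], of k n] finite_norm_tail(2)[OF z, of n]
        by (auto simp: u_def head_def tail_def)
      have "x = bseq (head n z) + (bseq u + bseq (tail k z))"
        using z u(3) k by (intro bcontfun_eqI)
          (auto simp: plus_bcontfun.rep_eq apply_bseq_N finite_norm_head finite_norm_tail u_def head_def tail_def z_def)
      then have "f x = f (bseq (head n z)) + (f (bseq u) + f (bseq (tail k z)))"
        using tailW bseq_in_W[OF u(1)] bseq_in_W[OF support_below_head] subspace_add[OF subspace_W] fadd by metis
      moreover have "\<bar>f (bseq u)\<bar> \<le> d * N z"
        using order_trans[OF n[OF u(1,2)] mult_left_mono[OF u(4)]] d by simp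
      moreover have "\<bar>f (bseq (tail k z))\<bar> \<le> \<bar>C\<bar> * N (tail k z)"
        using C[OF tailW, of k] finite_norm_tail(1)[OF z] N_nonneg[OF finite_norm_tail(1)[OF z], of k]
          mult_right_mono[OF abs_ge_self, of "N (tail k z)" C]
        by (simp add: nw_bseq)
      ultimately show ?thesis by (simp add: nw_def z_def)
    qed
    have lim: "(\<lambda>k. d * nw x + \<bar>C\<bar> * N (tail k z)) \<longlonglongrightarrow> d * nw x + \<bar>C\<bar> * 0"
      using x by (intro tendsto_intros) (simp add: W_def z_def)
    have "\<bar>f x - f (bseq (head n z))\<bar> \<le> d * nw x + \<bar>C\<bar> * 0"
      by (rule tendsto_lowerbound[OF lim]) (use le in \<open>auto intro: eventually_sequentiallyI\<close>)
    then show ?thesis by (simp add: dual_head[OF f] z_def coord_approx_def)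
  qed
  then show ?thesis by blast
qed

lemma dual_spaceI:
  assumes "\<And>x y. x \<in> W \<Longrightarrow> y \<in> W \<Longrightarrow> g (x + y) = g x + g y" "\<And>x c. x \<in> W \<Longrightarrow> g (c *\<^sub>R x) = c * g x"
    "\<And>x. x \<in> W \<Longrightarrow> \<bar>g x\<bar> \<le> B * nw x"
  shows "g \<in> W_dual"
  using assms unfolding dual_space_def by blast

lemma coord_sum_dual: "(\<lambda>x. \<Sum>i\<in>S. c i * ap x i) \<in> W_dual"
proof (rule dual_spaceI)
  fix x assume x: "x \<in> W"
  have "\<bar>\<Sum>i\<in>S. c i * ap x i\<bar> \<le> (\<Sum>i\<in>S. \<bar>c i\<bar> * nw x)"
    unfolding nw_def using abs_le_N[OF W_finite_norm[OF x]]
    by (intro order_trans[OF sum_abs] sum_mono) (simp add: abs_mult mult_left_mono)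
  then show "\<bar>\<Sum>i\<in>S. c i * ap x i\<bar> \<le> (\<Sum>i\<in>S. \<bar>c i\<bar>) * nw x"
    by (simp add: sum_distrib_right)
qed (simp_all add: plus_bcontfun.rep_eq scaleR_bcontfun.rep_eq algebra_simps sum.distrib sum_distrib_left)

lemma coord_dual: "(\<lambda>x. ap x i) \<in> W_dual"
  using coord_sum_dual[where S = "{i}" and c = "\<lambda>_. 1"] by simp

lemma dual_add:
  assumes "f \<in> W_dual" "g \<in> W_dual"
  shows "(\<lambda>x. f x + g x) \<in> W_dual"
proof -
  obtain B C where B: "\<And>x. x \<in> W \<Longrightarrow> \<bar>f x\<bar> \<le> B * nw x" and C: "\<And>x. x \<in> W \<Longrightarrow> \<bar>g x\<bar> \<le> C * nw x"
    using assms unfolding dual_space_def by blast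
  show ?thesis
  proof (rule dual_spaceI)
    show "\<bar>f x + g x\<bar> \<le> (B + C) * nw x" if "x \<in> W" for x
      using B[OF that] C[OF that] by (simp add: algebra_simps)
  qed (use assms in \<open>auto simp: dual_space_def algebra_simps\<close>)
qed

lemma dual_scale:
  assumes "f \<in> W_dual"
  shows "(\<lambda>x. c * f x) \<in> W_dual"
proof -
  obtain B where B: "\<And>x. x \<in> W \<Longrightarrow> \<bar>f x\<bar> \<le> B * nw x"
    using assms unfolding dual_space_def by blast
  show ?thesis
  proof (rule dual_spaceI)
    show "\<bar>c * f x\<bar> \<le> (\<bar>c\<bar> * B) * nw x" if "x \<in> W" for x
      using mult_left_mono[OF B[OF that], of "\<bar>c\<bar>"] by (simp add: abs_mult mult.assoc)
  qed (use assms in \<open>auto simp: dual_space_def algebra_simps\<close>)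
qed

lemma dual_diff:
  "f \<in> W_dual \<Longrightarrow> g \<in> W_dual \<Longrightarrow> (\<lambda>x. f x - g x) \<in> W_dual"
  using dual_add[OF _ dual_scale[of g "- 1"], of f] by simp

lemma dual_norm_le:
  assumes "\<And>x. x \<in> W \<Longrightarrow> \<bar>g x\<bar> \<le> B * nw x" "0 \<le> B"
  shows "W_dual_norm g \<le> B"
  unfolding dual_norm_def
proof (rule cSUP_least)
  have "nw 0 = 0" using banach_W subspace_0[OF subspace_W] by (simp add: banach_space_def)
  then show "unit_ball W nw \<noteq> {}" using subspace_0[OF subspace_W] by (auto simp: unit_ball_def)
  fix x assume "x \<in> unit_ball W nw"
  then show "\<bar>g x\<bar> \<le> B"
    using assms(1)[of x] mult_left_mono[OF _ assms(2), of "nw x" 1] by (simp add: unit_ball_def)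
qed

lemma abs_le_dual_norm:
  assumes g: "g \<in> W_dual" and x: "x \<in> W" "nw x \<le> 1"
  shows "\<bar>g x\<bar> \<le> W_dual_norm g"
  unfolding dual_norm_def
proof (rule cSUP_upper)
  obtain B where B: "\<And>x. x \<in> W \<Longrightarrow> \<bar>g x\<bar> \<le> B * nw x" using g unfolding dual_space_def by blast
  show "bdd_above ((\<lambda>x. \<bar>g x\<bar>) ` unit_ball W nw)"
  proof (rule bdd_aboveI2)
    fix x assume x: "x \<in> unit_ball W nw"
    then have "0 \<le> nw x" using N_nonneg[OF W_finite_norm] by (simp add: unit_ball_def nw_def)
    then have "B * nw x \<le> \<bar>B\<bar> * 1" using x by (intro mult_mono) (auto simp: unit_ball_def)
    then show "\<bar>g x\<bar> \<le> \<bar>B\<bar>" using B[of x] x by (simp add: unit_ball_def)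
  qed
qed (use x in \<open>auto simp: unit_ball_def\<close>)

section \<open>Separability of the space and of its dual\<close>

lemma rat_approx:
  fixes c :: "nat \<Rightarrow> real"
  assumes "0 < h"
  obtains qs :: "rat list" where "length qs = n" "\<And>i. i < n \<Longrightarrow> \<bar>c i - of_rat (qs ! i)\<bar> \<le> h"
proof -
  have "\<exists>q. \<bar>c i - of_rat q\<bar> \<le> h" for i
  proof -
    obtain q where "c i - h < of_rat q" "of_rat q < c i + h"
      using of_rat_dense[of "c i - h" "c i + h"] assms by auto
    then show ?thesis by (intro exI[of _ q]) (simp add: abs_le_iff)
  qed
  then obtain q where "\<And>i. \<bar>c i - of_rat (q i)\<bar> \<le> h" by metis
  then show ?thesis by (intro that[of "map q [0..<n]"]) auto
qed

lemma sum_close: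
  assumes "\<And>i. i < n \<Longrightarrow> \<bar>c i - d i\<bar> \<le> e / real (Suc n)" "0 \<le> e"
  shows "(\<Sum>i<n. \<bar>c i - d i\<bar>) \<le> e"
proof -
  have "(\<Sum>i<n. \<bar>c i - d i\<bar>) \<le> real n * (e / real (Suc n))"
    using sum_bounded_above[of "{..<n}" "\<lambda>i. \<bar>c i - d i\<bar>" "e / real (Suc n)"] assms(1) by simp
  also have "\<dots> \<le> e" using assms(2) by (simp add: field_simps)
  finally show ?thesis .
qed

lemma separable_dual_W: "separable_dual W nw"
proof -
  define E where "E = range (\<lambda>qs :: rat list. (\<lambda>x. \<Sum>i<length qs. real_of_rat (qs ! i) * ap x i))"
  have "\<exists>g\<in>E. W_dual_norm (\<lambda>x. f x - g x) < e" if f: "f \<in> W_dual" and e: "0 < e" for f e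
  proof -
    obtain n where n: "\<And>x. x \<in> W \<Longrightarrow> \<bar>f x - coord_approx f n x\<bar> \<le> e / 4 * nw x"
      using dual_approx[OF f, of "e / 4"] e by auto
    obtain qs :: "rat list" where qs: "length qs = n" "\<And>i. i < n \<Longrightarrow> \<bar>f (bseq (kron i)) - of_rat (qs ! i)\<bar> \<le> e / 4 / real (Suc n)"
      using rat_approx[of "e / 4 / real (Suc n)" n "\<lambda>i. f (bseq (kron i))"] e by auto
    define g where "g = (\<lambda>x. \<Sum>i<length qs. real_of_rat (qs ! i) * ap x i)"
    have "\<bar>f x - g x\<bar> \<le> e / 2 * nw x" if x: "x \<in> W" for x
    proof -
      have "coord_approx f n x - g x = (\<Sum>i<n. ap x i * (f (bseq (kron i)) - of_rat (qs ! i)))"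
        by (simp add: coord_approx_def g_def qs(1) right_diff_distrib sum_subtractf mult.commute)
      also have "\<bar>\<dots>\<bar> \<le> (\<Sum>i<n. nw x * \<bar>f (bseq (kron i)) - of_rat (qs ! i)\<bar>)"
        unfolding nw_def using abs_le_N[OF W_finite_norm[OF x]]
        by (intro order_trans[OF sum_abs] sum_mono) (simp add: abs_mult mult_right_mono)
      also have "\<dots> \<le> nw x * (e / 4)"
        unfolding sum_distrib_left[symmetric]
      proof (rule mult_left_mono)
        show "(\<Sum>i<n. \<bar>f (bseq (kron i)) - of_rat (qs ! i)\<bar>) \<le> e / 4"
          using qs(2) e by (intro sum_close) auto
        show "0 \<le> nw x" using N_nonneg[OF W_finite_norm[OF x]] by (simp add: nw_def)
      qed
      finally have "\<bar>coord_approx f n x - g x\<bar> \<le> e / 4 * nw x"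
        by (simp add: mult.commute)
      moreover have "e / 2 * nw x = e / 4 * nw x + e / 4 * nw x" by simp
      ultimately show ?thesis using n[OF x] by linarith
    qed
    then have "W_dual_norm (\<lambda>x. f x - g x) \<le> e / 2"
      using e by (intro dual_norm_le) auto
    then show ?thesis using e by (intro bexI[of _ g]) (auto simp: E_def g_def)
  qed
  moreover have "countable E" by (simp add: E_def)
  moreover have "E \<subseteq> W_dual" using coord_sum_dual by (auto simp: E_def)
  ultimately show ?thesis unfolding separable_dual_def by blast
qed

lemma separable_W: "separable_space W nw"
proof -
  define E where "E = range (\<lambda>qs :: rat list. bseq (\<lambda>i. if i < length qs then real_of_rat (qs ! i) else 0))"
  have sb: "support_below (length qs) (\<lambda>i. if i < length qs then real_of_rat (qs ! i) else 0)" for qs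
    by (simp add: support_below_def)
  have "\<exists>d\<in>E. nw (x - d) < e" if x: "x \<in> W" and e: "0 < e" for x e
  proof -
    define z where "z = ap x"
    have z: "finite_norm z" using x by (simp add: z_def W_finite_norm)
    have "(\<lambda>n. N (tail n z)) \<longlonglongrightarrow> 0" using x by (simp add: W_def z_def)
    then obtain n where n: "N (tail n z) < e / 2"
      using N_tail_small[of z "e / 2"] e by auto
    obtain qs :: "rat list" where qs: "length qs = n" "\<And>i. i < n \<Longrightarrow> \<bar>z i - of_rat (qs ! i)\<bar> \<le> e / 4 / real (Suc n)"
      using rat_approx[of "e / 4 / real (Suc n)" n z] e by auto
    define y where "y = (\<lambda>i. if i < length qs then real_of_rat (qs ! i) else 0)"
    have y: "finite_norm y" using finite_norm_support(1)[OF sb] by (simp add: y_def)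
    define u where "u = (\<lambda>i. if i < n then z i - y i else 0)"
    have u: "support_below n u" by (simp add: u_def support_below_def)
    have "(\<Sum>i<n. \<bar>u i\<bar>) \<le> e / 4"
      using sum_close[of n z "\<lambda>i. of_rat (qs ! i)" "e / 4"] qs e by (simp add: u_def y_def)
    then have "N u \<le> e / 4" using finite_norm_support(2)[OF u] by simp
    moreover have "ap (x - bseq y) = (\<lambda>i. tail n z i + u i)"
    proof
      fix i
      have "i \<ge> n \<Longrightarrow> y i = 0" by (simp add: y_def qs(1))
      then show "ap (x - bseq y) i = tail n z i + u i"
        by (simp add: minus_bcontfun.rep_eq apply_bseq_N[OF y] tail_def u_def z_def)
    qed
    ultimately have "nw (x - bseq y) < e"
      using finite_norm_add(2)[OF finite_norm_tail(1)[OF z, of n] finite_norm_support(1)[OF u]] n e by (simp add: nw_def)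
    then show ?thesis by (intro bexI[of _ "bseq y"]) (auto simp: E_def y_def)
  qed
  moreover have "countable E" by (simp add: E_def)
  moreover have "E \<subseteq> W" using bseq_in_W[OF sb] by (auto simp: E_def)
  ultimately show ?thesis unfolding separable_space_def by blast
qed

text \<open>Even unit vectors lie in \<open>D\<close> for both examples. They are weakly null since
  truncated functionals vanish on them eventually, and a Schreier set among the coordinates of a
  mean collects half of its mass.\<close>

lemma not_weak_banach_saks_W:
  assumes D: "\<And>n. even n \<Longrightarrow> n \<in> D"
  shows "\<not> weak_banach_saks W nw"
proof -
  define s where "s = (\<lambda>k. bseq (kron (2 * k)))"
  have s: "s k \<in> W" for k by (simp add: s_def bseq_in_W[OF support_below_kron])
  have ap: "ap (s k) = kron (2 * k)" for k
    by (simp add: s_def apply_bseq_N finite_norm_kron)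
  show ?thesis
  proof (rule banach_pair.not_weak_banach_saksI[OF banach_pair.intro[OF banach_W], of s "1 / 2"])
    fix f assume f: "f \<in> W_dual"
    show "(\<lambda>k. f (s k)) \<longlonglongrightarrow> 0"
    proof (rule LIMSEQ_I)
      fix e :: real assume e: "0 < e"
      obtain n where n: "\<And>x. x \<in> W \<Longrightarrow> \<bar>f x - coord_approx f n x\<bar> \<le> e / 2 * nw x"
        using dual_approx[OF f, of "e / 2"] e by auto
      have "norm (f (s k) - 0) < e" if k: "k \<ge> n" for k
      proof -
        have "coord_approx f n (s k) = 0"
          unfolding coord_approx_def using k by (intro sum.neutral) (auto simp: ap kron_def)
        then have "\<bar>f (s k)\<bar> \<le> e / 2 * nw (s k)" using n[OF s, of k] by simp
        also have "\<dots> \<le> e / 2 * 1" using nw_kron e by (intro mult_left_mono) (auto simp: s_def)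
        finally show ?thesis using e by simp
      qed
      then show "\<exists>n. \<forall>k\<ge>n. norm (f (s k) - 0) < e" by blast
    qed
  next
    fix r :: "nat \<Rightarrow> nat" and k
    assume r: "strict_mono r"
    define mu where "mu = means (s \<circ> r) (2 * Suc k - 1)"
    have mW: "mu \<in> W"
      unfolding mu_def using s by (intro subspace_means[OF subspace_W]) simp
    have "ap (\<Sum>j\<in>A. s (r j)) i = (\<Sum>j\<in>A. kron (2 * r j) i)" if "finite A" for A i
      using that by (induction A) (auto simp: plus_bcontfun.rep_eq ap)
    then have ap_mean: "ap mu i = (\<Sum>j\<le>2 * Suc k - 1. kron (2 * r j) i) / real (2 * Suc k)" for i
      by (simp add: mu_def means_def scaleR_bcontfun.rep_eq del: sum.atMost_Suc)
    \<comment> \<open>The second half of the terms: \<open>k + 1\<close> coordinates, none of them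
      below \<open>k\<close>, hence admissible.\<close>
    define A where "A = (\<lambda>j. 2 * r j) ` {Suc k..<2 * Suc k}"
    have inj: "inj_on (\<lambda>j. 2 * r j) {Suc k..<2 * Suc k}"
      using r by (auto simp: inj_on_def strict_mono_eq)
    then have cA: "card A = Suc k" by (simp add: A_def card_image)
    then have ne: "finite A" "A \<noteq> {}" by (auto simp: A_def)
    have "k \<le> i" if i: "i \<in> A" for i
    proof -
      obtain j where "Suc k \<le> j" "i = 2 * r j" using i by (auto simp: A_def)
      then show ?thesis using seq_suble[OF r, of j] by linarith
    qed
    then have "admissible D A"
      using ne cA D by (auto simp: admissible_def A_def)
    then have G: "{A} \<in> families D" by (simp add: families_def)
    have le: "1 / real (2 * Suc k) \<le> \<bar>ap mu i\<bar>" if i: "i \<in> A" for i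
    proof -
      obtain j where j: "j \<in> {Suc k..<2 * Suc k}" "i = 2 * r j" using i unfolding A_def by blast
      then have "kron (2 * r j) i \<le> (\<Sum>j\<le>2 * Suc k - 1. kron (2 * r j) i)"
        by (intro member_le_sum) (auto simp: kron_def)
      then have "1 / real (2 * Suc k) \<le> ap mu i"
        unfolding ap_mean by (intro divide_right_mono) (simp_all add: kron_def j(2))
      then show ?thesis by simp
    qed
    have "1 / 2 = (\<Sum>i\<in>A. 1 / real (2 * Suc k))" by (simp add: cA field_simps)
    also have "\<dots> \<le> fnorm {A} (ap mu)"
      using sum_mono[of A, OF le] by (simp add: fnorm_def sum_nonneg)
    also have "\<dots> \<le> nw mu" unfolding nw_def by (intro fnorm_le_N W_finite_norm mW G)
    finally show "1 / 2 \<le> nw (means (s \<circ> r) (2 * Suc k - 1))" by (simp only: mu_def)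
  qed (simp_all add: s)
qed

end

text \<open>For \<open>D = UNIV\<close> a family that almost attains the norm leaves little norm to families beyond it.\<close>

lemma tail_tendsto_0_UNIV:
  assumes "baernstein.finite_norm UNIV x"
  shows "(\<lambda>n. baernstein.N UNIV (tail n x)) \<longlonglongrightarrow> 0"
proof -
  interpret baernstein UNIV .
  \<comment> \<open>On \<open>UNIV\<close> singletons are admissible, so all families are of one
    kind and two with disjoint unions can be merged. For smaller \<open>D\<close> exactly this
    breaks down.\<close>
  have adm1: "admissible UNIV {i}" for i by (simp add: admissible_def)
  have fam: "finite \<G>" "pairwise disjnt \<G>" "\<And>A. A \<in> \<G> \<Longrightarrow> admissible UNIV A" if "\<G> \<in> families UNIV" for \<G>
    using that adm1 by (auto simp: families_def)
  show ?thesis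
  proof (rule N_tail_tendsto_0I[OF assms])
    fix e :: real assume e: "0 < e"
    show "\<exists>n. N (tail n x) \<le> e"
    proof (cases "N x \<le> e")
      case True
      then show ?thesis using finite_norm_tail(2)[OF assms, of 0] by (auto intro: order_trans)
    next
      case False
      then have Ne: "0 \<le> (N x)\<^sup>2 - e\<^sup>2" "sqrt ((N x)\<^sup>2 - e\<^sup>2) < N x"
        using e power_mono[of e "N x" 2] by (auto intro!: real_less_lsqrt)
      then obtain \<G> where G: "\<G> \<in> families UNIV" "sqrt ((N x)\<^sup>2 - e\<^sup>2) < fnorm \<G> x"
        using less_cSupD[of "(\<lambda>\<G>. fnorm \<G> x) ` families UNIV"] families_empty unfolding N_def by blast
      have "finite (\<Union>\<G>)" using families_disjoint[OF G(1)] by auto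
      then obtain n where n: "\<And>i. i \<in> \<Union>\<G> \<Longrightarrow> i < n"
        by (metis finite_nat_set_iff_bounded)
      have "fnorm \<H> (tail n x) \<le> e" if H: "\<H> \<in> families UNIV" for \<H>
      proof -
        \<comment> \<open>Cutting a set at \<open>n\<close> raises its minimum and does not raise
          its cardinality, so the pieces stay admissible, and they avoid all sets of
          \<open>\<G>\<close>.\<close>
        define \<K> where "\<K> = (\<lambda>A. A - {..<n}) ` {A\<in>\<H>. A - {..<n} \<noteq> {}}"
        have inj: "inj_on (\<lambda>A. A - {..<n}) {A\<in>\<H>. A - {..<n} \<noteq> {}}"
        proof (rule inj_onI)
          fix A B assume AB: "A \<in> {A\<in>\<H>. A - {..<n} \<noteq> {}}" "B \<in> {A\<in>\<H>. A - {..<n} \<noteq> {}}" "A - {..<n} = B - {..<n}"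
          then have "\<not> disjnt A B" by (auto simp: disjnt_def)
          then show "A = B" using AB fam(2)[OF H] by (auto simp: pairwise_def)
        qed
        have "(\<Sum>A\<in>\<H>. (\<Sum>i\<in>A. \<bar>tail n x i\<bar>)\<^sup>2) = (\<Sum>A\<in>{A\<in>\<H>. A - {..<n} \<noteq> {}}. (\<Sum>i\<in>A. \<bar>tail n x i\<bar>)\<^sup>2)"
          using fam(1)[OF H] by (intro sum.mono_neutral_right) (auto simp: tail_def intro!: sum.neutral)
        also have "\<dots> = (\<Sum>A\<in>{A\<in>\<H>. A - {..<n} \<noteq> {}}. (\<Sum>i\<in>A - {..<n}. \<bar>x i\<bar>)\<^sup>2)"
        proof (rule sum.cong[OF refl])
          fix A assume "A \<in> {A\<in>\<H>. A - {..<n} \<noteq> {}}"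
          then have "finite A" using families_disjoint(3)[OF H] by auto
          then have "(\<Sum>i\<in>A. \<bar>tail n x i\<bar>) = (\<Sum>i\<in>A - {..<n}. \<bar>x i\<bar>)"
            by (intro sum.mono_neutral_cong_right) (auto simp: tail_def)
          then show "(\<Sum>i\<in>A. \<bar>tail n x i\<bar>)\<^sup>2 = (\<Sum>i\<in>A - {..<n}. \<bar>x i\<bar>)\<^sup>2" by simp
        qed
        also have "\<dots> = (\<Sum>A\<in>\<K>. (\<Sum>i\<in>A. \<bar>x i\<bar>)\<^sup>2)"
          unfolding \<K>_def using inj by (simp add: sum.reindex)
        finally have sq: "(fnorm \<H> (tail n x))\<^sup>2 = (fnorm \<K> x)\<^sup>2"
          by (simp add: fnorm_def L2_set_def sum_nonneg)
        have admK: "admissible UNIV A" if A: "A \<in> \<K>" for A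
        proof -
          obtain B where B: "B \<in> \<H>" "A = B - {..<n}" "A \<noteq> {}" using A by (auto simp: \<K>_def)
          then have fB: "finite B" "card B \<le> Suc (Min B)" using fam(3)[OF H] by (auto simp: admissible_def)
          have "card A \<le> card B" unfolding B(2) using fB(1) by (intro card_mono) auto
          moreover have "Min B \<le> Min A" using B fB by (intro Min_antimono) auto
          ultimately have "card A \<le> Suc (Min A)" using fB(2) by linarith
          then show ?thesis using fB B(2,3) by (auto simp: admissible_def)
        qed
        have disj: "disjnt A B" if "A \<in> \<G>" "B \<in> \<K>" for A B
          using that n by (fastforce simp: \<K>_def disjnt_def)
        have fin_K: "finite \<K>"
          using fam(1)[OF H] by (simp add: \<K>_def)
        have "pairwise disjnt \<K>"
          using fam(2)[OF H] by (fastforce simp: \<K>_def pairwise_def disjnt_def)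
        then have "\<G> \<union> \<K> \<in> families UNIV"
          using fam[OF G(1)] fin_K admK disj
          by (auto simp: families_def pairwise_def disjnt_sym)
        then have "(fnorm (\<G> \<union> \<K>) x)\<^sup>2 \<le> (N x)\<^sup>2"
          by (intro power_mono fnorm_le_N assms fnorm_nonneg)
        moreover have "\<G> \<inter> \<K> = {}"
        proof (rule ccontr)
          assume "\<G> \<inter> \<K> \<noteq> {}"
          then obtain A where "A \<in> \<G>" "A \<in> \<K>" by blast
          then show False using disj[of A A] admK[of A] by (simp add: disjnt_def admissible_def)
        qed
        then have "(\<Sum>A\<in>\<G> \<union> \<K>. (\<Sum>i\<in>A. \<bar>x i\<bar>)\<^sup>2) = (\<Sum>A\<in>\<G>. (\<Sum>i\<in>A. \<bar>x i\<bar>)\<^sup>2) + (\<Sum>A\<in>\<K>. (\<Sum>i\<in>A. \<bar>x i\<bar>)\<^sup>2)"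
          using fam(1)[OF G(1)] fin_K by (intro sum.union_disjoint)
        then have "(fnorm (\<G> \<union> \<K>) x)\<^sup>2 = (fnorm \<G> x)\<^sup>2 + (fnorm \<K> x)\<^sup>2"
          by (simp add: fnorm_def L2_set_def sum_nonneg)
        moreover have "(N x)\<^sup>2 - e\<^sup>2 \<le> (fnorm \<G> x)\<^sup>2"
          using power_mono[OF less_imp_le[OF G(2)], of 2] Ne(1) by simp
        ultimately have "(fnorm \<H> (tail n x))\<^sup>2 \<le> e\<^sup>2" using sq by simp
        then show ?thesis by (rule power2_le_imp_le) (use e in simp)
      qed
      then have "N (tail n x) \<le> e" by (rule N_le)
      then show ?thesis ..
    qed
  qed
qed

section \<open>Bidual functionals and reflexivity\<close>

locale baernstein_bidual = baernstein +
  fixes \<Phi> :: "((nat \<Rightarrow>\<^sub>C real) \<Rightarrow> real) \<Rightarrow> real" and C :: real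
  assumes \<Phi>_add: "f \<in> W_dual \<Longrightarrow> g \<in> W_dual \<Longrightarrow> \<Phi> (\<lambda>x. f x + g x) = \<Phi> f + \<Phi> g"
    and \<Phi>_scale: "f \<in> W_dual \<Longrightarrow> \<Phi> (\<lambda>x. c * f x) = c * \<Phi> f"
    and \<Phi>_bound: "f \<in> W_dual \<Longrightarrow> \<bar>\<Phi> f\<bar> \<le> C * W_dual_norm f"
begin

lemma \<Phi>_sum:
  assumes "finite J" "\<And>j. j \<in> J \<Longrightarrow> h j \<in> W_dual"
  shows "(\<lambda>x. \<Sum>j\<in>J. h j x) \<in> W_dual \<and> \<Phi> (\<lambda>x. \<Sum>j\<in>J. h j x) = (\<Sum>j\<in>J. \<Phi> (h j))"
  using assms
proof induction
  case empty
  show ?case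
    using dual_scale[OF coord_dual, of 0 0] \<Phi>_scale[OF coord_dual, of 0 0] by simp
next
  case (insert j J)
  then show ?case using \<Phi>_add[of "h j" "\<lambda>x. \<Sum>j\<in>J. h j x"] dual_add[of "h j" "\<lambda>x. \<Sum>j\<in>J. h j x"] by simp
qed

definition z :: "nat \<Rightarrow> real" where
  "z i = \<Phi> (\<lambda>x. ap x i)"

lemma \<Phi>_coord_sum:
  assumes "finite S"
  shows "\<Phi> (\<lambda>x. \<Sum>i\<in>S. c i * ap x i) = (\<Sum>i\<in>S. c i * z i)"
  using \<Phi>_sum[of S "\<lambda>i x. c i * ap x i"] assms coord_dual
  by (simp add: dual_scale \<Phi>_scale z_def)

text \<open>For each family, \<open>\<Phi>\<close> is tested on a functional supported there that
  attains the family norm of \<open>z\<close>: signs of \<open>z\<close> inside each set, weights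
  \<open>t A / Q\<close> across the sets. By Cauchy-Schwarz its dual norm is at most 1.\<close>

lemma finite_norm_z: "finite_norm z"
proof (rule finite_normI)
  fix \<G> assume G: "\<G> \<in> families D"
  define t where "t = (\<lambda>A. \<Sum>i\<in>A. \<bar>z i\<bar>)"
  define Q where "Q = fnorm \<G> z"
  have Q: "Q = L2_set t \<G>" by (simp add: Q_def t_def fnorm_def)
  show "fnorm \<G> z \<le> \<bar>C\<bar>"
  proof (cases "Q = 0")
    case True
    then show ?thesis by (simp add: Q_def)
  next
    case False
    then have Qpos: "0 < Q" using fnorm_nonneg[of \<G> z] by (simp add: Q_def)
    define h where "h = (\<lambda>A x. \<Sum>i\<in>A. (t A / Q * sgn (z i)) * ap x i)"
    define g where "g = (\<lambda>x. \<Sum>A\<in>\<G>. h A x)"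
    have h: "h A \<in> W_dual" for A
      unfolding h_def by (rule coord_sum_dual)
    have g: "g \<in> W_dual" "\<Phi> g = (\<Sum>A\<in>\<G>. \<Phi> (h A))"
      using \<Phi>_sum[OF families_disjoint(1)[OF G], of h] h unfolding g_def by auto
    have "\<Phi> (h A) = (t A)\<^sup>2 / Q" if "A \<in> \<G>" for A
    proof -
      have "\<Phi> (h A) = (\<Sum>i\<in>A. t A / Q * \<bar>z i\<bar>)"
        unfolding h_def using families_disjoint(3)[OF G that]
        by (subst \<Phi>_coord_sum) (auto simp: abs_sgn mult_ac intro!: sum.cong)
      also have "\<dots> = t A / Q * t A"
        unfolding sum_distrib_left[symmetric] by (simp add: t_def)
      finally show ?thesis by (simp add: power2_eq_square)
    qed
    then have "\<Phi> g = (\<Sum>A\<in>\<G>. (t A)\<^sup>2) / Q"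
      by (simp add: g(2) sum_divide_distrib)
    also have "(\<Sum>A\<in>\<G>. (t A)\<^sup>2) = Q\<^sup>2"
      by (simp add: Q L2_set_def sum_nonneg)
    finally have "\<Phi> g = Q" using Qpos by (simp add: power2_eq_square)
    moreover have "W_dual_norm g \<le> 1"
    proof (rule dual_norm_le)
      fix x assume x: "x \<in> W"
      have "\<bar>h A x\<bar> \<le> \<bar>t A\<bar> * \<bar>\<Sum>i\<in>A. \<bar>ap x i\<bar>\<bar> / Q" for A
      proof -
        have tA: "0 \<le> t A" by (simp add: t_def sum_nonneg)
        have "\<bar>h A x\<bar> \<le> (\<Sum>i\<in>A. t A / Q * \<bar>ap x i\<bar>)"
          unfolding h_def
        proof (intro order_trans[OF sum_abs] sum_mono)
          fix i
          have "\<bar>t A / Q * sgn (z i) * ap x i\<bar> = t A / Q * (\<bar>sgn (z i)\<bar> * \<bar>ap x i\<bar>)"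
            using tA Qpos by (simp add: abs_mult)
          also have "\<dots> \<le> t A / Q * (1 * \<bar>ap x i\<bar>)"
            using tA Qpos by (intro mult_left_mono mult_right_mono) (auto simp: sgn_real_def)
          finally show "\<bar>t A / Q * sgn (z i) * ap x i\<bar> \<le> t A / Q * \<bar>ap x i\<bar>" by simp
        qed
        also have "\<dots> = t A * (\<Sum>i\<in>A. \<bar>ap x i\<bar>) / Q"
          by (simp add: sum_distrib_left sum_divide_distrib)
        finally show ?thesis using tA by (simp add: sum_nonneg)
      qed
      then have "\<bar>g x\<bar> \<le> (\<Sum>A\<in>\<G>. \<bar>t A\<bar> * \<bar>\<Sum>i\<in>A. \<bar>ap x i\<bar>\<bar> / Q)"
        unfolding g_def by (intro order_trans[OF sum_abs] sum_mono)
      also have "\<dots> \<le> L2_set t \<G> * fnorm \<G> (ap x) / Q"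
        unfolding sum_divide_distrib[symmetric] fnorm_def
        using Qpos by (intro divide_right_mono L2_set_mult_ineq) auto
      also have "\<dots> = fnorm \<G> (ap x)" using Qpos by (simp add: Q[symmetric])
      also have "\<dots> \<le> nw x" unfolding nw_def by (intro fnorm_le_N W_finite_norm x G)
      finally show "\<bar>g x\<bar> \<le> 1 * nw x" by simp
    qed simp
    moreover have "0 \<le> W_dual_norm g"
      using abs_le_dual_norm[OF g(1) subspace_0[OF subspace_W]] banach_W subspace_0[OF subspace_W]
      by (force simp: banach_space_def)
    moreover from calculation have "C * W_dual_norm g \<le> \<bar>C\<bar> * 1"
      by (intro mult_mono) auto
    ultimately show ?thesis
      using \<Phi>_bound[OF g(1)] by (simp add: Q_def)
  qed
qed

text \<open>Both sides agree on finite combinations of coordinate functionals, and both are bounded;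
  \<open>dual_approx\<close> says that these combinations are dense in the dual.\<close>

lemma \<Phi>_eq_if_in_W:
  assumes zW: "bseq z \<in> W" and f: "f \<in> W_dual"
  shows "\<Phi> f = f (bseq z)"
proof -
  define B where "B = \<bar>C\<bar> + nw (bseq z)"
  have B: "0 \<le> B" using N_nonneg[OF W_finite_norm[OF zW]] by (simp add: B_def nw_def)
  have le: "\<bar>\<Phi> f - f (bseq z)\<bar> \<le> B * d" if d: "0 < d" for d
  proof -
    obtain n where n: "\<And>x. x \<in> W \<Longrightarrow> \<bar>f x - coord_approx f n x\<bar> \<le> d * nw x"
      using dual_approx[OF f d] by blast
    define g where "g = (\<lambda>x. \<Sum>i<n. f (bseq (kron i)) * ap x i)"
    have g: "g \<in> W_dual" unfolding g_def by (rule coord_sum_dual)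
    have fg: "(\<lambda>x. f x - g x) \<in> W_dual" using f g by (rule dual_diff)
    have close: "\<bar>f x - g x\<bar> \<le> d * nw x" if "x \<in> W" for x
      using n[OF that] by (simp add: coord_approx_def g_def mult.commute)
    have "\<Phi> f = \<Phi> (\<lambda>x. f x - g x) + \<Phi> g"
      using \<Phi>_add[OF fg g] by simp
    moreover have "\<Phi> g = g (bseq z)"
      by (simp add: g_def \<Phi>_coord_sum apply_bseq_N[OF finite_norm_z])
    moreover have "\<bar>\<Phi> (\<lambda>x. f x - g x)\<bar> \<le> \<bar>C\<bar> * d"
    proof -
      have "0 \<le> W_dual_norm (\<lambda>x. f x - g x)"
        using abs_le_dual_norm[OF fg subspace_0[OF subspace_W]] banach_W subspace_0[OF subspace_W]
        by (force simp: banach_space_def)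
      moreover have "W_dual_norm (\<lambda>x. f x - g x) \<le> d"
        using close d by (intro dual_norm_le) auto
      ultimately have "C * W_dual_norm (\<lambda>x. f x - g x) \<le> \<bar>C\<bar> * d"
        by (intro mult_mono) auto
      then show ?thesis using \<Phi>_bound[OF fg] by simp
    qed
    ultimately show ?thesis using close[OF zW] by (simp add: B_def algebra_simps)
  qed
  have "\<bar>\<Phi> f - f (bseq z)\<bar> \<le> 0"
  proof (rule field_le_epsilon)
    fix e :: real assume e: "0 < e"
    have "B * (e / (B + 1)) \<le> e" using B e by (simp add: field_simps)
    then show "\<bar>\<Phi> f - f (bseq z)\<bar> \<le> 0 + e"
      using le[of "e / (B + 1)"] B e by simp
  qed
  then show ?thesis by simp
qed

end

text \<open>James's criterion at work: the shrinking property reduces a bidual functional to its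
  coordinates \<open>z\<close>, and finite norm with vanishing tails (bounded completeness) places
  \<open>z\<close> in the space.\<close>

lemma reflexive_UNIV: "reflexive_space (baernstein.W UNIV) (baernstein.nw UNIV)"
  unfolding reflexive_space_def
proof (intro allI impI, elim conjE exE)
  fix \<Phi> :: "((nat \<Rightarrow>\<^sub>C real) \<Rightarrow> real) \<Rightarrow> real" and C
  let ?dual = "dual_space (baernstein.W UNIV) (baernstein.nw UNIV)"
  assume "\<forall>f\<in>?dual. \<forall>g\<in>?dual. \<Phi> (\<lambda>x. f x + g x) = \<Phi> f + \<Phi> g"
    "\<forall>f\<in>?dual. \<forall>c. \<Phi> (\<lambda>x. c * f x) = c * \<Phi> f"
    "\<forall>f\<in>?dual. \<bar>\<Phi> f\<bar> \<le> C * dual_norm (baernstein.W UNIV) (baernstein.nw UNIV) f"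
  then interpret baernstein_bidual UNIV \<Phi> C
    by unfold_locales auto
  have "bseq z \<in> W"
    using finite_norm_z tail_tendsto_0_UNIV[OF finite_norm_z] by (simp add: W_def apply_bseq_N)
  then show "\<exists>x\<in>baernstein.W UNIV. \<forall>f\<in>?dual. \<Phi> f = f x"
    using \<Phi>_eq_if_in_W by blast
qed

text \<open>The functional \<open>f \<mapsto> \<Sum>k. f (e\<^sub>k)\<close>, over \<open>k\<close> outside \<open>D\<close>, is represented by the indicator function of the
  complement of \<open>D\<close> only, whose tails do not vanish.\<close>

lemma not_reflexive_even: "\<not> reflexive_space (baernstein.W {n. even n}) (baernstein.nw {n. even n})"
proof
  interpret baernstein "{n. even n}" .
  assume refl: "reflexive_space W nw"
  define e where "e = (\<lambda>k. bseq (kron (2 * k + 1)))"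
  have e: "e k \<in> W" for k by (simp add: e_def bseq_in_W[OF support_below_kron])
  have summ: "summable (\<lambda>k. \<bar>f (e k)\<bar>)" "(\<Sum>k. \<bar>f (e k)\<bar>) \<le> W_dual_norm f" if f: "f \<in> W_dual" for f
  proof -
    have le: "(\<Sum>k<n. \<bar>f (e k)\<bar>) \<le> W_dual_norm f" for n
    proof -
      \<comment> \<open>Signs on odd coordinates cost nothing: admissible sets contain only even
        numbers, so only the singleton families see \<open>u\<close>, and its norm is at most
        1.\<close>
      define u where "u = (\<lambda>i. if odd i \<and> i < 2 * n then sgn (f (bseq (kron i))) else 0)"
      have u: "support_below (2 * n) u" by (simp add: u_def support_below_def)
      have Nu: "N u \<le> 1"
      proof (rule N_le)
        fix \<G> assume "\<G> \<in> families {n. even n}"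
        then consider i where "\<G> = {{i}}" | "\<And>A. A \<in> \<G> \<Longrightarrow> A \<subseteq> {n. even n}"
          by (auto simp: families_def admissible_def)
        then show "fnorm \<G> u \<le> 1"
        proof cases
          case 1
          then show ?thesis by (simp add: fnorm_singleton u_def sgn_real_def)
        next
          case 2
          then have "(\<Sum>i\<in>A. \<bar>u i\<bar>) = 0" if "A \<in> \<G>" for A
            using that by (intro sum.neutral) (auto simp: u_def)
          then show ?thesis by (simp add: fnorm_def L2_set_def)
        qed
      qed
      have "head (2 * n) u = u" using u by (auto simp: head_def support_below_def fun_eq_iff)
      then have "f (bseq u) = (\<Sum>i<2 * n. u i * f (bseq (kron i)))"
        using dual_head[OF f, of "2 * n" u] by simp
      also have "\<dots> = (\<Sum>i\<in>(\<lambda>k. 2 * k + 1) ` {..<n}. u i * f (bseq (kron i)))"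
        by (intro sum.mono_neutral_right) (auto simp: u_def elim!: oddE)
      also have "\<dots> = (\<Sum>k<n. \<bar>f (e k)\<bar>)"
        by (subst sum.reindex) (auto simp: inj_on_def u_def e_def abs_sgn mult.commute intro!: sum.cong)
      finally have "f (bseq u) = (\<Sum>k<n. \<bar>f (e k)\<bar>)" .
      then show ?thesis
        using Nu abs_le_dual_norm[OF f bseq_in_W[OF u]] nw_bseq[OF finite_norm_support(1)[OF u]] by simp
    qed
    then show "summable (\<lambda>k. \<bar>f (e k)\<bar>)"
      by (intro summableI_nonneg_bounded) auto
    then show "(\<Sum>k. \<bar>f (e k)\<bar>) \<le> W_dual_norm f"
      using le by (intro suminf_le_const)
  qed
  define \<Phi> where "\<Phi> = (\<lambda>f :: (nat \<Rightarrow>\<^sub>C real) \<Rightarrow> real. \<Sum>k. f (e k))"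
  have summ': "summable (\<lambda>k. f (e k))" if "f \<in> W_dual" for f
    using summ(1)[OF that] by (rule summable_rabs_cancel)
  have "\<exists>x\<in>W. \<forall>f\<in>W_dual. \<Phi> f = f x"
  proof (rule refl[unfolded reflexive_space_def, rule_format], intro conjI ballI allI exI)
    show "\<Phi> (\<lambda>x. f x + g x) = \<Phi> f + \<Phi> g" if "f \<in> W_dual" "g \<in> W_dual" for f g
      using suminf_add[OF summ'[OF that(1)] summ'[OF that(2)]] by (simp add: \<Phi>_def)
    show "\<Phi> (\<lambda>x. c * f x) = c * \<Phi> f" if "f \<in> W_dual" for f c
      using suminf_mult[OF summ'[OF that]] by (simp add: \<Phi>_def)
    show "\<bar>\<Phi> f\<bar> \<le> 1 * W_dual_norm f" if "f \<in> W_dual" for f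
      using order_trans[OF summable_rabs[OF summ(1)[OF that]] summ(2)[OF that]] by (simp add: \<Phi>_def)
  qed
  then obtain x where x: "x \<in> W" "\<And>f. f \<in> W_dual \<Longrightarrow> \<Phi> f = f x" by blast
  have x1: "ap x (2 * n + 1) = 1" for n
  proof -
    have "ap x (2 * n + 1) = (\<Sum>k. ap (e k) (2 * n + 1))"
      using x(2)[OF coord_dual] by (simp add: \<Phi>_def)
    also have "(\<lambda>k. ap (e k) (2 * n + 1)) = (\<lambda>k. if k = n then 1 else 0)"
      by (auto simp: e_def apply_bseq_N[OF finite_norm_kron] kron_def fun_eq_iff)
    finally show ?thesis using sums_unique[OF sums_single[of n "\<lambda>_. 1 :: real"]] by simp
  qed
  obtain n where n: "N (tail n (ap x)) < 1"
    using N_tail_small[of "ap x" 1] x(1) by (auto simp: W_def)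
  have "\<bar>tail n (ap x) (2 * n + 1)\<bar> \<le> N (tail n (ap x))"
    by (intro abs_le_N finite_norm_tail W_finite_norm x)
  then show False using n x1[of n] by (simp add: tail_def)
qed

section \<open>A Schreier sequence of continuous functions\<close>

definition clamp01 :: "real \<Rightarrow> real" where
  "clamp01 x = max 0 (min 1 x)"

lemma clamp01_bounds: "0 \<le> clamp01 x" "clamp01 x \<le> 1"
  by (auto simp: clamp01_def)

lemma continuous_on_clamp01 [continuous_intros]:
  "continuous_on S f \<Longrightarrow> continuous_on S (\<lambda>x. clamp01 (f x))"
  unfolding clamp01_def by (intro continuous_intros)

text \<open>A continuous version of the \<open>i\<close>-th ternary digit: on the Cantor set it is \<open>0\<close> or \<open>1\<close> when the digit is
  \<open>0\<close> or \<open>2\<close>.\<close>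

definition digit :: "nat \<Rightarrow> real \<Rightarrow> real" where
  "digit i t = clamp01 (1 / 2 - cos (pi * 3 ^ i * t))"

lemma digit_bounds: "0 \<le> digit i t" "digit i t \<le> 1"
  by (auto simp: digit_def clamp01_bounds)

lemma continuous_on_digit [continuous_intros]: "continuous_on S (digit i)"
  unfolding digit_def by (intro continuous_intros)

text \<open>The cosine takes the values 1/2 and -1/2 at pi/3 and 2 pi/3, so clamping makes the
  function constant on the first and on the last third of the interval.\<close>

lemma digit_0: "0 \<le> t \<Longrightarrow> t \<le> 1 / 3 \<Longrightarrow> digit 0 t = 0"
  using cos_monotone_0_pi_le[of "pi * t" "pi / 3"] pi_gt_zero
  by (simp add: digit_def clamp01_def cos_60 mult_left_le)

lemma digit_1: "2 / 3 \<le> t \<Longrightarrow> t \<le> 1 \<Longrightarrow> digit 0 t = 1"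
  using cos_monotone_0_pi_le[of "2 * pi / 3" "pi * t"] pi_gt_zero cos_120
  by (simp add: digit_def clamp01_def mult_left_le)

lemma digit_Suc: "digit (Suc i) t = digit i (3 * t)"
  by (simp add: digit_def mult_ac)

text \<open>Period 2 fits ternary digits: prepending the digit 2 to \<open>u\<close> gives
  \<open>t = (u + 2) / 3\<close>, and then \<open>3 * t\<close> differs from \<open>u\<close> by one
  period.\<close>

lemma digit_shift: "digit i (t + 2 * real k) = digit i t"
proof -
  have "pi * 3 ^ i * (t + 2 * real k) = pi * 3 ^ i * t + real (3 ^ i * k) * (2 * pi)"
    by (simp add: algebra_simps)
  then show ?thesis
    using cos.plus_of_nat[of "pi * 3 ^ i * t" "3 ^ i * k"] by (simp add: digit_def)
qed

text \<open>The point has ternary digits \<open>2 * b i\<close>, and the induction prepends a digit.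
  The second clause concerns the first nonzero digit: with nothing before it,
  \<open>3 ^ i * t\<close> lies in the last third, where \<open>bump\<close> is 1.\<close>

lemma ex_digits:
  "\<exists>t\<in>{0..1}. (\<forall>i<n. digit i t = (if b i then 1 else 0)) \<and>
     (\<forall>i<n. (\<forall>j<i. \<not> b j) \<longrightarrow> b i \<longrightarrow> 3 ^ i * t \<in> {2 / 3..1})"
proof (induction n arbitrary: b)
  case 0
  then show ?case by (intro bexI[of _ 0]) auto
next
  case (Suc n)
  obtain u where u: "u \<in> {0..1}" "\<And>i. i < n \<Longrightarrow> digit i u = (if b (Suc i) then 1 else 0)"
    "\<And>i. i < n \<Longrightarrow> \<forall>j<i. \<not> b (Suc j) \<Longrightarrow> b (Suc i) \<Longrightarrow> 3 ^ i * u \<in> {2 / 3..1}"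
    using Suc.IH[of "\<lambda>i. b (Suc i)"] by auto
  define t where "t = (u + 2 * real (of_bool (b 0))) / 3"
  have t: "t \<in> {0..1}" using u(1) by (auto simp: t_def)
  have "digit i t = (if b i then 1 else 0)" if "i < Suc n" for i
  proof (cases i)
    case 0
    then show ?thesis using u(1) by (auto simp: t_def intro!: digit_0 digit_1)
  next
    case (Suc j)
    have "3 * t = u + 2 * real (of_bool (b 0))"
      by (simp add: t_def)
    then have "digit i t = digit j (u + 2 * real (of_bool (b 0)))"
      by (simp only: Suc digit_Suc)
    also have "\<dots> = digit j u" by (rule digit_shift)
    finally show ?thesis using u(2)[of j] that Suc by simp
  qed
  moreover have "3 ^ i * t \<in> {2 / 3..1}" if "i < Suc n" "\<forall>j<i. \<not> b j" "b i" for i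
  proof (cases i)
    case 0
    then show ?thesis using u(1) that by (auto simp: t_def)
  next
    case (Suc j)
    then have "\<not> b 0" "\<forall>k<j. \<not> b (Suc k)" using that by auto
    then show ?thesis using u(3)[of j] that Suc by (auto simp: t_def)
  qed
  ultimately show ?case using t by blast
qed

text \<open>The functions \<open>bump (3 ^ k * t)\<close> have disjoint supports. On the support of the \<open>k\<close>-th one, \<open>schreier\<close>
  consists of the increments of the digit sums starting at \<open>k\<close>, truncated at \<open>k + 1\<close>: every set \<open>F\<close> with
  \<open>card F \<le> Min F + 1\<close> occurs as a pattern of ones, while the total sum stays bounded by \<open>k + 1\<close>.\<close>

definition bump :: "real \<Rightarrow> real" where
  "bump x = max 0 (min 1 (min (6 * x - 3) (3 - 2 * x)))"

definition digit_sum :: "nat \<Rightarrow> nat \<Rightarrow> real \<Rightarrow> real" where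
  "digit_sum k n t = (\<Sum>i=k..<n. digit i t)"

definition increment :: "nat \<Rightarrow> nat \<Rightarrow> real \<Rightarrow> real" where
  "increment k n t = min (real k + 1) (digit_sum k (Suc n) t) - min (real k + 1) (digit_sum k n t)"

definition schreier :: "nat \<Rightarrow> real \<Rightarrow> real" where
  "schreier n t = (\<Sum>k\<le>n. bump (3 ^ k * t) * increment k n t)"

lemma bump_bounds: "0 \<le> bump x" "bump x \<le> 1"
  by (auto simp: bump_def)

lemma bump_eq_1: "2 / 3 \<le> x \<Longrightarrow> x \<le> 1 \<Longrightarrow> bump x = 1"
  by (auto simp: bump_def)

lemma bump_nonzero: "bump x \<noteq> 0 \<Longrightarrow> 1 / 2 < x \<and> x < 3 / 2"
  by (auto simp: bump_def max_def min_def split: if_splits)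

text \<open>The support of \<open>bump\<close> lies in [1/2, 3/2], whose endpoints have ratio 3;
  scalings by different powers of 3 can meet only at endpoints, where \<open>bump\<close> is
  0.\<close>

lemma bump_disjoint:
  assumes "bump (3 ^ k * t) \<noteq> 0" "bump (3 ^ l * t) \<noteq> 0"
  shows "k = l"
proof -
  have no: False if "k < l" "bump (3 ^ k * t) \<noteq> 0" "bump (3 ^ l * t) \<noteq> 0" for k l
  proof -
    have b: "1 / 2 < 3 ^ k * t" "3 ^ l * t < 3 / 2"
      using bump_nonzero that by blast+
    have "0 < t"
    proof (rule ccontr)
      assume "\<not> 0 < t"
      then have "3 ^ k * t \<le> 0" by (intro mult_nonneg_nonpos) auto
      then show False using b by simp
    qed
    have "(3::real) ^ Suc k \<le> 3 ^ l" using that by (intro power_increasing) auto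
    then have "3 ^ Suc k * t \<le> 3 ^ l * t" using \<open>0 < t\<close> by (intro mult_right_mono) auto
    then show False using b by simp
  qed
  show ?thesis using no[of k l] no[of l k] assms by (cases k l rule: linorder_cases) auto
qed

lemma digit_sum_Suc: "k \<le> n \<Longrightarrow> digit_sum k (Suc n) t = digit_sum k n t + digit n t"
  by (simp add: digit_sum_def)

lemma increment_bounds:
  assumes "k \<le> n"
  shows "0 \<le> increment k n t" "increment k n t \<le> 1"
  using digit_bounds[of n t] by (auto simp: increment_def digit_sum_Suc[OF assms])

lemma continuous_on_schreier: "continuous_on S (schreier n)"
  unfolding schreier_def bump_def increment_def digit_sum_def
  by (intro continuous_intros)

lemma schreier_cases:
  obtains k where "\<And>n. schreier n t = (if k \<le> n then bump (3 ^ k * t) * increment k n t else 0)"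
proof (cases "\<exists>k. bump (3 ^ k * t) \<noteq> 0")
  case True
  then obtain k where k: "bump (3 ^ k * t) \<noteq> 0" by blast
  have "schreier n t = (\<Sum>l\<le>n. if l = k then bump (3 ^ k * t) * increment k n t else 0)" for n
    unfolding schreier_def using bump_disjoint[OF k] by (intro sum.cong) auto
  then show thesis by (intro that[of k]) simp
next
  case False
  \<comment> \<open>At points where no bump is active, \<open>k = 0\<close> is as good as any other
    value: its product vanishes too.\<close>
  then have "bump (3 ^ k * t) = 0" for k by blast
  then show thesis by (intro that[of 0]) (simp add: schreier_def del: power_0)
qed

lemma schreier_bounds: "0 \<le> schreier n t" "schreier n t \<le> 1"
proof -
  obtain k where k: "\<And>n. schreier n t = (if k \<le> n then bump (3 ^ k * t) * increment k n t else 0)"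
    using schreier_cases[of t] by blast
  show "0 \<le> schreier n t" "schreier n t \<le> 1"
    using bump_bounds increment_bounds[of k n t] by (auto simp: k intro!: mult_le_one)
qed

text \<open>The same \<open>k\<close> is the index before which everything vanishes and, up to 1,
  the bound for all sums, since the truncated digit sums telescope. Points where many functions are
  large are thus reached late, and this makes the sequence weakly null.\<close>

lemma schreier_sparse:
  "\<exists>k. (\<forall>n<k. schreier n t = 0) \<and> (\<forall>A. finite A \<longrightarrow> (\<Sum>n\<in>A. schreier n t) \<le> real k + 1)"
proof -
  obtain k where k: "\<And>n. schreier n t = (if k \<le> n then bump (3 ^ k * t) * increment k n t else 0)"
    using schreier_cases[of t] by blast
  have "(\<Sum>n\<in>A. schreier n t) \<le> real k + 1" if A: "finite A" for A
  proof -
    obtain m where "A \<subseteq> {..<m}" using A finite_nat_iff_bounded by blast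
    then have m: "A \<subseteq> {..<k + m}" by auto
    have "(\<Sum>n\<in>A. schreier n t) \<le> (\<Sum>n<k + m. schreier n t)"
      using m schreier_bounds by (intro sum_mono2) auto
    also have "\<dots> = (\<Sum>n=k..<k + m. schreier n t)"
      by (intro sum.mono_neutral_right) (auto simp: k)
    also have "\<dots> \<le> (\<Sum>n=k..<k + m. increment k n t)"
      using bump_bounds increment_bounds(1) by (intro sum_mono) (auto simp: k mult_left_le_one_le)
    also have "\<dots> = min (real k + 1) (digit_sum k (k + m) t) - min (real k + 1) (digit_sum k k t)"
      unfolding increment_def by (rule sum_Suc_diff') simp
    also have "\<dots> \<le> real k + 1" by (simp add: digit_sum_def)
    finally show ?thesis .
  qed
  then show ?thesis by (intro exI[of _ k]) (auto simp: k)
qed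

text \<open>Take the point with digit pattern \<open>F\<close> and let \<open>k\<close> be the
  minimum of \<open>F\<close>. Its bump is active there, and the truncation at \<open>k + 1\<close>
  never bites because \<open>card F\<close> is at most \<open>k + 1\<close>; so each digit 1 yields
  an increment of 1.\<close>

lemma schreier_eq_1:
  assumes F: "finite F" "F \<noteq> {}" "card F \<le> Suc (Min F)"
  shows "\<exists>t\<in>{0..1}. \<forall>n\<in>F. schreier n t = 1"
proof -
  define m where "m = Suc (Max F)"
  have m: "n < m" if "n \<in> F" for n using F(1) that by (simp add: m_def less_Suc_eq_le)
  obtain t where t: "t \<in> {0..1}" "\<And>i. i < m \<Longrightarrow> digit i t = (if i \<in> F then 1 else 0)"
    "\<And>i. i < m \<Longrightarrow> \<forall>j<i. j \<notin> F \<Longrightarrow> i \<in> F \<Longrightarrow> 3 ^ i * t \<in> {2 / 3..1}"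
    using ex_digits[of m "\<lambda>i. i \<in> F"] by blast
  define k where "k = Min F"
  have k: "k \<in> F" "\<And>n. n \<in> F \<Longrightarrow> k \<le> n" using F by (auto simp: k_def)
  have "\<forall>j<k. j \<notin> F" using k(2) leD by blast
  then have b: "bump (3 ^ k * t) = 1"
    using t(3)[OF m[OF k(1)]] k(1) by (intro bump_eq_1) auto
  have ds: "digit_sum k n t = real (card (F \<inter> {k..<n}))" if "n \<le> m" for n
  proof -
    have "digit_sum k n t = (\<Sum>i=k..<n. if i \<in> F then 1 else 0)"
      unfolding digit_sum_def using that by (intro sum.cong) (auto simp: t(2))
    then show ?thesis by (simp add: sum.If_cases Int_commute)
  qed
  have card_le: "real (card (F \<inter> {k..<n})) \<le> real k + 1" for n
  proof -
    have "card (F \<inter> {k..<n}) \<le> card F" using F(1) by (intro card_mono) auto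
    then show ?thesis using F(3) by (simp add: k_def)
  qed
  have "schreier n t = 1" if n: "n \<in> F" for n
  proof -
    have inc: "increment k n t = 1"
      using card_le[of n] card_le[of "Suc n"] m[OF n] digit_sum_Suc[OF k(2)[OF n], of t] t(2)[OF m[OF n]] n
      by (simp add: increment_def ds min_def) 
    have "schreier n t = (\<Sum>l\<le>n. if l = k then 1 else 0)"
      unfolding schreier_def
    proof (intro sum.cong refl)
      fix l
      show "bump (3 ^ l * t) * increment l n t = (if l = k then 1 else 0)"
        using bump_disjoint[of l t k] b inc by (cases "l = k") auto
    qed
    then show ?thesis using k(2)[OF n] by simp
  qed
  with t(1) show ?thesis by blast
qed

section \<open>The space of continuous functions\<close>

lemma C01_eq: "f \<in> C01 \<Longrightarrow> ap f t = ap f (clamp01 t)"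
  by (simp add: C01_def clamp01_def)

lemma C01_bdd: "bdd_above ((\<lambda>t. \<bar>ap f t\<bar>) ` A)"
  using norm_bounded[of f] by (intro bdd_aboveI2) auto

lemma abs_le_C01_norm: "t \<in> {0..1} \<Longrightarrow> \<bar>ap f t\<bar> \<le> C01_norm f"
  unfolding C01_norm_def by (intro cSUP_upper C01_bdd)

lemma C01_norm_le: "(\<And>t. t \<in> {0..1} \<Longrightarrow> \<bar>ap f t\<bar> \<le> B) \<Longrightarrow> C01_norm f \<le> B"
  unfolding C01_norm_def by (intro cSUP_least) auto

lemma C01_norm_eq_norm:
  assumes "f \<in> C01"
  shows "C01_norm f = norm f"
proof (rule antisym)
  show "C01_norm f \<le> norm f"
    using norm_bounded[of f] by (intro C01_norm_le) auto
  have "norm (ap f t) \<le> C01_norm f" for t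
    using abs_le_C01_norm[of "clamp01 t" f] clamp01_bounds C01_eq[OF assms, of t] by simp
  then show "norm f \<le> C01_norm f" by (rule norm_bound)
qed

lemma subspace_C01: "subspace C01"
  by (rule subspaceI) (auto simp: C01_def plus_bcontfun.rep_eq scaleR_bcontfun.rep_eq)

lemma banach_C01: "banach_space C01 C01_norm"
  unfolding banach_space_def
proof (intro conjI ballI allI impI)
  show "subspace C01" by (rule subspace_C01)
next
  fix f assume "f \<in> C01"
  then show "C01_norm f = 0 \<longleftrightarrow> f = 0" by (simp add: C01_norm_eq_norm)
next
  fix f g assume "f \<in> C01" "g \<in> C01"
  then show "C01_norm (f + g) \<le> C01_norm f + C01_norm g"
    by (simp add: C01_norm_eq_norm subspace_add[OF subspace_C01] norm_triangle_ineq)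
next
  fix f and c :: real assume "f \<in> C01"
  then show "C01_norm (c *\<^sub>R f) = \<bar>c\<bar> * C01_norm f"
    by (simp add: C01_norm_eq_norm subspace_scale[OF subspace_C01])
next
  fix s :: "nat \<Rightarrow> real \<Rightarrow>\<^sub>C real"
  assume s: "(\<forall>n. s n \<in> C01) \<and> (\<forall>e>0. \<exists>N. \<forall>m\<ge>N. \<forall>n\<ge>N. C01_norm (s m - s n) < e)"
  have diff: "C01_norm (s m - s n) = dist (s m) (s n)" for m n
    using s by (simp add: C01_norm_eq_norm subspace_diff[OF subspace_C01] dist_norm)
  then have "Cauchy s" using s by (intro metric_CauchyI) simp
  then obtain x where x: "s \<longlonglongrightarrow> x" by (auto simp: Cauchy_convergent_iff convergent_def)
  have lim: "(\<lambda>n. ap (s n) t) \<longlonglongrightarrow> ap x t" for t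
  proof (rule LIMSEQ_I)
    fix e :: real assume "0 < e"
    then obtain N where "\<And>n. n \<ge> N \<Longrightarrow> dist (s n) x < e" using x by (auto simp: lim_sequentially)
    then have "norm (ap (s n) t - ap x t) < e" if "n \<ge> N" for n
      using dist_fun_lt_imp_dist_val_lt[of "s n" x e t] that by (simp add: dist_norm)
    then show "\<exists>N. \<forall>n\<ge>N. norm (ap (s n) t - ap x t) < e" by blast
  qed
  have "ap x t = ap x (clamp01 t)" for t
  proof -
    have "(\<lambda>n. ap (s n) t) = (\<lambda>n. ap (s n) (clamp01 t))"
      using C01_eq s by blast
    then have "(\<lambda>n. ap (s n) t) \<longlonglongrightarrow> ap x (clamp01 t)"
      using lim[of "clamp01 t"] by (simp only:)
    then show ?thesis by (rule LIMSEQ_unique[OF lim])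
  qed
  then have xC: "x \<in> C01" by (simp add: C01_def clamp01_def)
  have "(\<lambda>n. C01_norm (s n - x)) = (\<lambda>n. dist (s n) x)"
    using s xC by (simp add: C01_norm_eq_norm subspace_diff[OF subspace_C01] dist_norm)
  then have "(\<lambda>n. C01_norm (s n - x)) \<longlonglongrightarrow> 0"
    using tendsto_dist_iff[THEN iffD1, OF x] by (simp only:)
  with xC show "\<exists>x\<in>C01. (\<lambda>n. C01_norm (s n - x)) \<longlonglongrightarrow> 0" ..
qed

definition schreier_fun :: "nat \<Rightarrow> real \<Rightarrow>\<^sub>C real" where
  "schreier_fun n = Bcontfun (\<lambda>t. schreier n (clamp01 t))"

lemma ap_schreier_fun: "ap (schreier_fun n) t = schreier n (clamp01 t)"
proof -
  have "continuous_on UNIV (\<lambda>t. schreier n (clamp01 t))"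
    by (rule continuous_on_compose2[OF continuous_on_schreier[of UNIV n]]) (auto intro!: continuous_intros)
  then have "(\<lambda>t. schreier n (clamp01 t)) \<in> bcontfun"
    using schreier_bounds by (intro bcontfun_normI[of _ 1]) auto
  then show ?thesis by (simp add: schreier_fun_def Bcontfun_inverse)
qed

lemma clamp01_id: "t \<in> {0..1} \<Longrightarrow> clamp01 t = t"
  by (auto simp: clamp01_def)

lemma schreier_fun_C01: "schreier_fun n \<in> C01"
  by (simp add: C01_def ap_schreier_fun clamp01_def)

lemma ap_sum: "ap (\<Sum>i\<in>A. c i *\<^sub>R g i) t = (\<Sum>i\<in>A. c i * ap (g i) t)"
  by (induction A rule: infinite_finite_induct) (auto simp: plus_bcontfun.rep_eq scaleR_bcontfun.rep_eq)

text \<open>If a functional were at least \<open>d\<close> on infinitely many of the functions, then so it would be on averages \<open>w\<close>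
  over long blocks; but a sum of \<open>m\<close> such averages has norm at most \<open>1 + m * h\<close> for every prescribed \<open>h > 0\<close>.\<close>

lemma dual_schreier_fun_small:
  assumes f: "f \<in> dual_space C01 C01_norm" and d: "0 < d"
  shows "finite {n. d \<le> f (schreier_fun n)}"
proof (rule ccontr)
  assume inf: "infinite {n. d \<le> f (schreier_fun n)}"
  define L where "L = {n. d \<le> f (schreier_fun n)}"
  obtain C where C: "\<And>x. x \<in> C01 \<Longrightarrow> \<bar>f x\<bar> \<le> C * C01_norm x"
    using f unfolding dual_space_def by blast
  have fadd: "f (x + y) = f x + f y" if "x \<in> C01" "y \<in> C01" for x y
    using f that unfolding dual_space_def by blast
  have fscale: "f (c *\<^sub>R x) = c * f x" if "x \<in> C01" for c x
    using f that unfolding dual_space_def by blast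
  have fsum: "f (\<Sum>i\<in>A. x i) = (\<Sum>i\<in>A. f (x i))" if "finite A" "\<And>i. x i \<in> C01" for A and x :: "nat \<Rightarrow> _"
    using that(1)
  proof induction
    case empty
    show ?case using fscale[OF subspace_0[OF subspace_C01], of 0] by simp
  next
    case (insert i A)
    then show ?case using that(2) by (simp add: fadd subspace_sum[OF subspace_C01])
  qed
  define D where "D = max C 1"
  have D: "0 < D" "C \<le> D" by (auto simp: D_def)
  \<comment> \<open>With this \<open>h\<close> the upper bound for \<open>f v\<close> is
    \<open>D + m * d / 2\<close>, which falls below the lower bound \<open>m * d\<close> once
    \<open>m\<close> exceeds \<open>2 * D / d\<close>.\<close>
  define h where "h = d / (2 * D)"
  have h: "0 < h" using d D by (simp add: h_def)
  have "\<exists>v M. v \<in> C01 \<and> real m * d \<le> f v \<and> (\<forall>t. 0 \<le> ap v t \<and> ap v t \<le> 1 + real m * h) \<and>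
      (\<forall>t. (\<forall>n<M. schreier n (clamp01 t) = 0) \<longrightarrow> ap v t = 0)" for m
  proof (induction m)
    case 0
    have "f 0 = 0" using fscale[OF subspace_0[OF subspace_C01], of 0] by simp
    then show ?case by (intro exI[of _ 0]) (simp add: subspace_0[OF subspace_C01])
  next
    case (Suc m)
    then obtain v M where v: "v \<in> C01" "real m * d \<le> f v" "\<And>t. 0 \<le> ap v t" "\<And>t. ap v t \<le> 1 + real m * h"
      "\<And>t. (\<forall>n<M. schreier n (clamp01 t) = 0) \<Longrightarrow> ap v t = 0" by blast
    \<comment> \<open>The average is taken over so many functions that a sum bounded by
      \<open>M + 1\<close> becomes at most \<open>h\<close>.\<close>
    obtain K :: nat where K: "(real M + 1) / h < real K" using reals_Archimedean2 by blast
    then have K0: "0 < real K" using h by (meson add_nonneg_pos divide_pos_pos less_trans of_nat_0_le_iff zero_less_one)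
    have "infinite (L - {..<M})" using inf by (simp add: L_def)
    then obtain A where A: "finite A" "card A = K" "A \<subseteq> L - {..<M}"
      by (meson infinite_arbitrarily_large)
    define w where "w = (\<Sum>n\<in>A. (1 / real K) *\<^sub>R schreier_fun n)"
    have wC: "w \<in> C01"
      unfolding w_def by (intro subspace_sum subspace_scale subspace_C01 schreier_fun_C01)
    have ap_w: "ap w t = (\<Sum>n\<in>A. schreier n (clamp01 t)) / real K" for t
      by (simp add: w_def ap_sum ap_schreier_fun sum_divide_distrib)
    have w0: "0 \<le> ap w t" for t
      by (simp add: ap_w sum_nonneg schreier_bounds)
    have w1: "ap w t \<le> 1" for t
    proof -
      have "(\<Sum>n\<in>A. schreier n (clamp01 t)) \<le> real K"
        using sum_bounded_above[of A "\<lambda>n. schreier n (clamp01 t)" 1] schreier_bounds(2) A(2) by simp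
      then show ?thesis using K0 by (simp add: ap_w)
    qed
    have "d \<le> f w"
    proof -
      have "f w = (\<Sum>n\<in>A. 1 / real K * f (schreier_fun n))"
        unfolding w_def using A(1) subspace_scale[OF subspace_C01 schreier_fun_C01]
        by (simp add: fsum fscale schreier_fun_C01)
      also have "\<dots> \<ge> (\<Sum>n\<in>A. 1 / real K * d)"
        using A(3) by (intro sum_mono mult_left_mono) (auto simp: L_def)
      finally show ?thesis using K0 A(2) by simp
    qed
    then have 1: "real (Suc m) * d \<le> f (v + w)"
      using v(1,2) wC by (simp add: fadd algebra_simps)
    have 2: "ap (v + w) t \<le> 1 + real (Suc m) * h" for t
    proof -
      obtain k where k: "\<And>n. n < k \<Longrightarrow> schreier n (clamp01 t) = 0"
        "\<And>A. finite A \<Longrightarrow> (\<Sum>n\<in>A. schreier n (clamp01 t)) \<le> real k + 1"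
        using schreier_sparse[of "clamp01 t"] by blast
      show ?thesis
      \<comment> \<open>Either the functions with index below \<open>M\<close> all vanish at the
        point, and then so does \<open>v\<close>; or the new sum is at most \<open>M + 1\<close>
        there, and \<open>w\<close> adds no more than \<open>h\<close>.\<close>
      proof (cases "M \<le> k")
        case True
        then have "ap v t = 0" using k(1) by (intro v(5)) auto
        then show ?thesis using w1[of t] h by (simp add: plus_bcontfun.rep_eq add_increasing2)
      next
        case False
        then have "(\<Sum>n\<in>A. schreier n (clamp01 t)) \<le> real M + 1" using k(2)[OF A(1)] by simp
        also have "\<dots> \<le> h * real K" using K h by (simp add: field_simps)
        finally have "ap w t \<le> h" using K0 by (simp add: ap_w field_simps)
        then show ?thesis using v(4)[of t] by (simp add: plus_bcontfun.rep_eq algebra_simps)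
      qed
    qed
    define M' where "M' = max M (Suc (Max (insert 0 A)))"
    have M': "n < M'" if "n \<in> A" for n
      using A(1) that by (simp add: M'_def less_max_iff_disj less_Suc_eq_le)
    have 3: "ap (v + w) t = 0" if t: "\<forall>n<M'. schreier n (clamp01 t) = 0" for t
    proof -
      have "ap v t = 0" using t by (intro v(5)) (auto simp: M'_def)
      moreover have "ap w t = 0" using t M' by (simp add: ap_w)
      ultimately show ?thesis by (simp add: plus_bcontfun.rep_eq)
    qed
    show ?case
      using 1 2 3 v(1,3) w0 wC subspace_add[OF subspace_C01]
      by (intro exI[of _ "v + w"] exI[of _ M']) (auto simp: plus_bcontfun.rep_eq)
  qed
  moreover obtain m :: nat where m: "2 * D / d < real m" using reals_Archimedean2 by blast
  ultimately obtain v where v: "v \<in> C01" "real m * d \<le> f v" "\<And>t. 0 \<le> ap v t" "\<And>t. ap v t \<le> 1 + real m * h"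
    by blast
  have nv: "C01_norm v \<le> 1 + real m * h" using v(3,4) by (intro C01_norm_le) simp
  have "f v \<le> C * C01_norm v" using C[OF v(1)] by simp
  also have "\<dots> \<le> D * (1 + real m * h)"
    using D nv abs_le_C01_norm[of 0 v] by (intro mult_mono) auto
  also have "\<dots> = D + real m * d / 2" using D by (simp add: h_def algebra_simps)
  finally show False using v(2) m d by (simp add: field_simps)
qed

lemma not_weak_banach_saks_C01: "\<not> weak_banach_saks C01 C01_norm"
proof (rule banach_pair.not_weak_banach_saksI[OF banach_pair.intro[OF banach_C01], of schreier_fun "1 / 2"])
  fix f assume f: "f \<in> dual_space C01 C01_norm"
  have neg: "(\<lambda>x. - f x) \<in> dual_space C01 C01_norm"
    using f unfolding dual_space_def by auto
  show "(\<lambda>k. f (schreier_fun k)) \<longlonglongrightarrow> 0"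
  proof (rule LIMSEQ_I)
    fix e :: real assume e: "0 < e"
    have "finite ({n. e \<le> f (schreier_fun n)} \<union> {n. e \<le> - f (schreier_fun n)})"
      using dual_schreier_fun_small[OF f e] dual_schreier_fun_small[OF neg e] by simp
    then obtain N where N: "\<And>n. n \<in> {n. e \<le> f (schreier_fun n)} \<union> {n. e \<le> - f (schreier_fun n)} \<Longrightarrow> n < N"
      using finite_nat_set_iff_bounded by auto
    have "norm (f (schreier_fun n) - 0) < e" if "n \<ge> N" for n
      using N[of n] that by (force simp: abs_less_iff)
    then show "\<exists>N. \<forall>n\<ge>N. norm (f (schreier_fun n) - 0) < e" by blast
  qed
next
  fix r :: "nat \<Rightarrow> nat" and k
  assume r: "strict_mono r"
  define mu where "mu = means (schreier_fun \<circ> r)"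
  have ap_mean: "ap (mu m) t = (\<Sum>j\<le>m. schreier (r j) (clamp01 t)) / real (Suc m)" for m t
    using ap_sum[of "\<lambda>_. 1" "schreier_fun \<circ> r" "{..m}" t]
    by (simp add: mu_def means_def scaleR_bcontfun.rep_eq ap_schreier_fun)
  define F where "F = r ` {Suc k..<2 * Suc k}"
  have "inj_on r {Suc k..<2 * Suc k}" using r by (auto simp: inj_on_def strict_mono_eq)
  then have cF: "card F = Suc k" by (simp add: F_def card_image)
  then have F: "finite F" "F \<noteq> {}" by (auto simp: F_def)
  have "k \<le> i" if i: "i \<in> F" for i
  proof -
    obtain j where "j \<in> {Suc k..<2 * Suc k}" "i = r j" using i unfolding F_def by blast
    then show ?thesis using seq_suble[OF r, of j] by auto
  qed
  then have "card F \<le> Suc (Min F)" using F cF by simp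
  then obtain t where t: "t \<in> {0..1}" "\<And>n. n \<in> F \<Longrightarrow> schreier n t = 1"
    using schreier_eq_1[OF F] by blast
  have "real (Suc k) = (\<Sum>j=Suc k..<2 * Suc k. schreier (r j) t)"
    using t(2) by (simp add: F_def)
  also have "\<dots> \<le> (\<Sum>j\<le>2 * Suc k - 1. schreier (r j) t)"
    using schreier_bounds by (intro sum_mono2) auto
  finally have "real (Suc k) / real (2 * Suc k) \<le> ap (mu (2 * Suc k - 1)) t"
    by (simp add: ap_mean clamp01_id[OF t(1)] divide_right_mono)
  moreover have "real (Suc k) / real (2 * Suc k) = 1 / 2"
    by (simp add: field_simps)
  ultimately have "1 / 2 \<le> ap (mu (2 * Suc k - 1)) t" by (simp only:)
  then show "1 / 2 \<le> C01_norm (means (schreier_fun \<circ> r) (2 * Suc k - 1))"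
    using abs_le_C01_norm[OF t(1), of "mu (2 * Suc k - 1)"] by (simp add: mu_def)
qed (simp_all add: schreier_fun_C01)

theorem theorem5p1:
  fixes V :: "'a::real_vector set" and nrm :: "'a \<Rightarrow> real"
  assumes "banach_space V nrm"
  shows "(weak_banach_saks V nrm \<longrightarrow> wbs V nrm (unit_ball V nrm) = 0) \<and>
         (\<not> weak_banach_saks V nrm \<longrightarrow> wbs V nrm (unit_ball V nrm) = 2) \<and>
         (\<exists>(W :: (nat \<Rightarrow>\<^sub>C real) set) nw. banach_space W nw \<and> separable_space W nw \<and>
             reflexive_space W nw \<and>
             bs W nw (unit_ball W nw) = 2 \<and> wbs W nw (unit_ball W nw) = 2) \<and>
         (\<exists>(W :: (nat \<Rightarrow>\<^sub>C real) set) nw. banach_space W nw \<and> \<not> reflexive_space W nw \<and>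
             separable_dual W nw \<and>
             bs W nw (unit_ball W nw) = 2 \<and> wbs W nw (unit_ball W nw) = 2) \<and>
         (bs C01 C01_norm (unit_ball C01 C01_norm) = 2 \<and>
          wbs C01 C01_norm (unit_ball C01 C01_norm) = 2)"
proof -
  interpret V: banach_pair V nrm using assms by unfold_locales
  \<comment> \<open>Polymorphic in the carrier type, as it serves both the sequence spaces and
    C[0,1].\<close>
  have two: "bs W nw (unit_ball W nw) = 2 \<and> wbs W nw (unit_ball W nw) = 2"
    if "banach_space W nw" "\<not> weak_banach_saks W nw" for W :: "'b::real_vector set" and nw
    using banach_pair.bs_eq_2[of W nw] banach_pair.wbs_eq_2[of W nw] that by (simp add: banach_pair_def)
  show ?thesis
  proof (intro conjI)
    show "weak_banach_saks V nrm \<longrightarrow> wbs V nrm (unit_ball V nrm) = 0" using V.wbs_eq_0 by blast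
    show "\<not> weak_banach_saks V nrm \<longrightarrow> wbs V nrm (unit_ball V nrm) = 2" using V.wbs_eq_2 by blast
    show "\<exists>(W :: (nat \<Rightarrow>\<^sub>C real) set) nw. banach_space W nw \<and> separable_space W nw \<and>
        reflexive_space W nw \<and> bs W nw (unit_ball W nw) = 2 \<and> wbs W nw (unit_ball W nw) = 2"
      using baernstein.banach_W baernstein.separable_W reflexive_UNIV
        two[OF baernstein.banach_W baernstein.not_weak_banach_saks_W[of UNIV]] by blast
    show "\<exists>(W :: (nat \<Rightarrow>\<^sub>C real) set) nw. banach_space W nw \<and> \<not> reflexive_space W nw \<and>
        separable_dual W nw \<and> bs W nw (unit_ball W nw) = 2 \<and> wbs W nw (unit_ball W nw) = 2"
      using baernstein.banach_W baernstein.separable_dual_W not_reflexive_even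
        two[OF baernstein.banach_W baernstein.not_weak_banach_saks_W[of "{n. even n}"]] by blast
    show "bs C01 C01_norm (unit_ball C01 C01_norm) = 2" "wbs C01 C01_norm (unit_ball C01 C01_norm) = 2"
      using two[OF banach_C01 not_weak_banach_saks_C01] by auto
  qed
qed

end
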